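(* Given a stable assignment instance $(G,<,\mathbf{q})$ with $G=(A\cup B,E)$, the graph $G_L=(A\cup B,\bar E)$, where $\bar E$ is the set of legal edges (edges contained in some legal assignment), can be computed in time $O(|E|)$.
   Context: A stable assignment instance is $(G,<,\mathbf{q})$ with $G=(A\cup B,E)$ a finite simple bipartite graph (students $A$, schools $B$), $<_v$ a strict total order on the neighbours of each vertex $v$ (write $y>_x y'$ and $y>_x\emptyset$ for each neighbour $y$), and positive integer quotas $q_b$, $b\in B$. An assignment is $M\subseteq E$ with each student in at most one edge and each school $b$ in at most $q_b$ edges of $M$; $M(x)=\{y:xy\in M\}$ (for a student identified with its element or $\emptyset$). Edge $ab$ blocks $M$ if $b>_a M(a)$ and either $|M(b)|<q_b$ or $a>_b a'$ for some $a'\in M(b)$; an assignment blocks $M$ if one of its edges blocks $M$. A set $\mathcal{L}$ of assignments has the legal property if the assignments blocked by some member of $\mathcal{L}$ are exactly the assignments not in $\mathcal{L}$; there is exactly one such set, whose members are the legal assignments. *)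

theory Defs
  imports Main
begin

section \<open>Stable assignment instances and legal assignments\<close>

text \<open>
  Students and schools live on separate sides, so a finite simple bipartite graph is a finite set of
  pairs. \<open>(y', y) \<in> student_ord I a\<close> reads \<open>y' <\<^sub>a y\<close>, i.e. \<open>a\<close> prefers \<open>y\<close> to \<open>y'\<close>; likewise for
  \<open>school_ord\<close>.
\<close>

record ('a, 'b) assignment_instance =
  students :: "'a set"
  schools :: "'b set"
  edges :: "('a \<times> 'b) set"
  student_ord :: "'a \<Rightarrow> ('b \<times> 'b) set"
  school_ord :: "'b \<Rightarrow> ('a \<times> 'a) set"
  quota :: "'b \<Rightarrow> nat"

definition strict_total_order_of :: "'x set \<Rightarrow> ('x \<times> 'x) set \<Rightarrow> bool" where
  "strict_total_order_of X r \<longleftrightarrow> r \<subseteq> X \<times> X \<and> strict_linear_order_on X r"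

definition stable_assignment_instance :: "('a, 'b) assignment_instance \<Rightarrow> bool" where
  "stable_assignment_instance I \<longleftrightarrow>
     finite (students I) \<and> finite (schools I) \<and>
     edges I \<subseteq> students I \<times> schools I \<and>
     (\<forall>a \<in> students I. strict_total_order_of (edges I `` {a}) (student_ord I a)) \<and>
     (\<forall>b \<in> schools I. strict_total_order_of ((edges I)\<inverse> `` {b}) (school_ord I b)) \<and>
     (\<forall>b \<in> schools I. quota I b > 0)"

definition is_assignment :: "('a, 'b) assignment_instance \<Rightarrow> ('a \<times> 'b) set \<Rightarrow> bool" where
  "is_assignment I M \<longleftrightarrow>
     M \<subseteq> edges I \<and>
     (\<forall>a \<in> students I. card (M `` {a}) \<le> 1) \<and>
     (\<forall>b \<in> schools I. card (M\<inverse> `` {b}) \<le> quota I b)"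

text \<open>
  For an assignment \<open>M\<close>, the set \<open>M `` {a}\<close> is empty or a singleton, so the first conjunct below says
  \<open>b >\<^sub>a M(a)\<close>, including the case \<open>M(a) = \<emptyset>\<close>.
\<close>

definition edge_blocks ::
  "('a, 'b) assignment_instance \<Rightarrow> 'a \<times> 'b \<Rightarrow> ('a \<times> 'b) set \<Rightarrow> bool" where
  "edge_blocks I e M \<longleftrightarrow> e \<in> edges I \<and>
     (case e of (a, b) \<Rightarrow>
        (\<forall>b' \<in> M `` {a}. (b', b) \<in> student_ord I a) \<and>
        (card (M\<inverse> `` {b}) < quota I b \<or> (\<exists>a' \<in> M\<inverse> `` {b}. (a', a) \<in> school_ord I b)))"

definition blocks ::
  "('a, 'b) assignment_instance \<Rightarrow> ('a \<times> 'b) set \<Rightarrow> ('a \<times> 'b) set \<Rightarrow> bool" where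
  "blocks I M' M \<longleftrightarrow> (\<exists>e \<in> M'. edge_blocks I e M)"

definition legal_property ::
  "('a, 'b) assignment_instance \<Rightarrow> ('a \<times> 'b) set set \<Rightarrow> bool" where
  "legal_property I L \<longleftrightarrow>
     L \<subseteq> {M. is_assignment I M} \<and>
     {M. is_assignment I M \<and> (\<exists>M' \<in> L. blocks I M' M)} = {M. is_assignment I M} - L"

definition legal_assignments :: "('a, 'b) assignment_instance \<Rightarrow> ('a \<times> 'b) set set" where
  "legal_assignments I = (THE L. legal_property I L)"

definition legal_edges :: "('a, 'b) assignment_instance \<Rightarrow> ('a \<times> 'b) set" where
  "legal_edges I = {e \<in> edges I. \<exists>M \<in> legal_assignments I. e \<in> M}"

definition legal_graph ::
  "('a, 'b) assignment_instance \<Rightarrow> 'a set \<times> 'b set \<times> ('a \<times> 'b) set" where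
  "legal_graph I = (students I, schools I, legal_edges I)"


section \<open>A unit-cost random access machine\<close>

text \<open>
  Programs are structured commands over a memory of natural numbers that is organised in named,
  unbounded arrays with random access; a scalar is cell 0 of an array. A program mentions only
  finitely many arrays. The only arithmetic is successor and predecessor, so after time \<open>t\<close> every
  number in memory is at most \<open>t\<close> plus the largest input number or program constant, and unit cost
  cannot be abused to compute with huge numbers. Every operation, memory access, constant and test
  costs one unit.
\<close>

type_synonym memory = "string \<Rightarrow> nat \<Rightarrow> nat"

datatype aexp =
    Const nat
  | Read string aexp
  | Succ aexp
  | Pred aexp

datatype bexp =
    Less aexp aexp
  | Equal aexp aexp
  | Neg bexp
  | Conj bexp bexp

datatype com =
    Skip
  | Write string aexp aexp
  | Seq com com
  | Cond bexp com com
  | While bexp com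

fun aval :: "aexp \<Rightarrow> memory \<Rightarrow> nat" where
  "aval (Const n) s = n"
| "aval (Read x e) s = s x (aval e s)"
| "aval (Succ e) s = aval e s + 1"
| "aval (Pred e) s = aval e s - 1"

fun acost :: "aexp \<Rightarrow> nat" where
  "acost (Const n) = 1"
| "acost (Read x e) = 1 + acost e"
| "acost (Succ e) = 1 + acost e"
| "acost (Pred e) = 1 + acost e"

fun bval :: "bexp \<Rightarrow> memory \<Rightarrow> bool" where
  "bval (Less e f) s \<longleftrightarrow> aval e s < aval f s"
| "bval (Equal e f) s \<longleftrightarrow> aval e s = aval f s"
| "bval (Neg b) s \<longleftrightarrow> \<not> bval b s"
| "bval (Conj b c) s \<longleftrightarrow> bval b s \<and> bval c s"

fun bcost :: "bexp \<Rightarrow> nat" where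
  "bcost (Less e f) = 1 + acost e + acost f"
| "bcost (Equal e f) = 1 + acost e + acost f"
| "bcost (Neg b) = 1 + bcost b"
| "bcost (Conj b c) = 1 + bcost b + bcost c"

text \<open>\<open>runs p s t s'\<close>: started in \<open>s\<close>, program \<open>p\<close> halts in \<open>s'\<close> after exactly \<open>t\<close> time units.\<close>

inductive runs :: "com \<Rightarrow> memory \<Rightarrow> nat \<Rightarrow> memory \<Rightarrow> bool" where
  Skip: "runs Skip s 1 s"
| Write: "runs (Write x e f) s (1 + acost e + acost f) (s(x := (s x)(aval e s := aval f s)))"
| Seq: "runs p s t s' \<Longrightarrow> runs q s' t' s'' \<Longrightarrow> runs (Seq p q) s (t + t') s''"
| CondTrue: "bval b s \<Longrightarrow> runs p s t s' \<Longrightarrow> runs (Cond b p q) s (1 + bcost b + t) s'"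
| CondFalse: "\<not> bval b s \<Longrightarrow> runs q s t s' \<Longrightarrow> runs (Cond b p q) s (1 + bcost b + t) s'"
| WhileFalse: "\<not> bval b s \<Longrightarrow> runs (While b p) s (1 + bcost b) s"
| WhileTrue: "bval b s \<Longrightarrow> runs p s t s' \<Longrightarrow> runs (While b p) s' t' s'' \<Longrightarrow>
    runs (While b p) s (1 + bcost b + t + t') s''"


section \<open>Input and output format\<close>

text \<open>For the machine, students and schools are numbered consecutively from 0.\<close>

definition numbered_instance :: "(nat, nat) assignment_instance \<Rightarrow> bool" where
  "numbered_instance I \<longleftrightarrow> stable_assignment_instance I \<and>
     students I = {..<card (students I)} \<and> schools I = {..<card (schools I)}"

text \<open>
  The preference lists of all students, most preferred neighbour first, written one after the other;
  likewise for the schools. Each entry is stored as an edge, so that isolated vertices take no space.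
\<close>

definition student_listing :: "(nat, nat) assignment_instance \<Rightarrow> (nat \<times> nat) list \<Rightarrow> bool" where
  "student_listing I xs \<longleftrightarrow> set xs = edges I \<and>
     sorted_wrt (\<lambda>(a, b) (a', b'). a < a' \<or> a = a' \<and> (b', b) \<in> student_ord I a) xs"

definition school_listing :: "(nat, nat) assignment_instance \<Rightarrow> (nat \<times> nat) list \<Rightarrow> bool" where
  "school_listing I ys \<longleftrightarrow> set ys = edges I \<and>
     sorted_wrt (\<lambda>(a, b) (a', b'). b < b' \<or> b = b' \<and> (a', a) \<in> school_ord I b) ys"

definition array :: "nat list \<Rightarrow> nat \<Rightarrow> nat" where
  "array ns i = (if i < length ns then ns ! i else 0)"

definition input_memory ::
  "(nat, nat) assignment_instance \<Rightarrow> (nat \<times> nat) list \<Rightarrow> (nat \<times> nat) list \<Rightarrow> memory" where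
  "input_memory I xs ys = (\<lambda>x i. 0)
     (''students'' := array [card (students I)],
      ''schools'' := array [card (schools I)],
      ''edges'' := array [card (edges I)],
      ''student_list_a'' := array (map fst xs),
      ''student_list_b'' := array (map snd xs),
      ''school_list_a'' := array (map fst ys),
      ''school_list_b'' := array (map snd ys),
      ''quota'' := array (map (quota I) [0..<card (schools I)]))"

definition output_edges :: "memory \<Rightarrow> (nat \<times> nat) list" where
  "output_edges s = map (\<lambda>i. (s ''out_a'' i, s ''out_b'' i)) [0..<s ''out_edges'' 0]"

definition outputs_graph :: "memory \<Rightarrow> nat set \<times> nat set \<times> (nat \<times> nat) set \<Rightarrow> bool" where
  "outputs_graph s G \<longleftrightarrow> distinct (output_edges s) \<and>
     G = ({..<s ''out_students'' 0}, {..<s ''out_schools'' 0}, set (output_edges s))"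

text \<open>Every instance has an input representation, and programs are deterministic.\<close>

lemma ex_sorted_wrt_listing:
  assumes "finite X"
    and "\<And>x y z. x \<in> X \<Longrightarrow> y \<in> X \<Longrightarrow> z \<in> X \<Longrightarrow> R x y \<Longrightarrow> R y z \<Longrightarrow> R x z"
    and "\<And>x. x \<in> X \<Longrightarrow> \<not> R x x"
    and "\<And>x y. x \<in> X \<Longrightarrow> y \<in> X \<Longrightarrow> x \<noteq> y \<Longrightarrow> R x y \<or> R y x"
  shows "\<exists>xs. set xs = X \<and> sorted_wrt R xs"
  using assms
proof (induction X rule: finite_induct)
  case empty
  then show ?case by auto
next
  case (insert x X)
  have "\<exists>xs. set xs = X \<and> sorted_wrt R xs"
    by (rule insert.IH) (use insert.prems in blast)+
  then obtain xs where xs: "set xs = X" "sorted_wrt R xs" by blast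
  let ?l = "filter (\<lambda>y. R y x) xs" and ?r = "filter (\<lambda>y. R x y) xs"
  have tot: "R y x \<or> R x y" if "y \<in> X" for y
    using insert.prems(3)[of y x] insert.hyps that by auto
  have "set (?l @ x # ?r) = insert x X"
    using xs tot by auto
  moreover have "sorted_wrt R (?l @ x # ?r)"
    using xs insert.prems(1) by (auto simp: sorted_wrt_append sorted_wrt_filter)
  ultimately show ?case by blast
qed

lemma finite_edges: "stable_assignment_instance I \<Longrightarrow> finite (edges I)"
  unfolding stable_assignment_instance_def by (meson finite_SigmaI finite_subset)

lemma ex_student_listing:
  assumes "numbered_instance I"
  shows "\<exists>xs. student_listing I xs"
proof -
  have I: "stable_assignment_instance I" using assms by (simp add: numbered_instance_def)
  have o: "trans (student_ord I a)" "irrefl (student_ord I a)"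
    "total_on (edges I `` {a}) (student_ord I a)" if "(a, b) \<in> edges I" for a b
    using I that unfolding stable_assignment_instance_def strict_total_order_of_def
      strict_linear_order_on_def by blast+
  show ?thesis unfolding student_listing_def
  proof (rule ex_sorted_wrt_listing[OF finite_edges[OF I]], goal_cases)
    case (1 x y z)
    then show ?case using o(1) by (auto dest: transD)
  next
    case (2 x)
    then show ?case using o(2) by (auto simp: irrefl_def)
  next
    case (3 x y)
    obtain a b a' b' where xy: "x = (a, b)" "y = (a', b')" by (metis surj_pair)
    show ?case
    proof (cases "a = a'")
      case True
      then have "(b, b') \<in> student_ord I a \<or> (b', b) \<in> student_ord I a"
        using o(3)[of a b] 3 xy unfolding total_on_def by auto
      then show ?thesis using xy True by auto
    next
      case False
      then show ?thesis using xy by auto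
    qed
  qed
qed

lemma ex_school_listing:
  assumes "numbered_instance I"
  shows "\<exists>ys. school_listing I ys"
proof -
  have I: "stable_assignment_instance I" using assms by (simp add: numbered_instance_def)
  have o: "trans (school_ord I b)" "irrefl (school_ord I b)"
    "total_on ((edges I)\<inverse> `` {b}) (school_ord I b)" if "(a, b) \<in> edges I" for a b
    using I that unfolding stable_assignment_instance_def strict_total_order_of_def
      strict_linear_order_on_def by blast+
  show ?thesis unfolding school_listing_def
  proof (rule ex_sorted_wrt_listing[OF finite_edges[OF I]], goal_cases)
    case (1 x y z)
    then show ?case using o(1) by (auto dest: transD)
  next
    case (2 x)
    then show ?case using o(2) by (auto simp: irrefl_def)
  next
    case (3 x y)
    obtain a b a' b' where xy: "x = (a, b)" "y = (a', b')" by (metis surj_pair)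
    show ?case
    proof (cases "b = b'")
      case True
      then have "(a, a') \<in> school_ord I b \<or> (a', a) \<in> school_ord I b"
        using o(3)[of a b] 3 xy unfolding total_on_def by auto
      then show ?thesis using xy True by auto
    next
      case False
      then show ?thesis using xy by auto
    qed
  qed
qed

inductive_cases runs_elims:
  "runs Skip s t s'" "runs (Write x e f) s t s'" "runs (Seq p q) s t s'"
  "runs (Cond b p q) s t s'" "runs (While b p) s t s'"

lemma runs_deterministic:
  "runs p s t s' \<Longrightarrow> runs p s u s'' \<Longrightarrow> t = u \<and> s' = s''"
proof (induction arbitrary: u s'' rule: runs.induct)
  case (Seq p s t s' q t' r)
  from Seq.prems show ?case by (rule runs_elims) (metis Seq.IH)
next
  case (WhileTrue b s p t s' t' r)
  from WhileTrue.prems obtain v w s1 where *: "u = 1 + bcost b + v + w" "runs p s v s1"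
    "runs (While b p) s1 w s''"
    by (rule runs_elims) (use WhileTrue.hyps in simp_all)
  have "t = v \<and> s' = s1" by (rule WhileTrue.IH(1)[OF *(2)])
  moreover from this have "t' = w \<and> r = s''" using *(3) WhileTrue.IH(2) by blast
  ultimately show ?case using *(1) by simp
next
  case (WhileFalse b s p)
  from WhileFalse.prems show ?case by (rule runs_elims) (use WhileFalse.hyps in simp_all)
next
  case (CondTrue b s p t s' q)
  from CondTrue.prems obtain v where "u = 1 + bcost b + v" "runs p s v s''"
    by (rule runs_elims) (use CondTrue.hyps in simp_all)
  then show ?case using CondTrue.IH by simp
next
  case (CondFalse b s q t s' p)
  from CondFalse.prems obtain v where "u = 1 + bcost b + v" "runs q s v s''"
    by (rule runs_elims) (use CondFalse.hyps in simp_all)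
  then show ?case using CondFalse.IH by simp
next
  case (Skip s)
  from Skip.prems show ?case by (rule runs_elims) simp
next
  case (Write x e f s)
  from Write.prems show ?case by (rule runs_elims) simp
qed

end

theory Submission
  imports Defs
begin

text \<open>
  Start from a stable assignment \<open>M\<^sub>0\<close>, found by deferred acceptance, and let one side propose further down its lists.
  If vertices on that side displace each other cyclically, execute the rotation. If a proposal would displace a vertex
  that has no proposal left, the proposed edge lies in no legal assignment and is removed. Doing this from \<open>M\<^sub>0\<close> for
  either side yields two chains of assignments, which together form one chain for the preference of the students, so
  the visited assignments do not block each other.

  Double counting shows that two assignments that do not block each other differ only by edges which are gained at one
  endpoint and lost at the other. Hence an assignment not blocked by any visited edge contains no removed edge, does not
  block any visited assignment, and, since both phases end with every vertex dead, uses visited edges only. It follows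
  that the assignments not blocked by visited edges form the unique legal set, and that the legal edges are precisely
  the visited ones.

  Every pointer moves monotonically through a preference list, and the path to the next rotation or removal is kept on
  a stack, so the total work is linear in the number of edges.
\<close>

section \<open>Two-sided markets and the exchange argument\<close>

text \<open>The time bound counts edges only, so no stage may loop over vertices or clear an array
  indexed by them: loops run over listing positions or are paid for by pointer moves, memory that
  starts at zero replaces initialisation, and the flags \<open>ons\<close> are reset while the stack
  is popped. Fullness is tested in constant time because neither a rotation nor a removal changes
  the number of edges at a vertex, so flags computed at the stable assignment stay valid. When
  schools propose, a proposer may hold several edges; being worse than all of them then takes the
  place of being next on the list, and one argument with quotas on both sides serves both runs. A
  removal is sound because accepting the edge would oblige the displaced owner to take an edge below
  its present ones, where only removed edges are left. The legal set is given by a definite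
  description, so its existence and uniqueness must come out of the runs themselves. An edge outside
  \<open>M0\<close> is rejected by some side at \<open>M0\<close>, and it is searched for in the run
  in which that side proposes.\<close>

text \<open>Both sides get quotas, which makes the theory symmetric in the side \<open>d\<close>; students are the side
  \<open>d = True\<close>, with quota 1. Smaller ranks are better.\<close>

locale two_sided =
  fixes E :: "'e set" and vt :: "bool \<Rightarrow> 'e \<Rightarrow> 'v" and rk :: "bool \<Rightarrow> 'e \<Rightarrow> nat"
    and qt :: "bool \<Rightarrow> 'v \<Rightarrow> nat"
  assumes finite_E: "finite E"
    and rk_inj: "e \<in> E \<Longrightarrow> f \<in> E \<Longrightarrow> vt d e = vt d f \<Longrightarrow> rk d e = rk d f \<Longrightarrow> e = f"
begin

definition star :: "bool \<Rightarrow> 'v \<Rightarrow> 'e set \<Rightarrow> 'e set" where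
  "star d v M = {e \<in> M. vt d e = v}"

definition asg :: "'e set \<Rightarrow> bool" where
  "asg M \<longleftrightarrow> M \<subseteq> E \<and> (\<forall>d v. card (star d v M) \<le> qt d v)"

definition worse :: "bool \<Rightarrow> 'e set \<Rightarrow> 'e \<Rightarrow> bool" where
  "worse d M e \<longleftrightarrow> (\<forall>f \<in> star d (vt d e) M. rk d f < rk d e)"

definition full :: "bool \<Rightarrow> 'e set \<Rightarrow> 'v \<Rightarrow> bool" where
  "full d M v \<longleftrightarrow> qt d v \<le> card (star d v M)"

definition rej :: "bool \<Rightarrow> 'e set \<Rightarrow> 'e \<Rightarrow> bool" where
  "rej d M e \<longleftrightarrow> full d M (vt d e) \<and> worse d M e"

definition blk :: "'e set \<Rightarrow> 'e \<Rightarrow> bool" where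
  "blk M e \<longleftrightarrow> e \<in> E - M \<and> (\<forall>d. \<not> rej d M e)"

definition unblocked :: "'e set \<Rightarrow> 'e set \<Rightarrow> bool" where
  "unblocked N M \<longleftrightarrow> (\<forall>e \<in> N. \<not> blk M e)"

lemma mem_star [simp]: "e \<in> star d v M \<longleftrightarrow> e \<in> M \<and> vt d e = v"
  by (auto simp: star_def)

lemma asg_finite: "asg M \<Longrightarrow> finite M"
  using finite_E finite_subset by (auto simp: asg_def)

lemma finite_star: "finite M \<Longrightarrow> finite (star d v M)"
  by (auto simp: star_def)

lemma unblocked_rej: "unblocked N M \<Longrightarrow> N \<subseteq> E \<Longrightarrow> e \<in> N - M \<Longrightarrow> \<exists>d. rej d M e"
  by (auto simp: unblocked_def blk_def)

text \<open>\<open>M\<close> is preferred to \<open>N\<close> at the vertex \<open>v\<close> of side \<open>d\<close>.\<close>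

definition gains :: "'e set \<Rightarrow> 'e set \<Rightarrow> bool \<Rightarrow> 'v \<Rightarrow> bool" where
  "gains M N d v \<longleftrightarrow> (\<exists>e \<in> N - M. vt d e = v \<and> rej d M e)"

text \<open>Both together would give an edge of \<open>N\<close> and an edge of \<open>M\<close> at
  one vertex, each ranked below the other.\<close>

lemma gains_disjoint: "gains M N d v \<Longrightarrow> \<not> gains N M d v"
  unfolding gains_def rej_def worse_def by (metis DiffD1 less_asym mem_star)

lemma sum_card_star:
  assumes "finite D" "finite P" "\<And>e d. e \<in> D \<Longrightarrow> p d (vt d e) \<Longrightarrow> (d, vt d e) \<in> P"
    and "\<And>d v. (d, v) \<in> P \<Longrightarrow> p d v"
  shows "(\<Sum>(d, v)\<in>P. card (star d v D)) = (\<Sum>e\<in>D. card {d. p d (vt d e)})"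
proof -
  have "(\<Sum>(d, v)\<in>P. card (star d v D)) = (\<Sum>x\<in>P. \<Sum>e\<in>D. if vt (fst x) e = snd x then 1 else 0)"
    using assms(1) by (intro sum.cong) (auto simp: star_def sum.If_cases Int_def)
  also have "\<dots> = (\<Sum>e\<in>D. \<Sum>x\<in>P. if vt (fst x) e = snd x then 1 else 0)"
    by (rule sum.swap)
  also have "\<dots> = (\<Sum>e\<in>D. card {d. p d (vt d e)})"
  proof (intro sum.cong refl)
    fix e assume e: "e \<in> D"
    have "(\<Sum>x\<in>P. if vt (fst x) e = snd x then 1 else (0::nat)) = card {x \<in> P. vt (fst x) e = snd x}"
      using assms(2) by (simp add: sum.If_cases Int_def)
    also have "{x \<in> P. vt (fst x) e = snd x} = (\<lambda>d. (d, vt d e)) ` {d. p d (vt d e)}"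
      using assms(3)[OF e] assms(4) by force
    also have "card \<dots> = card {d. p d (vt d e)}"
      by (intro card_image) (auto simp: inj_on_def)
    finally show "(\<Sum>x\<in>P. if vt (fst x) e = snd x then 1 else 0) = card {d. p d (vt d e)}" .
  qed
  finally show ?thesis .
qed

text \<open>Counts pairs of an edge and a gaining endpoint in two ways. Restricting to endpoints of
  \<open>E\<close> keeps the index set finite, since the vertex type is arbitrary.\<close>

lemma sum_gains:
  assumes "D \<subseteq> E"
  shows "(\<Sum>e\<in>D. card {d. gains M N d (vt d e)})
    = (\<Sum>(d, v)\<in>{(d, v). gains M N d v \<and> v \<in> vt d ` E}. card (star d v D))"
  and "finite {(d, v). gains M N d v \<and> v \<in> vt d ` E}"
proof -
  show fin: "finite {(d, v). gains M N d v \<and> v \<in> vt d ` E}"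
    by (rule finite_subset[of _ "SIGMA d:UNIV. vt d ` E"]) (auto simp: finite_E)
  show "(\<Sum>e\<in>D. card {d. gains M N d (vt d e)})
    = (\<Sum>(d, v)\<in>{(d, v). gains M N d v \<and> v \<in> vt d ` E}. card (star d v D))"
    using assms fin finite_E by (subst sum_card_star) (auto intro: finite_subset)
qed

text \<open>\<open>N\<close> respects the quota that \<open>M\<close> fills at \<open>v\<close>;
  cancelling the common edges leaves the claim.\<close>

lemma card_star_diff:
  assumes M: "asg M" and N: "asg N" and "full d M v"
  shows "card (star d v (N - M)) \<le> card (star d v (M - N))"
proof -
  have fin: "finite M" "finite N" using M N asg_finite by auto
  have "card (star d v N) \<le> card (star d v M)"
    using N assms(3) by (auto simp: asg_def full_def intro: order_trans)
  moreover have "card (star d v N) = card (star d v (N - M)) + card (star d v (N \<inter> M))"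
    "card (star d v M) = card (star d v (M - N)) + card (star d v (N \<inter> M))"
    using fin by (subst card_Un_disjoint[symmetric]; auto simp: star_def intro!: arg_cong[of _ _ card])+
  ultimately show ?thesis by simp
qed

text \<open>Each edge of \<open>N - M\<close> is rejected by \<open>M\<close> at some endpoint,
  which then gains; each edge of \<open>M - N\<close> is rejected by \<open>N\<close> at some
  endpoint, which then cannot gain. Gaining vertices are full in \<open>M\<close>, whence the middle
  inequality.\<close>

lemma gains_counts:
  assumes M: "asg M" and N: "asg N" and "unblocked N M" "unblocked M N"
  defines "g \<equiv> \<lambda>e. card {d. gains M N d (vt d e)}"
  shows "card (N - M) \<le> sum g (N - M)" "sum g (N - M) \<le> sum g (M - N)" "sum g (M - N) \<le> card (M - N)"
    "e \<in> N - M \<Longrightarrow> 1 \<le> g e" "e \<in> M - N \<Longrightarrow> g e \<le> 1"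
proof -
  have sub: "M \<subseteq> E" "N \<subseteq> E" using M N by (auto simp: asg_def)
  let ?P = "{(d, v). gains M N d v \<and> v \<in> vt d ` E}"
  have s: "sum g D = (\<Sum>(d, v)\<in>?P. card (star d v D))" if "D \<subseteq> E" for D
    unfolding g_def by (rule sum_gains[OF that])
  show *: "1 \<le> g e" if e: "e \<in> N - M" for e
  proof -
    obtain d where "rej d M e" using unblocked_rej[OF assms(3) sub(2) e] by blast
    then have "{d. gains M N d (vt d e)} \<noteq> {}" using e by (auto simp: gains_def)
    then show ?thesis unfolding g_def by (simp add: Suc_le_eq card_gt_0_iff)
  qed
  show **: "g e \<le> 1" if e: "e \<in> M - N" for e
  proof -
    obtain d where "rej d N e" using unblocked_rej[OF assms(4) sub(1) e] by blast
    then have "gains N M d (vt d e)" using e by (auto simp: gains_def)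
    then have "\<not> gains M N d (vt d e)" by (rule gains_disjoint)
    then have "{d. gains M N d (vt d e)} \<subseteq> {\<not> d}"
      by (cases d; auto; case_tac x; auto)
    then show ?thesis unfolding g_def using card_mono[of "{\<not> d}"] by force
  qed
  show "card (N - M) \<le> sum g (N - M)"
    using sum_mono[of "N - M" "\<lambda>_. 1" g] * by simp
  show "sum g (M - N) \<le> card (M - N)"
    using sum_mono[of "M - N" g "\<lambda>_. 1"] ** by simp
  have "(\<Sum>(d, v)\<in>?P. card (star d v (N - M))) \<le> (\<Sum>(d, v)\<in>?P. card (star d v (M - N)))"
    by (intro sum_mono) (auto simp: gains_def rej_def intro!: card_star_diff[OF M N])
  then show "sum g (N - M) \<le> sum g (M - N)"
    using s[of "N - M"] s[of "M - N"] sub(1) sub(2) Diff_subset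
    by (metis (no_types, lifting) order_trans)
qed

lemma sum_eq_card_imp_1:
  fixes g :: "'x \<Rightarrow> nat"
  assumes "finite D" "sum g D = card D" "(\<forall>e\<in>D. 1 \<le> g e) \<or> (\<forall>e\<in>D. g e \<le> 1)" "e \<in> D"
  shows "g e = 1"
proof (rule ccontr)
  assume ne: "g e \<noteq> 1"
  from assms(3) show False
  proof
    assume a: "\<forall>e\<in>D. 1 \<le> g e"
    have "sum (\<lambda>_. 1) D < sum g D"
      using a ne assms by (intro sum_strict_mono_ex1) (auto simp: order_le_less)
    then show False using assms by simp
  next
    assume a: "\<forall>e\<in>D. g e \<le> 1"
    have "sum g D < sum (\<lambda>_. 1) D"
      using a ne assms by (intro sum_strict_mono_ex1) (auto simp: order_le_less)
    then show False using assms by simp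
  qed
qed

text \<open>If two assignments do not block each other, the inequalities of \<open>gains_counts\<close> for \<open>(M, N)\<close> and \<open>(N, M)\<close>
  form a cycle, so all of them are equalities.\<close>

lemma exchange_sides:
  assumes M: "asg M" and N: "asg N" and MN: "unblocked N M" and NM: "unblocked M N"
    and e: "e \<in> N - M"
  shows "\<exists>d. gains M N d (vt d e) \<and> gains N M (\<not> d) (vt (\<not> d) e)"
proof -
  have fin: "finite (M - N)" "finite (N - M)" using M N asg_finite by auto
  note 1 = gains_counts[OF M N MN NM]
  note 2 = gains_counts[OF N M NM MN]
  have "card {d. gains M N d (vt d e)} = 1"
    by (rule sum_eq_card_imp_1[OF fin(2) _ _ e]) (use 1 2 in auto)
  moreover have "card {d. gains N M d (vt d e)} = 1"
    by (rule sum_eq_card_imp_1[OF fin(2) _ _ e]) (use 1 2 in auto)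
  ultimately obtain x y where xy: "{d. gains M N d (vt d e)} = {x}" "{d. gains N M d (vt d e)} = {y}"
    by (metis card_1_singletonE)
  then have "x \<noteq> y" using gains_disjoint[of M N x "vt x e"] by blast
  then have "y = (\<not> x)" by (cases x; cases y) auto
  then have "gains M N x (vt x e) \<and> gains N M (\<not> x) (vt (\<not> x) e)" using xy by blast
  then show ?thesis by (rule exI)
qed

text \<open>A relative of the rural hospitals theorem: the two middle sums agree, and each term of
  one is bounded by the term of the other, so they agree term by term.\<close>

lemma gains_card_eq:
  assumes M: "asg M" and N: "asg N" and MN: "unblocked N M" and NM: "unblocked M N"
    and g: "gains M N d v"
  shows "card (star d v M) = card (star d v N)"
proof -
  have fin: "finite M" "finite N" using M N asg_finite by auto
  have sub: "M \<subseteq> E" "N \<subseteq> E" using M N by (auto simp: asg_def)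
  let ?P = "{(d, v). gains M N d v \<and> v \<in> vt d ` E}"
  note finP = sum_gains(2)[OF subset_refl, of M N]
  have ND: "N - M \<subseteq> E" "M - N \<subseteq> E" using sub by auto
  have le: "card (star d v (N - M)) \<le> card (star d v (M - N))" if "gains M N d v" for d v
    using that card_star_diff[OF M N] by (auto simp: gains_def rej_def)
  have "(\<Sum>(d, v)\<in>?P. card (star d v (N - M))) = (\<Sum>(d, v)\<in>?P. card (star d v (M - N)))"
    using gains_counts(1-3)[OF M N MN NM] gains_counts(1-3)[OF N M NM MN]
    unfolding sum_gains(1)[OF ND(1)] sum_gains(1)[OF ND(2)] by linarith
  moreover have "(d, v) \<in> ?P" using g sub by (auto simp: gains_def)
  ultimately have "card (star d v (N - M)) = card (star d v (M - N))"
    using le finP sum_mono_inv[of "\<lambda>(d, v). card (star d v (N - M))" ?P "\<lambda>(d, v). card (star d v (M - N))" "(d, v)"]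
    by auto
  moreover have "card (star d v N) = card (star d v (N - M)) + card (star d v (N \<inter> M))"
    "card (star d v M) = card (star d v (M - N)) + card (star d v (N \<inter> M))"
    using fin by (subst card_Un_disjoint[symmetric]; auto simp: star_def intro!: arg_cong[of _ _ card])+
  ultimately show ?thesis by simp
qed

text \<open>Since \<open>e\<close> is below everything \<open>M\<close> holds on side
  \<open>d\<close>, \<open>N\<close> cannot gain there, so \<open>exchange_sides\<close> decides
  which endpoint gains. The last two conclusions rule out the first two cases of
  \<open>removable\<close> for edges of \<open>N\<close>.\<close>

lemma exchange_worse:
  assumes M: "asg M" and N: "asg N" and MN: "unblocked N M" and NM: "unblocked M N"
    and e: "e \<in> N - M" and w: "worse d M e"
  shows "gains M N d (vt d e)" "gains N M (\<not> d) (vt (\<not> d) e)"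
    "full (\<not> d) M (vt (\<not> d) e)" "\<not> worse (\<not> d) M e"
proof -
  have "\<not> gains N M d (vt d e)"
    using w e unfolding gains_def rej_def worse_def by (metis DiffD1 less_asym mem_star)
  then have *: "gains M N d (vt d e) \<and> gains N M (\<not> d) (vt (\<not> d) e)"
    using exchange_sides[OF M N MN NM e] by (cases d) (auto simp: ex_bool_eq)
  then show "gains M N d (vt d e)" and 1: "gains N M (\<not> d) (vt (\<not> d) e)" by auto
  then obtain f where f: "f \<in> M - N" "vt (\<not> d) f = vt (\<not> d) e" "rej (\<not> d) N f"
    by (auto simp: gains_def)
  have "rk (\<not> d) e < rk (\<not> d) f" using f e by (auto simp: rej_def worse_def)
  then show "\<not> worse (\<not> d) M e" using f unfolding worse_def by (metis DiffD1 less_asym mem_star)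
  show "full (\<not> d) M (vt (\<not> d) e)"
    using gains_card_eq[OF N M NM MN 1] f by (simp add: rej_def full_def)
qed

text \<open>Stated edge by edge through rejection at both ends, so that switching the side reverses
  the relation and both directions of non-blocking can be read off.\<close>

definition dominates :: "bool \<Rightarrow> 'e set \<Rightarrow> 'e set \<Rightarrow> bool" where
  "dominates d M M' \<longleftrightarrow> (\<forall>e \<in> M' - M. rej d M e) \<and> (\<forall>e \<in> M - M'. rej (\<not> d) M' e)"

lemma dominates_swap: "dominates (\<not> d) M M' \<longleftrightarrow> dominates d M' M"
  by (auto simp: dominates_def)

lemma dominates_refl: "dominates d M M"
  by (auto simp: dominates_def)

lemma dominates_unblocked:
  assumes "dominates d M M'"
  shows "unblocked M M'" "unblocked M' M"
  using assms by (auto simp: dominates_def unblocked_def blk_def)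

text \<open>If \<open>M'\<close> has an edge outside \<open>M\<close> at this vertex,
  \<open>M\<close> rejects that edge and hence also \<open>e\<close>, which ranks lower. Otherwise
  fullness of \<open>M'\<close> makes the two stars coincide.\<close>

lemma rej_trans:
  assumes M: "asg M" and M': "asg M'" and d: "\<forall>e \<in> M' - M. rej d M e" and e: "rej d M' e"
  shows "rej d M e"
proof -
  let ?v = "vt d e"
  have fin: "finite (star d ?v M)" "finite (star d ?v M')" using M M' asg_finite finite_star by auto
  have c: "card (star d ?v M) \<le> qt d ?v" using M by (auto simp: asg_def)
  have q: "qt d ?v \<le> card (star d ?v M')" using e by (auto simp: rej_def full_def)
  show ?thesis
  proof (cases "star d ?v M' \<subseteq> star d ?v M")
    case True
    then have "star d ?v M' = star d ?v M" using fin c q by (intro card_subset_eq) (auto intro: card_mono antisym)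
    then show ?thesis using e by (simp add: rej_def full_def worse_def)
  next
    case False
    then obtain g where g: "g \<in> M'" "g \<notin> M" "vt d g = ?v" unfolding subset_iff mem_star by blast
    then have "rej d M g" using d by auto
    moreover have "rk d g < rk d e" using e g by (auto simp: rej_def worse_def)
    ultimately show ?thesis using g by (auto simp: rej_def worse_def intro: less_trans)
  qed
qed

lemma dominates_trans:
  assumes "asg M" "asg M'" "asg M''" "dominates d M M'" "dominates d M' M''"
  shows "dominates d M M''"
  unfolding dominates_def
proof (intro conjI ballI)
  fix e assume "e \<in> M'' - M"
  then show "rej d M e"
    using rej_trans[of M M' d e] assms unfolding dominates_def by blast
next
  fix e assume "e \<in> M - M''"
  then show "rej (\<not> d) M'' e"
    using rej_trans[of M'' M' "\<not> d" e] assms unfolding dominates_def by blast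
qed

section \<open>Rotations and removals\<close>

text \<open>Side \<open>d\<close> proposes. The set \<open>R\<close> collects edges known to be in no legal assignment; a vertex is dead if it has
  nobody left to propose to.\<close>

definition dead :: "bool \<Rightarrow> 'e set \<Rightarrow> 'e set \<Rightarrow> 'v \<Rightarrow> bool" where
  "dead d M R u \<longleftrightarrow> (\<forall>e \<in> E - M. vt d e = u \<longrightarrow> worse d M e \<longrightarrow> e \<in> R)"

definition worst :: "bool \<Rightarrow> 'e set \<Rightarrow> 'e \<Rightarrow> bool" where
  "worst d M f \<longleftrightarrow> f \<in> M \<and> (\<forall>g \<in> star d (vt d f) M. rk d g \<le> rk d f)"

text \<open>In the last case, accepting \<open>e\<close> would displace \<open>f\<close>, whose owner could not be compensated.\<close>

definition removable :: "bool \<Rightarrow> 'e set \<Rightarrow> 'e set \<Rightarrow> 'e \<Rightarrow> bool" where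
  "removable d M R e \<longleftrightarrow> e \<in> E - M \<and> worse d M e \<and>
     (worse (\<not> d) M e \<or> \<not> full (\<not> d) M (vt (\<not> d) e) \<or>
      (\<exists>f. vt (\<not> d) f = vt (\<not> d) e \<and> worst (\<not> d) M f \<and> dead d M R (vt d f)))"

text \<open>Each \<open>e \<in> X\<close> is the next proposal of its owner and displaces \<open>h e\<close>; the displaced owners are the
  proposers, so every vertex keeps its number of edges.\<close>

definition rotation :: "bool \<Rightarrow> 'e set \<Rightarrow> 'e set \<Rightarrow> 'e set \<Rightarrow> ('e \<Rightarrow> 'e) \<Rightarrow> bool" where
  "rotation d M R X h \<longleftrightarrow> X \<subseteq> E - M - R \<and>
     (\<forall>e \<in> X. worse d M e \<and> worst (\<not> d) M (h e) \<and> vt (\<not> d) (h e) = vt (\<not> d) e \<and>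
        rk (\<not> d) e < rk (\<not> d) (h e) \<and>
        full (\<not> d) M (vt (\<not> d) e) \<and>
        (\<forall>e' \<in> E - M - R. vt d e' = vt d e \<longrightarrow> worse d M e' \<longrightarrow> rk d e \<le> rk d e')) \<and>
     inj_on (vt d) X \<and> inj_on (vt (\<not> d)) X \<and> inj_on (\<lambda>e. vt d (h e)) X \<and>
     (\<lambda>e. vt d (h e)) ` X = vt d ` X"

text \<open>\<open>C\<close> keeps the whole history, because the legal edges are read off its
  union; a removal only shrinks the set of admissible proposals.\<close>

inductive reach :: "bool \<Rightarrow> 'e set \<Rightarrow> 'e set \<Rightarrow> 'e set \<Rightarrow> 'e set set \<Rightarrow> bool" for d M0 where
  init: "reach d M0 M0 {} {M0}"
| remove: "reach d M0 M R C \<Longrightarrow> removable d M R e \<Longrightarrow> reach d M0 M (insert e R) C"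
| rotate: "reach d M0 M R C \<Longrightarrow> rotation d M R X h \<Longrightarrow> M' = M - h ` X \<union> X \<Longrightarrow>
    reach d M0 M' R (insert M' C)"

lemma card_star_inj:
  "inj_on (vt d) S \<Longrightarrow> card (star d v S) = (if v \<in> vt d ` S then 1 else 0)"
proof -
  assume i: "inj_on (vt d) S"
  show ?thesis
  proof (cases "v \<in> vt d ` S")
    case True
    then obtain e where "e \<in> S" "vt d e = v" by auto
    then have "star d v S = {e}" using i by (auto simp: inj_on_def)
    then show ?thesis using True by simp
  next
    case False
    then have "star d v S = {}" by auto
    then show ?thesis using False by simp
  qed
qed

lemma card_star_exchange:
  assumes "finite M" "finite X" "F \<subseteq> M" "X \<inter> M = {}" "card (star d v F) = card (star d v X)"
  shows "card (star d v (M - F \<union> X)) = card (star d v M)"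
proof -
  have "star d v (M - F \<union> X) = (star d v M - star d v F) \<union> star d v X" by auto
  also have "card \<dots> = card (star d v M - star d v F) + card (star d v X)"
    using assms by (intro card_Un_disjoint) (auto simp: finite_star)
  also have "card (star d v M - star d v F) = card (star d v M) - card (star d v F)"
    using assms by (intro card_Diff_subset finite_star) (auto intro: finite_subset)
  also have "\<dots> + card (star d v X) = card (star d v M)"
    using assms(5) card_mono[OF finite_star[OF assms(1)], of "star d v F" d v] assms(3)
    by (simp add: subset_iff)
  finally show ?thesis .
qed

text \<open>Entering and leaving edges meet the same vertices on each side, once each, so degrees
  and fullness stay put while side \<open>d\<close> loses and the other side improves. A new
  blocking edge would lie between the old edges of a proposer and its next proposal, where only
  removed edges are.\<close>

lemma rotation_step:
  assumes M: "asg M" and R: "\<forall>e \<in> E - R. \<not> blk M e" and X: "rotation d M R X h"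
  defines "M' \<equiv> M - h ` X \<union> X"
  shows "asg M'" "\<forall>e \<in> E - R. \<not> blk M' e" "dominates d M M'"
    "card (star d' v M') = card (star d' v M)"
proof -
  have XE: "X \<subseteq> E" "X \<inter> M = {}" "X \<inter> R = {}" using X by (auto simp: rotation_def)
  have hM: "h ` X \<subseteq> M" using X by (auto simp: rotation_def worst_def)
  have fin: "finite M" "finite X" using asg_finite[OF M] XE finite_E by (auto intro: finite_subset)
  have h: "worst (\<not> d) M (h e)" "vt (\<not> d) (h e) = vt (\<not> d) e" "rk (\<not> d) e < rk (\<not> d) (h e)"
    "worse d M e" "full (\<not> d) M (vt (\<not> d) e)"
    "\<And>e'. e' \<in> E - M - R \<Longrightarrow> vt d e' = vt d e \<Longrightarrow> worse d M e' \<Longrightarrow> rk d e \<le> rk d e'"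
    if "e \<in> X" for e using X that by (auto simp: rotation_def)
  have inj: "inj_on (vt d) X" "inj_on (vt (\<not> d)) X" "inj_on (\<lambda>e. vt d (h e)) X"
    "(\<lambda>e. vt d (h e)) ` X = vt d ` X" using X by (auto simp: rotation_def)
  have injh: "inj_on (vt d) (h ` X)" using inj(3) by (auto simp: inj_on_def)
  have injh': "inj_on (vt (\<not> d)) (h ` X)" using inj(2) h(2) by (auto simp: inj_on_def)
  have im: "vt d ` h ` X = vt d ` X" "vt (\<not> d) ` h ` X = vt (\<not> d) ` X"
    using inj(4) h(2) by (auto simp: image_image)
  show c: "card (star d' v M') = card (star d' v M)" for d' v
    unfolding M'_def
  proof (rule card_star_exchange[OF fin hM XE(2)])
    consider "d' = d" | "d' = (\<not> d)" by blast
    then show "card (star d' v (h ` X)) = card (star d' v X)"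
      by cases (simp_all only: card_star_inj inj injh injh' im)
  qed
  show "asg M'" using M XE c by (auto simp: asg_def M'_def)
  have full: "full d' M' v \<longleftrightarrow> full d' M v" for d' v by (simp add: full_def c)
  \<comment> \<open>The receiving side only trades up: an entering edge beats the one it replaces,
    so what was below all old edges stays below.\<close>
  have wX: "worse (\<not> d) M' e" if "worse (\<not> d) M e" for e
    unfolding worse_def
  proof
    fix g assume g: "g \<in> star (\<not> d) (vt (\<not> d) e) M'"
    show "rk (\<not> d) g < rk (\<not> d) e"
    proof (cases "g \<in> M")
      case True
      then show ?thesis using that g by (auto simp: worse_def)
    next
      case False
      then have gX: "g \<in> X" using g by (auto simp: M'_def)
      have "rk (\<not> d) (h g) < rk (\<not> d) e"
        using that h(1,2)[OF gX] g by (auto simp: worse_def worst_def)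
      then show ?thesis using h(3)[OF gX] by simp
    qed
  qed
  have wh: "rej (\<not> d) M' (h e)" if e: "e \<in> X" for e
    unfolding rej_def full worse_def
  proof (intro conjI ballI)
    show "full (\<not> d) M (vt (\<not> d) (h e))" using h(2,5)[OF e] by simp
    fix g assume g: "g \<in> star (\<not> d) (vt (\<not> d) (h e)) M'"
    show "rk (\<not> d) g < rk (\<not> d) (h e)"
    proof (cases "g \<in> X")
      case True
      then have "g = e" using g h(2)[OF e] inj(2) e by (auto simp: inj_on_def)
      then show ?thesis using h(3)[OF e] by simp
    next
      case False
      then have gM: "g \<in> M" "g \<noteq> h e" "vt (\<not> d) g = vt (\<not> d) (h e)" using g e by (auto simp: M'_def)
      then have "rk (\<not> d) g \<le> rk (\<not> d) (h e)" using h(1)[OF e] by (auto simp: worst_def)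
      moreover have "rk (\<not> d) g \<noteq> rk (\<not> d) (h e)"
        using rk_inj[of g "h e" "\<not> d"] gM M hM e by (auto simp: asg_def)
      ultimately show ?thesis by simp
    qed
  qed
  \<comment> \<open>Some side rejects \<open>e\<close>, which does not block \<open>M\<close>; at
    the receiving end it beats \<open>h e\<close>, so the rejecting side is
    \<open>d\<close>.\<close>
  have Xrej: "rej d M e" if e: "e \<in> X" for e
  proof -
    have "e \<in> E" "e \<notin> R" "e \<notin> M" using e XE by auto
    then obtain d' where d': "rej d' M e" using R by (auto simp: blk_def)
    have "\<not> worse (\<not> d) M e"
      using h(1-3)[OF e] unfolding worse_def worst_def by (metis less_asym mem_star)
    then have "d' = d" using d' by (cases d; cases d') (auto simp: rej_def)
    then show ?thesis using d' by simp
  qed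
  show "dominates d M M'"
    unfolding dominates_def using Xrej wh by (auto simp: M'_def)
  show "\<forall>e \<in> E - R. \<not> blk M' e"
  proof
    fix e assume e: "e \<in> E - R"
    show "\<not> blk M' e"
    proof
      assume b: "blk M' e"
      then have eM': "e \<notin> M'" by (auto simp: blk_def)
      have "e \<notin> h ` X" using b wh by (auto simp: blk_def)
      then have eM: "e \<notin> M" using eM' by (auto simp: M'_def)
      then obtain d' where d': "rej d' M e" using R e by (auto simp: blk_def)
      have "\<not> rej (\<not> d) M' e" "\<not> rej d M' e" using b by (auto simp: blk_def)
      then have "\<not> rej (\<not> d) M e" using wX full by (auto simp: rej_def)
      then have "d' = d" using d' by (cases d; cases d') auto
      then have r: "rej d M e" using d' by simp
      then obtain g where g: "g \<in> M'" "vt d g = vt d e" "\<not> rk d g < rk d e"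
        using \<open>\<not> rej d M' e\<close> full by (auto simp: rej_def worse_def)
      then have "g \<notin> M" using r by (auto simp: rej_def worse_def)
      then have gX: "g \<in> X" using g by (auto simp: M'_def)
      \<comment> \<open>\<open>e\<close> is itself an available proposal of the owner of
        \<open>g\<close>, so minimality of \<open>g\<close> applies to it.\<close>
      have "rk d g \<le> rk d e"
        by (rule h(6)[OF gX]) (use e eM r g in \<open>auto simp: rej_def\<close>)
      then have "rk d g = rk d e" using g by simp
      then have "g = e" using rk_inj[of g e d] g e gX XE by auto
      then show False using g eM' by simp
    qed
  qed
qed

text \<open>Each rotation steps down for side \<open>d\<close>, and \<open>dominates_trans\<close>
  carries this to all earlier members of the history.\<close>

lemma reach_chain:
  assumes "asg M0" "\<forall>e \<in> E. \<not> blk M0 e" "reach d M0 M R C"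
  shows "asg M \<and> M \<in> C \<and> (\<forall>e \<in> E - R. \<not> blk M e) \<and>
    (\<forall>A \<in> C. asg A \<and> dominates d M0 A \<and> dominates d A M) \<and>
    (\<forall>A \<in> C. \<forall>B \<in> C. dominates d A B \<or> dominates d B A)"
  using assms(3)
proof induction
  case init
  then show ?case using assms dominates_refl by auto
next
  case (remove M R C e)
  then show ?case by auto
next
  case (rotate M R C X h M')
  then have 1: "asg M'" "\<forall>e \<in> E - R. \<not> blk M' e" "dominates d M M'"
    using rotation_step[of M R d X h] by auto
  have "dominates d A M'" if "A \<in> C" for A
    using dominates_trans[of A M M' d] 1 rotate.IH that by blast
  moreover have "dominates d M0 M'"
    using dominates_trans[of M0 M M' d] 1 rotate.IH assms(1) by blast
  ultimately show ?case using 1 rotate.IH dominates_refl by auto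
qed

text \<open>Lets fullness be tested at the starting assignment, so the flags are computed once and
  never updated.\<close>

lemma reach_card_star:
  assumes "asg M0" "\<forall>e \<in> E. \<not> blk M0 e" "reach d M0 M R C"
  shows "card (star d' v M) = card (star d' v M0)"
  using assms(3)
proof induction
  case (rotate M R C X h M')
  then show ?case using rotation_step(4)[of M R d X h d' v] reach_chain[OF assms(1,2) rotate.hyps(1)] by auto
qed auto

text \<open>This is applied to an arbitrary legal set \<open>NN\<close> (for uniqueness) and to the set of all assignments not blocked by
  visited edges (for existence).\<close>

lemma reach_unblocked:
  assumes M0: "asg M0" "\<forall>e \<in> E. \<not> blk M0 e" and "reach d M0 M R C"
    and NN: "\<And>N. N \<in> NN \<Longrightarrow> asg N"
    and H: "\<And>A. A \<in> C \<Longrightarrow> \<forall>N \<in> NN. unblocked N A \<Longrightarrow> \<forall>N \<in> NN. unblocked A N"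
  shows "(\<forall>A \<in> C. \<forall>N \<in> NN. unblocked N A) \<and> (\<forall>N \<in> NN. N \<inter> R = {}) \<and>
    (\<forall>N \<in> NN. \<forall>e \<in> N. rej d M0 e \<longrightarrow> e \<in> \<Union>C \<or> worse d M e)"
  using assms(3) H
proof induction
  case init
  have "\<forall>N \<in> NN. unblocked N M0" using M0(2) NN unfolding asg_def unblocked_def by blast
  then show ?case by (auto simp: rej_def)
next
  case (remove M R C e)
  then have IH: "\<forall>A \<in> C. \<forall>N \<in> NN. unblocked N A" "\<forall>N \<in> NN. N \<inter> R = {}"
    "\<forall>N \<in> NN. \<forall>e \<in> N. rej d M0 e \<longrightarrow> e \<in> \<Union>C \<or> worse d M e" by auto
  note ch = reach_chain[OF M0 remove.hyps(1)]
  have "e \<notin> N" if N: "N \<in> NN" for N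
  proof
    assume e: "e \<in> N"
    have M: "asg M" "M \<in> C" using ch by auto
    have u: "unblocked N M" "unblocked M N" using IH(1) M(2) remove.prems N by auto
    have eM: "e \<in> N - M" "worse d M e" using remove.hyps(2) e by (auto simp: removable_def)
    \<comment> \<open>This excludes the first two cases of \<open>removable\<close>; there remains
      the edge \<open>f\<close> that would be displaced and whose owner is dead.\<close>
    note x = exchange_worse[OF M(1) NN[OF N] u eM]
    then obtain f where f: "vt (\<not> d) f = vt (\<not> d) e" "worst (\<not> d) M f" "dead d M R (vt d f)"
      using remove.hyps(2) by (auto simp: removable_def)
    obtain f0 where f0: "f0 \<in> M - N" "vt (\<not> d) f0 = vt (\<not> d) e" "rej (\<not> d) N f0"
      using x(2) by (auto simp: gains_def)
    \<comment> \<open>\<open>N\<close> rejects \<open>f0\<close>, and the worst edge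
      \<open>f\<close> ranks no better, so \<open>f\<close> is missing from \<open>N\<close> as
      well.\<close>
    have "rk (\<not> d) f0 \<le> rk (\<not> d) f" using f f0 by (auto simp: worst_def)
    then have fN: "f \<in> M - N" using f f0 unfolding worst_def rej_def worse_def
      by (metis DiffI leD mem_star)
    obtain d' where d': "gains N M d' (vt d' f)" "gains M N (\<not> d') (vt (\<not> d') f)"
      using exchange_sides[OF NN[OF N] M(1) u(2,1) fN] by auto
    \<comment> \<open>The receiving end of \<open>f\<close> already prefers \<open>N\<close>, so the
      exchange makes the owner of \<open>f\<close> prefer \<open>M\<close>. That owner has an edge
      of \<open>N\<close> below its edges of \<open>M\<close>, and deadness puts this edge into
      \<open>R\<close>.\<close>
    have "\<not> gains M N (\<not> d) (vt (\<not> d) f)" using gains_disjoint x(2) f(1) by metis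
    then have "d' = (\<not> d)" using d' by (cases d; cases d') auto
    then have "gains M N d (vt d f)" using d' by simp
    then obtain g where g: "g \<in> N - M" "vt d g = vt d f" "rej d M g" by (auto simp: gains_def)
    then have "g \<in> R" using f(3) NN[OF N] by (auto simp: dead_def rej_def asg_def)
    then show False using IH(2) N g by auto
  qed
  then show ?case using IH by auto
next
  case (rotate M R C X h M')
  have IH: "\<forall>A \<in> C. \<forall>N \<in> NN. unblocked N A" "\<forall>N \<in> NN. N \<inter> R = {}"
    "\<forall>N \<in> NN. \<forall>e \<in> N. rej d M0 e \<longrightarrow> e \<in> \<Union>C \<or> worse d M e"
    using rotate.IH rotate.prems by auto
  note ch = reach_chain[OF M0 rotate.hyps(1)]
  have 1: "asg M'" "\<forall>e \<in> E - R. \<not> blk M' e"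
    using rotation_step[of M R d X h] rotate.hyps ch by auto
  have "unblocked N M'" if "N \<in> NN" for N
    using 1(2) IH(2) NN[OF that] that unfolding unblocked_def asg_def by blast
  moreover have "e \<in> \<Union>(insert M' C) \<or> worse d M' e" if N: "N \<in> NN" "e \<in> N" "rej d M0 e" for N e
  proof (rule ccontr)
    assume a: "\<not> ?thesis"
    then have eC: "e \<notin> \<Union>C" "e \<notin> M'" "e \<notin> M" using ch by auto
    then have w: "worse d M e" using IH(3) N by auto
    obtain g where g: "g \<in> M'" "vt d g = vt d e" "\<not> rk d g < rk d e" using a by (auto simp: worse_def)
    then have "g \<notin> M" using w by (auto simp: worse_def)
    then have gX: "g \<in> X" using g rotate.hyps by auto
    have eE: "e \<in> E - M - R" using eC IH(2) N NN[OF N(1)] by (auto simp: asg_def)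
    have "rk d g \<le> rk d e"
      using rotate.hyps(2) gX eE g(2) w by (auto simp: rotation_def)
    then have "g = e" using rk_inj[of g e d] g eE gX rotate.hyps(2) by (auto simp: rotation_def)
    then show False using g eC by simp
  qed
  ultimately show ?case using IH by auto
qed

text \<open>A kernel of the blocking digraph, written as one fixed-point equation.\<close>

definition legal :: "'e set set \<Rightarrow> bool" where
  "legal L \<longleftrightarrow> L = {M. asg M \<and> (\<forall>N \<in> L. unblocked N M)}"

theorem legal_characterization:
  assumes M0: "asg M0" "\<forall>e \<in> E. \<not> blk M0 e"
    and reach: "\<And>d. reach d M0 (M d) (R d) (C d)" and dead: "\<And>d u. dead d (M d) (R d) u"
  defines "K \<equiv> \<Union>d. \<Union>(C d)"
  shows "\<exists>!L. legal L" "legal L \<Longrightarrow> \<Union>L = K"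
proof -
  note ch = reach_chain[OF M0 reach]
  let ?S = "{N. asg N \<and> unblocked K N}"
  have C: "asg A" "dominates d M0 A" if "A \<in> C d" for A d using ch that by auto
  have cmp: "unblocked A B" if A: "A \<in> C d" and B: "B \<in> C d'" for A B d d'
  proof (cases "d = d'")
    case True
    then have "dominates d A B \<or> dominates d B A" using ch A B by blast
    then show ?thesis using dominates_unblocked by blast
  next
    case False
    then have "d' = (\<not> d)" by auto
    \<comment> \<open>Seen from side \<open>d\<close>, the other run climbs from \<open>M0\<close>
      to \<open>B\<close> while this one descends to \<open>A\<close>; transitivity passes through
      \<open>M0\<close>.\<close>
    then have "dominates d B M0" using C(2)[OF B] dominates_swap by simp
    then have "dominates d B A" using dominates_trans[of B M0 A d] C[OF A] C(1)[OF B] M0 by simp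
    then show ?thesis using dominates_unblocked by blast
  qed
  have CS: "A \<in> ?S" if "A \<in> C d" for A d
    using that C cmp by (auto simp: K_def unblocked_def)
  have inK: "N \<subseteq> K" if N: "N \<in> ?S" for N
  proof
    fix e assume e: "e \<in> N"
    show "e \<in> K"
    proof (cases "e \<in> M0")
      case True
      have "M0 \<in> C True" using reach[of True] by induction auto
      then show ?thesis using True by (auto simp: K_def)
    next
      case False
      then have "\<not> blk M0 e" "e \<in> E - M0" using M0 e N by (auto simp: asg_def)
      then obtain d where d: "rej d M0 e" by (auto simp: blk_def)
      \<comment> \<open>For \<open>?S\<close> the closure hypothesis of
        \<open>reach_unblocked\<close> is immediate, as visited assignments consist of edges of
        \<open>K\<close>.\<close>
      have *: "(\<forall>A \<in> C d. \<forall>N \<in> ?S. unblocked N A) \<and> (\<forall>N \<in> ?S. N \<inter> R d = {}) \<and>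
          (\<forall>N \<in> ?S. \<forall>e \<in> N. rej d M0 e \<longrightarrow> e \<in> \<Union>(C d) \<or> worse d (M d) e)"
        by (rule reach_unblocked[OF M0 reach]) (auto simp: K_def unblocked_def)
      then have "e \<in> \<Union>(C d) \<or> worse d (M d) e" "e \<notin> R d" using N e d by blast+
      moreover have "e \<in> \<Union>(C d)" if "worse d (M d) e"
      proof (rule ccontr)
        assume "e \<notin> \<Union>(C d)"
        then have "e \<in> E - M d" using ch \<open>e \<in> E - M0\<close> by auto
        then show False using dead[of d "vt d e"] that \<open>e \<notin> R d\<close> by (auto simp: dead_def)
      qed
      ultimately show ?thesis by (auto simp: K_def)
    qed
  qed
  have S: "legal ?S"
    unfolding legal_def
  proof (intro equalityI subsetI)
    fix N assume N: "N \<in> ?S"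
    then have "unblocked N' N" if "N' \<in> ?S" for N'
      using inK[OF that] by (auto simp: unblocked_def)
    then show "N \<in> {M. asg M \<and> (\<forall>N \<in> ?S. unblocked N M)}" using N by auto
  next
    fix N assume "N \<in> {M. asg M \<and> (\<forall>N \<in> ?S. unblocked N M)}"
    then have "asg N" "\<And>A d. A \<in> C d \<Longrightarrow> unblocked A N" using CS by blast+
    then show "N \<in> ?S" by (auto simp: K_def unblocked_def)
  qed
  have uniq: "L = ?S" if L: "legal L" for L
  proof -
    have asgL: "\<And>N. N \<in> L \<Longrightarrow> asg N" and inL: "\<And>N. asg N \<Longrightarrow> \<forall>N' \<in> L. unblocked N' N \<Longrightarrow> N \<in> L"
      and unL: "\<And>N N'. N \<in> L \<Longrightarrow> N' \<in> L \<Longrightarrow> unblocked N' N"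
      using L unfolding legal_def by blast+
    have *: "(\<forall>A \<in> C d. \<forall>N \<in> L. unblocked N A) \<and> (\<forall>N \<in> L. N \<inter> R d = {}) \<and>
        (\<forall>N \<in> L. \<forall>e \<in> N. rej d M0 e \<longrightarrow> e \<in> \<Union>(C d) \<or> worse d (M d) e)" for d
    proof (rule reach_unblocked[OF M0 reach asgL])
      \<comment> \<open>Here the closure hypothesis comes from \<open>L\<close> being legal: a
        visited assignment that \<open>L\<close> does not block belongs to \<open>L\<close>, and
        members do not block each other.\<close>
      fix A assume "A \<in> C d" "\<forall>N \<in> L. unblocked N A"
      then have "A \<in> L" using inL C(1) by simp
      then show "\<forall>N \<in> L. unblocked A N" using unL by simp
    qed
    have CL: "A \<in> L" if "A \<in> C d" for A d
      using inL[OF C(1)[OF that]] * that by simp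
    have LS: "L \<subseteq> ?S"
    proof
      fix N assume N: "N \<in> L"
      then have "unblocked A N" if "A \<in> C d" for A d by (rule unL[OF _ CL[OF that]])
      then show "N \<in> ?S" using asgL[OF N] by (auto simp: K_def unblocked_def)
    qed
    have "N \<in> L" if N: "N \<in> ?S" for N
    proof (rule inL)
      show "asg N" using N by simp
      show "\<forall>N' \<in> L. unblocked N' N" using LS S N unfolding legal_def by blast
    qed
    then show ?thesis using LS by blast
  qed
  show "\<exists>!L. legal L" using S uniq by blast
  show "\<Union>L = K" if "legal L"
    unfolding uniq[OF that]
  proof
    show "\<Union>?S \<subseteq> K" using inK by blast
    show "K \<subseteq> \<Union>?S" using CS unfolding K_def by blast
  qed
qed

end

section \<open>A program logic with running times\<close>

definition halts :: "com \<Rightarrow> memory \<Rightarrow> nat \<Rightarrow> (memory \<Rightarrow> bool) \<Rightarrow> bool" where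
  "halts p s T Q \<longleftrightarrow> (\<exists>t s'. runs p s t s' \<and> t \<le> T \<and> Q s')"

fun loop_free :: "com \<Rightarrow> bool" where
  "loop_free Skip \<longleftrightarrow> True"
| "loop_free (Write x e f) \<longleftrightarrow> True"
| "loop_free (Seq p q) \<longleftrightarrow> loop_free p \<and> loop_free q"
| "loop_free (Cond b p q) \<longleftrightarrow> loop_free p \<and> loop_free q"
| "loop_free (While b p) \<longleftrightarrow> False"

text \<open>A functional semantics lets the simplifier compute the effect of loop bodies. The clause
  for \<open>While\<close> is a dummy, since results are transferred only under
  \<open>loop_free\<close>.\<close>

fun exec :: "com \<Rightarrow> memory \<Rightarrow> memory" where
  "exec Skip s = s"
| "exec (Write x e f) s = s(x := (s x)(aval e s := aval f s))"
| "exec (Seq p q) s = exec q (exec p s)"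
| "exec (Cond b p q) s = (if bval b s then exec p s else exec q s)"
| "exec (While b p) s = s"

fun max_cost :: "com \<Rightarrow> nat" where
  "max_cost Skip = 1"
| "max_cost (Write x e f) = 1 + acost e + acost f"
| "max_cost (Seq p q) = max_cost p + max_cost q"
| "max_cost (Cond b p q) = 1 + bcost b + max (max_cost p) (max_cost q)"
| "max_cost (While b p) = 0"

fun writes :: "com \<Rightarrow> string set" where
  "writes Skip = {}"
| "writes (Write x e f) = {x}"
| "writes (Seq p q) = writes p \<union> writes q"
| "writes (Cond b p q) = writes p \<union> writes q"
| "writes (While b p) = writes p"

lemma runs_exec: "loop_free p \<Longrightarrow> \<exists>t \<le> max_cost p. runs p s t (exec p s)"
proof (induction p arbitrary: s)
  case Skip
  then show ?case using runs.Skip[of s] by auto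
next
  case (Write x e f)
  then show ?case using runs.Write[of x e f s] by (auto simp del: fun_upd_apply)
next
  case (Seq p q)
  then obtain t t' where "t \<le> max_cost p" "runs p s t (exec p s)"
    "t' \<le> max_cost q" "runs q (exec p s) t' (exec q (exec p s))" by fastforce
  then show ?case using runs.Seq by (intro exI[of _ "t + t'"]) auto
next
  case (Cond b p q)
  show ?case
  proof (cases "bval b s")
    case True
    obtain t where "t \<le> max_cost p" "runs p s t (exec p s)" using Cond by auto
    then show ?thesis using True runs.CondTrue[of b s p t] by (intro exI[of _ "1 + bcost b + t"]) auto
  next
    case False
    obtain t where "t \<le> max_cost q" "runs q s t (exec q s)" using Cond by auto
    then show ?thesis using False runs.CondFalse[of b s q t] by (intro exI[of _ "1 + bcost b + t"]) auto
  qed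
qed simp

lemma runs_unwritten: "runs p s t s' \<Longrightarrow> x \<notin> writes p \<Longrightarrow> s' x = s x"
  by (induction rule: runs.induct) auto

lemma halts_exec: "loop_free p \<Longrightarrow> Q (exec p s) \<Longrightarrow> halts p s (max_cost p) Q"
  unfolding halts_def using runs_exec by blast

lemma halts_Seq:
  assumes "halts p s T P" "\<And>s'. P s' \<Longrightarrow> halts q s' T' Q"
  shows "halts (Seq p q) s (T + T') Q"
proof -
  obtain t s' where 1: "runs p s t s'" "t \<le> T" "P s'" using assms(1) by (auto simp: halts_def)
  obtain t' s'' where 2: "runs q s' t' s''" "t' \<le> T'" "Q s''"
    using assms(2)[OF 1(3)] by (auto simp: halts_def)
  show ?thesis unfolding halts_def using runs.Seq[OF 1(1) 2(1)] 1 2 add_mono by blast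
qed

lemma halts_Seq_linear:
  assumes "halts p s (a * N) P" "\<And>s'. P s' \<Longrightarrow> halts q s' (b * N) Q"
  shows "halts (Seq p q) s ((a + b) * N) Q"
  using halts_Seq[OF assms] by (simp add: add_mult_distrib)

lemma halts_mono: "halts p s T Q \<Longrightarrow> T \<le> T' \<Longrightarrow> (\<And>s'. Q s' \<Longrightarrow> Q' s') \<Longrightarrow> halts p s T' Q'"
  unfolding halts_def using order_trans by blast

lemma halts_unwritten:
  "halts p s T Q \<Longrightarrow> halts p s T (\<lambda>s'. Q s' \<and> (\<forall>x. x \<notin> writes p \<longrightarrow> s' x = s x))"
  unfolding halts_def using runs_unwritten by blast

lemma halts_Cond_True: "bval b s \<Longrightarrow> halts p s T Q \<Longrightarrow> halts (Cond b p q) s (1 + bcost b + T) Q"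
  unfolding halts_def using runs.CondTrue by (metis add_le_cancel_left)

lemma halts_Cond_False: "\<not> bval b s \<Longrightarrow> halts q s T Q \<Longrightarrow> halts (Cond b p q) s (1 + bcost b + T) Q"
  unfolding halts_def using runs.CondFalse by (metis add_le_cancel_left)

text \<open>Amortized time: each iteration is paid for by the drop of the potential \<open>\<phi>\<close>.\<close>

lemma halts_While:
  fixes \<phi> :: "memory \<Rightarrow> nat"
  assumes "J s"
    and step: "\<And>s. J s \<Longrightarrow> bval b s \<Longrightarrow> \<exists>T. halts p s T (\<lambda>s'. J s' \<and> \<phi> s' < \<phi> s \<and> T \<le> c * (\<phi> s - \<phi> s'))"
  shows "halts (While b p) s ((c + 1 + bcost b) * \<phi> s + 1 + bcost b) (\<lambda>s'. J s' \<and> \<not> bval b s')"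
  using assms(1)
proof (induction "\<phi> s" arbitrary: s rule: less_induct)
  case less
  show ?case
  proof (cases "bval b s")
    case False
    then show ?thesis unfolding halts_def
      using runs.WhileFalse[of b s p] less.prems by (intro exI[of _ "1 + bcost b"]) auto
  next
    case True
    then obtain T where "halts p s T (\<lambda>s'. J s' \<and> \<phi> s' < \<phi> s \<and> T \<le> c * (\<phi> s - \<phi> s'))"
      using step less.prems by blast
    then obtain t s1 where 1: "runs p s t s1" "t \<le> T" "J s1" "\<phi> s1 < \<phi> s" "T \<le> c * (\<phi> s - \<phi> s1)"
      unfolding halts_def by blast
    then obtain t' s2 where 2: "runs (While b p) s1 t' s2" "J s2" "\<not> bval b s2"
      "t' \<le> (c + 1 + bcost b) * \<phi> s1 + 1 + bcost b"
      using less.hyps[OF 1(4,3)] unfolding halts_def by blast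
    have "1 + bcost b + t \<le> (c + 1 + bcost b) * (\<phi> s - \<phi> s1)"
    proof -
      \<comment> \<open>The strict drop pays for the loop test in addition to the body.\<close>
      have "1 \<le> \<phi> s - \<phi> s1" using 1(4) by simp
      then have "(1 + bcost b) * 1 \<le> (1 + bcost b) * (\<phi> s - \<phi> s1)" by (rule mult_le_mono2)
      then have "1 + bcost b + t \<le> c * (\<phi> s - \<phi> s1) + (1 + bcost b) * (\<phi> s - \<phi> s1)"
        using add_mono[OF order_trans[OF 1(2,5)], of "1 + bcost b" "(1 + bcost b) * (\<phi> s - \<phi> s1)"]
        by (simp only: mult_1_right add.commute)
      then show ?thesis by (simp only: distrib_right add.assoc)
    qed
    moreover have "(c + 1 + bcost b) * \<phi> s1 + (c + 1 + bcost b) * (\<phi> s - \<phi> s1) = (c + 1 + bcost b) * \<phi> s"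
      using 1(4) by (simp flip: distrib_left)
    ultimately have "1 + bcost b + t + t' \<le> (c + 1 + bcost b) * \<phi> s + 1 + bcost b"
      using 2(4) by linarith
    then show ?thesis unfolding halts_def
      using runs.WhileTrue[OF True 1(1) 2(1)] 2 by blast
  qed
qed

lemma halts_While_exec:
  fixes \<phi> :: "memory \<Rightarrow> nat"
  assumes "J s" "loop_free p"
    and step: "\<And>s. J s \<Longrightarrow> bval b s \<Longrightarrow> J (exec p s) \<and> \<phi> (exec p s) < \<phi> s"
  shows "halts (While b p) s ((max_cost p + 1 + bcost b) * \<phi> s + 1 + bcost b) (\<lambda>s'. J s' \<and> \<not> bval b s')"
proof (rule halts_While[where J = J, OF assms(1)])
  fix s assume s: "J s" "bval b s"
  then have st: "J (exec p s)" "\<phi> (exec p s) < \<phi> s" using step by auto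
  have "max_cost p * 1 \<le> max_cost p * (\<phi> s - \<phi> (exec p s))"
    using st(2) by (intro mult_le_mono2) simp
  then show "\<exists>T. halts p s T (\<lambda>s'. J s' \<and> \<phi> s' < \<phi> s \<and> T \<le> max_cost p * (\<phi> s - \<phi> s'))"
    using st by (intro exI[of _ "max_cost p"] halts_exec[OF assms(2)]) simp
qed

abbreviation var :: "string \<Rightarrow> aexp" where "var x \<equiv> Read x (Const 0)"
abbreviation set_var :: "string \<Rightarrow> aexp \<Rightarrow> com" where "set_var x e \<equiv> Write x (Const 0) e"
abbreviation seq :: "com \<Rightarrow> com \<Rightarrow> com" (infixr ";;" 60) where "p ;; q \<equiv> Seq p q"

definition for_edges :: "com \<Rightarrow> com" where
  "for_edges p = set_var ''i'' (Const 0) ;; While (Less (var ''i'') (var ''edges'')) p"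

text \<open>The loop test costs 6 per iteration; initialisation and the final test add 9. The
  constant 20 covers their sum with slack.\<close>

definition for_cost :: "com \<Rightarrow> nat" where
  "for_cost p = max_cost p + 20"

lemma halts_for_edges:
  assumes n: "s ''edges'' 0 = n" and "loop_free p"
    and init: "J 0 (s(''i'' := (s ''i'')(0 := 0)))"
    and step: "\<And>k s. k < n \<Longrightarrow> J k s \<Longrightarrow> s ''i'' 0 = k \<Longrightarrow> s ''edges'' 0 = n \<Longrightarrow>
      J (Suc k) (exec p s) \<and> exec p s ''i'' 0 = Suc k \<and> exec p s ''edges'' 0 = n"
  shows "halts (for_edges p) s (for_cost p * max 1 n) (J n)"
proof -
  let ?b = "Less (var ''i'') (var ''edges'')" and ?s = "s(''i'' := (s ''i'')(0 := 0))"
  let ?J = "\<lambda>s'. s' ''edges'' 0 = n \<and> s' ''i'' 0 \<le> n \<and> J (s' ''i'' 0) s'"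
  have "halts (set_var ''i'' (Const 0)) s (max_cost (set_var ''i'' (Const 0))) (\<lambda>s'. s' = ?s)"
    by (rule halts_exec) auto
  moreover have "halts (While ?b p) s' ((max_cost p + 1 + bcost ?b) * n + 1 + bcost ?b) (J n)"
    if s': "s' = ?s" for s'
  proof (rule halts_mono[OF halts_While_exec[where J = ?J and \<phi> = "\<lambda>s. n - s ''i'' 0"]])
    show "?J s'" using s' n init by simp
    show "?J (exec p s) \<and> n - exec p s ''i'' 0 < n - s ''i'' 0" if "?J s" "bval ?b s" for s
      using that step[of "s ''i'' 0" s] by auto
    show "J n s" if "?J s \<and> \<not> bval ?b s" for s
    proof -
      have "s ''i'' 0 = n" using that by auto
      then show ?thesis using that by auto
    qed
  qed (use assms s' in auto)
  ultimately have "halts (for_edges p) s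
      (max_cost (set_var ''i'' (Const 0)) + ((max_cost p + 1 + bcost ?b) * n + 1 + bcost ?b)) (J n)"
    unfolding for_edges_def by (rule halts_Seq)
  moreover have "(max_cost p + 6) * n \<le> (max_cost p + 6) * max 1 n" by (rule mult_le_mono2) simp
  ultimately show ?thesis
    by (elim halts_mono) (auto simp: for_cost_def algebra_simps max_def split: if_splits)
qed

section \<open>Cross references between the two listings\<close>

text \<open>The edges of each school are chained through \<open>nxt\<close>, starting at \<open>head\<close>; links are positions plus one,
  with 0 for the end of the chain. \<open>last_occ f b i\<close> is the link to the last position below \<open>i\<close> where \<open>f\<close> has
  value \<open>b\<close>.\<close>

fun last_occ :: "(nat \<Rightarrow> nat) \<Rightarrow> nat \<Rightarrow> nat \<Rightarrow> nat" where
  "last_occ f b 0 = 0"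
| "last_occ f b (Suc i) = (if f i = b then Suc i else last_occ f b i)"

lemma last_occ_Suc: "last_occ f b i = Suc x \<Longrightarrow> x < i \<and> f x = b"
  by (induction i) (auto split: if_splits)

lemma last_occ_le: "last_occ f b i \<le> x \<Longrightarrow> x < i \<Longrightarrow> f x \<noteq> b"
  by (induction i) (auto simp: less_Suc_eq split: if_splits)

definition link_body :: com where
  "link_body =
     Write ''nxt'' (var ''i'') (Read ''head'' (Read ''student_list_b'' (var ''i''))) ;;
     Write ''head'' (Read ''student_list_b'' (var ''i'')) (Succ (var ''i'')) ;;
     set_var ''i'' (Succ (var ''i''))"

lemma link_correct:
  assumes h: "s ''head'' = (\<lambda>_. 0)" and n: "s ''edges'' 0 = n"
  shows "halts (for_edges link_body) s (for_cost link_body * max 1 n)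
    (\<lambda>s'. (\<forall>b. s' ''head'' b = last_occ (s ''student_list_b'') b n) \<and>
      (\<forall>x<n. s' ''nxt'' x = last_occ (s ''student_list_b'') (s ''student_list_b'' x) x))"
proof -
  let ?f = "s ''student_list_b''"
  let ?J = "\<lambda>k s'. s' ''student_list_b'' = ?f \<and> (\<forall>b. s' ''head'' b = last_occ ?f b k) \<and>
    (\<forall>x<k. s' ''nxt'' x = last_occ ?f (?f x) x)"
  have "halts (for_edges link_body) s (for_cost link_body * max 1 n) (?J n)"
    by (rule halts_for_edges[where J = ?J]) (use h n in \<open>auto simp: link_body_def less_Suc_eq\<close>)
  then show ?thesis by (rule halts_mono) auto
qed

text \<open>School by school, the chain of the current school is unrolled into \<open>tmp\<close>, which then translates each
  student of the school's list into a position of the students' listing.\<close>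

definition match_body :: com where
  "match_body =
     Cond (Equal (var ''c'') (Const 0))
       (Write ''xpos'' (var ''j'') (Read ''tmp'' (Read ''school_list_a'' (var ''j''))) ;;
        Write ''ypos'' (Read ''tmp'' (Read ''school_list_a'' (var ''j''))) (var ''j'') ;;
        set_var ''j'' (Succ (var ''j'')) ;;
        Cond (Equal (Read ''school_list_b'' (var ''j'')) (Read ''school_list_b'' (Pred (var ''j''))))
          Skip
          (set_var ''c'' (Read ''head'' (Read ''school_list_b'' (var ''j'')))))
       (Write ''tmp'' (Read ''student_list_a'' (Pred (var ''c''))) (Pred (var ''c'')) ;;
        set_var ''c'' (Read ''nxt'' (Pred (var ''c''))))"

definition match_prog :: com where
  "match_prog =
     (set_var ''j'' (Const 0) ;; set_var ''c'' (Read ''head'' (Read ''school_list_b'' (Const 0)))) ;;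
     While (Less (var ''j'') (var ''edges'')) match_body"

definition match_cost :: nat where
  "match_cost = 2 * max_cost match_body + 40"

text \<open>\<open>tmp\<close> is never cleared between schools, so the invariant speaks only about
  unrolled positions of the current school. A lookup happens when the link \<open>c\<close> is 0,
  and then these are all its positions.\<close>

lemma match_correct:
  fixes n :: nat
  defines "b \<equiv> Less (var ''j'') (var ''edges'')"
  assumes n: "s ''edges'' 0 = n"
    and xa: "s ''student_list_a'' = xa" and xb: "s ''student_list_b'' = xb"
    and ya: "s ''school_list_a'' = ya" and yb: "s ''school_list_b'' = yb"
    and inj: "\<And>x x'. x < n \<Longrightarrow> x' < n \<Longrightarrow> xa x = xa x' \<Longrightarrow> xb x = xb x' \<Longrightarrow> x = x'"
    and inj': "\<And>y y'. y < n \<Longrightarrow> y' < n \<Longrightarrow> ya y = ya y' \<Longrightarrow> yb y = yb y' \<Longrightarrow> y = y'"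
    and ex: "\<And>y. y < n \<Longrightarrow> \<exists>x<n. xa x = ya y \<and> xb x = yb y"
    and mono: "\<And>y y'. y \<le> y' \<Longrightarrow> y' < n \<Longrightarrow> yb y \<le> yb y'"
    and head: "\<forall>b. s ''head'' b = last_occ xb b n"
    and nxt: "\<forall>x<n. s ''nxt'' x = last_occ xb (xb x) x"
  shows "halts match_prog s (match_cost * max 1 n)
    (\<lambda>s'. \<forall>y<n. s' ''xpos'' y < n \<and> xa (s' ''xpos'' y) = ya y \<and> xb (s' ''xpos'' y) = yb y \<and>
        s' ''ypos'' (s' ''xpos'' y) = y)"
proof -
  define hd where "hd = (\<lambda>b. last_occ xb b n)"
  \<comment> \<open>Positions still to be unrolled: those of later schools and, since links are
    positions plus one, those of the current school up to the one \<open>c\<close> points to. Each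
    lookup and each unrolling is charged one unit, so \<open>\<phi>\<close> starts at no more than
    \<open>2 * n\<close>.\<close>
  define Z where "Z = (\<lambda>y c. {x. x < n \<and> (yb y < xb x \<or> xb x = yb y \<and> x < c)})"
  define \<phi> where "\<phi> = (\<lambda>s::memory. (n - s ''j'' 0) + (if s ''j'' 0 < n then card (Z (s ''j'' 0) (s ''c'' 0)) else 0))"
  define J where "J = (\<lambda>s::memory. s ''edges'' 0 = n \<and> s ''student_list_a'' = xa \<and> s ''student_list_b'' = xb \<and>
     s ''school_list_a'' = ya \<and> s ''school_list_b'' = yb \<and> s ''head'' = hd \<and>
     (\<forall>x<n. s ''nxt'' x = last_occ xb (xb x) x) \<and>
     (\<forall>y<s ''j'' 0. y < n \<longrightarrow> s ''xpos'' y < n \<and> xa (s ''xpos'' y) = ya y \<and> xb (s ''xpos'' y) = yb y \<and>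
        s ''ypos'' (s ''xpos'' y) = y) \<and>
     (s ''j'' 0 < n \<longrightarrow> (\<forall>x. s ''c'' 0 = Suc x \<longrightarrow> x < n \<and> xb x = yb (s ''j'' 0)) \<and>
       (\<forall>x<n. xb x = yb (s ''j'' 0) \<longrightarrow> s ''c'' 0 \<le> x \<longrightarrow> s ''tmp'' (xa x) = x)))"
  have hd: "s ''head'' = hd" using head by (auto simp: hd_def)
  have hdS: "x < n \<and> xb x = b" if "hd b = Suc x" for b x
    using last_occ_Suc that by (auto simp: hd_def)
  have hdle: "xb x \<noteq> b" if "hd b \<le> x" "x < n" for b x
    using last_occ_le that by (auto simp: hd_def)
  have finZ: "finite (Z y c)" for y c by (auto simp: Z_def)
  have step: "J (exec match_body s) \<and> \<phi> (exec match_body s) < \<phi> s" if J: "J s" and bv: "bval b s" for s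
  proof (cases "s ''c'' 0")
    case 0
    define y where "y = s ''j'' 0"
    have y: "y < n" using bv J by (auto simp: y_def b_def J_def)
    obtain x where x: "x < n" "xa x = ya y" "xb x = yb y" using ex y by blast
    have t: "s ''tmp'' (ya y) = x" using J 0 y x by (auto simp: J_def y_def)
    \<comment> \<open>Distinct entries point to distinct positions, so the write to
      \<open>ypos\<close> spoils no earlier entry.\<close>
    have ny: "s ''xpos'' y' \<noteq> x" if "y' < y" for y'
      using J that y x inj'[of y' y] by (auto simp: J_def y_def)
    have old: "\<forall>y'<y. s ''xpos'' y' < n \<and> xa (s ''xpos'' y') = ya y' \<and> xb (s ''xpos'' y') = yb y' \<and>
        s ''ypos'' (s ''xpos'' y') = y'" using J y by (auto simp: J_def y_def)
    show ?thesis
    \<comment> \<open>For the last entry this inspects the cell behind the list; whatever is found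
      there, the invariant demands nothing of \<open>c\<close> once \<open>j\<close> reaches
      \<open>n\<close>.\<close>
    proof (cases "yb (Suc y) = yb y")
      case True
      have e: "exec match_body s = s(''xpos'' := (s ''xpos'')(y := x),
          ''ypos'' := (s ''ypos'')(x := y), ''j'' := (s ''j'')(0 := Suc y))"
        using J 0 t True by (auto simp: match_body_def J_def y_def)
      have "J (exec match_body s)"
        unfolding e using J 0 y x ny True old by (auto simp: J_def less_Suc_eq simp flip: y_def)
      moreover have "\<phi> (exec match_body s) < \<phi> s"
        unfolding e using y True 0 by (auto simp: \<phi>_def Z_def simp flip: y_def)
      ultimately show ?thesis by simp
    next
      case False
      have e: "exec match_body s = s(''xpos'' := (s ''xpos'')(y := x),
          ''ypos'' := (s ''ypos'')(x := y), ''j'' := (s ''j'')(0 := Suc y), ''c'' := (s ''c'')(0 := hd (yb (Suc y))))"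
        using J 0 t False by (auto simp: match_body_def J_def y_def)
      have "J (exec match_body s)"
        unfolding e using J 0 y x ny old hdS hdle by (auto simp: J_def less_Suc_eq simp flip: y_def)
      moreover have "Z (Suc y) (hd (yb (Suc y))) \<subseteq> Z y 0" if "Suc y < n"
        using mono[of y "Suc y"] that False by (auto simp: Z_def)
      then have "Suc y < n \<Longrightarrow> card (Z (Suc y) (hd (yb (Suc y)))) \<le> card (Z y 0)"
        by (intro card_mono[OF finZ])
      then have "\<phi> (exec match_body s) < \<phi> s"
        unfolding e using y 0 by (auto simp: \<phi>_def simp flip: y_def)
      ultimately show ?thesis by simp
    qed
  next
    case (Suc x)
    define y where "y = s ''j'' 0"
    have y: "y < n" using bv J by (auto simp: y_def b_def J_def)
    have x: "x < n" "xb x = yb y" using J Suc y by (auto simp: J_def y_def)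
    define l where "l = last_occ xb (yb y) x"
    have e: "exec match_body s = s(''tmp'' := (s ''tmp'')(xa x := x), ''c'' := (s ''c'')(0 := l))"
      using J Suc x by (auto simp: match_body_def J_def y_def l_def)
    have tmp: "s ''tmp'' (xa x') = x'" if "x' < n" "xb x' = yb y" "x < x'" for x'
      using J that Suc y by (auto simp: J_def y_def)
    \<comment> \<open>\<open>tmp\<close> is indexed by students; by \<open>inj\<close>, positions of
      one school with the same student coincide, so no other entry of this school is
      overwritten.\<close>
    have "((s ''tmp'')(xa x := x)) (xa x') = x'" if "x' < n" "xb x' = yb y" "l \<le> x'" for x'
      using tmp[OF that(1,2)] last_occ_le[of xb "yb y" x x'] inj[OF x(1) that(1)] x that
      by (cases "x' < x") (auto simp: not_less le_less l_def)
    moreover have "x' < n \<and> xb x' = yb y" if "l = Suc x'" for x'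
      using last_occ_Suc[of xb "yb y" x x'] that x by (auto simp: l_def)
    ultimately have "J (exec match_body s)"
      unfolding e using J y by (simp add: J_def flip: y_def)
    moreover have "Z y l \<subset> Z y (Suc x)"
    proof -
      have "l \<le> x" using last_occ_Suc[of xb "yb y" x "l - 1"] by (cases l) (auto simp: l_def)
      then have "Z y l \<subseteq> Z y (Suc x)" "x \<in> Z y (Suc x)" "x \<notin> Z y l"
        unfolding Z_def using x by auto
      then show ?thesis by blast
    qed
    then have "\<phi> (exec match_body s) < \<phi> s"
      unfolding e using y Suc psubset_card_mono[OF finZ, of "Z y l" y "Suc x"]
      by (simp add: \<phi>_def flip: y_def)
    ultimately show ?thesis by simp
  qed
  let ?s = "s(''j'' := (s ''j'')(0 := 0), ''c'' := (s ''c'')(0 := hd (yb 0)))"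
  have "halts (set_var ''j'' (Const 0) ;; set_var ''c'' (Read ''head'' (Read ''school_list_b'' (Const 0)))) s
      (max_cost (set_var ''j'' (Const 0) ;; set_var ''c'' (Read ''head'' (Read ''school_list_b'' (Const 0)))))
      (\<lambda>s'. s' = ?s)"
    by (rule halts_exec) (use yb hd in auto)
  moreover have "halts (While b match_body) s' ((max_cost match_body + 1 + bcost b) * (2 * n) + 1 + bcost b)
      (\<lambda>s'. J s' \<and> \<not> bval b s')" if s': "s' = ?s" for s'
  proof (rule halts_mono[OF halts_While_exec[where J = J and \<phi> = \<phi>]])
    have "\<forall>x. hd (yb 0) = Suc x \<longrightarrow> x < n \<and> xb x = yb 0" using hdS by blast
    moreover have "\<forall>x<n. xb x = yb 0 \<longrightarrow> hd (yb 0) \<le> x \<longrightarrow> s ''tmp'' (xa x) = x" using hdle by blast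
    ultimately show "J s'" using n xa xb ya yb nxt hd unfolding s' J_def by simp
    have "card (Z y c) \<le> n" for y c
      using card_mono[of "{..<n}" "Z y c"] by (auto simp: Z_def)
    then have "\<phi> s' \<le> 2 * n" unfolding \<phi>_def mult_2 by (intro add_mono) auto
    then have "(max_cost match_body + 1 + bcost b) * \<phi> s' \<le> (max_cost match_body + 1 + bcost b) * (2 * n)"
      by (rule mult_le_mono2)
    then show "(max_cost match_body + 1 + bcost b) * \<phi> s' + 1 + bcost b
      \<le> (max_cost match_body + 1 + bcost b) * (2 * n) + 1 + bcost b" by simp
  qed (use step in \<open>auto simp: match_body_def\<close>)
  ultimately have "halts match_prog s
      (max_cost (set_var ''j'' (Const 0) ;; set_var ''c'' (Read ''head'' (Read ''school_list_b'' (Const 0)))) +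
       ((max_cost match_body + 1 + bcost b) * (2 * n) + 1 + bcost b)) (\<lambda>s'. J s' \<and> \<not> bval b s')"
    unfolding match_prog_def b_def by (rule halts_Seq)
  moreover have "(max_cost match_body + 6) * (2 * n) \<le> (max_cost match_body + 6) * (2 * max 1 n)"
    by (intro mult_le_mono2) simp
  ultimately show ?thesis
    by (elim halts_mono) (auto simp: match_cost_def algebra_simps max_def b_def J_def split: if_splits)
qed

text \<open>Afterwards \<open>p\<close> holds the first position of each block of \<open>nu\<close> and \<open>thr\<close> the last position of each
  block of \<open>nv\<close>: the second array is scanned upwards and the first one downwards, so the last write wins.\<close>

definition prep_body :: "string \<Rightarrow> string \<Rightarrow> com" where
  "prep_body nu nv =
     Write ''thr'' (Read nv (var ''i'')) (var ''i'') ;;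
     set_var ''j'' (Pred (var ''j'')) ;;
     Write ''p'' (Read nu (var ''j'')) (var ''j'') ;;
     set_var ''i'' (Succ (var ''i''))"

definition prep_prog :: "string \<Rightarrow> string \<Rightarrow> com" where
  "prep_prog nu nv = set_var ''j'' (var ''edges'') ;; for_edges (prep_body nu nv)"

lemma prep_correct:
  assumes n: "s ''edges'' 0 = n"
    and names: "{nu, nv} \<inter> {''thr'', ''p'', ''i'', ''j''} = {}"
  shows "halts (prep_prog nu nv) s ((for_cost (prep_body nu nv) + 4) * max 1 n)
    (\<lambda>s'. (\<forall>t<n. t \<le> s' ''thr'' (s nv t) \<and> s' ''thr'' (s nv t) < n \<and> s nv (s' ''thr'' (s nv t)) = s nv t) \<and>
      (\<forall>k<n. s' ''p'' (s nu k) \<le> k \<and> s nu (s' ''p'' (s nu k)) = s nu k))"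
proof -
  define f g where "f = s nu" and "g = s nv"
  have ne: "nu \<noteq> ''thr''" "nu \<noteq> ''p''" "nu \<noteq> ''i''" "nu \<noteq> ''j''"
    "nv \<noteq> ''thr''" "nv \<noteq> ''p''" "nv \<noteq> ''i''" "nv \<noteq> ''j''" using names by auto
  let ?J = "\<lambda>i s'. s' nu = f \<and> s' nv = g \<and> s' ''j'' 0 = n - i \<and>
    (\<forall>t<i. t \<le> s' ''thr'' (g t) \<and> s' ''thr'' (g t) < i \<and> g (s' ''thr'' (g t)) = g t) \<and>
    (\<forall>k<n. n - i \<le> k \<longrightarrow> s' ''p'' (f k) \<le> k \<and> f (s' ''p'' (f k)) = f k)"
  let ?s = "s(''j'' := (s ''j'')(0 := n))"
  have "halts (set_var ''j'' (var ''edges'')) s (max_cost (set_var ''j'' (var ''edges''))) (\<lambda>s'. s' = ?s)"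
    by (rule halts_exec) (use n in auto)
  moreover have "halts (for_edges (prep_body nu nv)) s' (for_cost (prep_body nu nv) * max 1 n) (?J n)"
    if "s' = ?s" for s'
  proof (rule halts_for_edges[where J = ?J])
    fix k s assume k: "k < n" and J: "?J k s" and i: "s ''i'' 0 = k" and e: "s ''edges'' 0 = n"
    have ex: "exec (prep_body nu nv) s = s(''thr'' := (s ''thr'')(g k := k), ''j'' := (s ''j'')(0 := n - Suc k),
       ''p'' := (s ''p'')(f (n - Suc k) := n - Suc k), ''i'' := (s ''i'')(0 := Suc k))"
      using J i ne by (auto simp: prep_body_def)
    have "n - Suc k \<le> x \<longleftrightarrow> x = n - Suc k \<or> n - k \<le> x" for x using k by auto
    then show "?J (Suc k) (exec (prep_body nu nv) s) \<and> exec (prep_body nu nv) s ''i'' 0 = Suc k \<and>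
       exec (prep_body nu nv) s ''edges'' 0 = n"
      unfolding ex using k J i e ne by (auto simp: less_Suc_eq)
  qed (use n that ne in \<open>auto simp: prep_body_def f_def g_def\<close>)
  ultimately have "halts (prep_prog nu nv) s
     (max_cost (set_var ''j'' (var ''edges'')) + for_cost (prep_body nu nv) * max 1 n) (?J n)"
    unfolding prep_prog_def by (rule halts_Seq)
  then show ?thesis by (rule halts_mono) (auto simp: f_def g_def algebra_simps max_def)
qed

section \<open>Pointers into the preference lists\<close>

text \<open>Edges are addressed by their position \<open>k\<close> in the listing of the proposing side \<open>d\<close>. The arrays \<open>nu\<close> and \<open>nw\<close>
  give the two endpoints, \<open>cr\<close> the position in the other listing, and \<open>bk\<close> is the inverse of \<open>cr\<close>.\<close>

locale edge_lists = two_sided E vt rk qt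
  for E :: "'e set" and vt :: "bool \<Rightarrow> 'e \<Rightarrow> nat" and rk :: "bool \<Rightarrow> 'e \<Rightarrow> nat"
    and qt :: "bool \<Rightarrow> nat \<Rightarrow> nat" +
  fixes d :: bool and n :: nat and ed :: "nat \<Rightarrow> 'e" and nu nw cr bk :: "nat \<Rightarrow> nat"
  assumes ed: "ed ` {..<n} = E"
    and rk_ed: "k < n \<Longrightarrow> rk d (ed k) = k" and rk'_ed: "k < n \<Longrightarrow> rk (\<not> d) (ed k) = cr k"
    and vt_ed: "k < n \<Longrightarrow> vt d (ed k) = nu k" and vt'_ed: "k < n \<Longrightarrow> vt (\<not> d) (ed k) = nw k"
    and cr_less: "k < n \<Longrightarrow> cr k < n" and bk_less: "t < n \<Longrightarrow> bk t < n"
    and bk_cr: "k < n \<Longrightarrow> bk (cr k) = k" and cr_bk: "t < n \<Longrightarrow> cr (bk t) = t"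
    and nu_mono: "j \<le> k \<Longrightarrow> k < n \<Longrightarrow> nu j \<le> nu k"
    and nv_mono: "t \<le> t' \<Longrightarrow> t' < n \<Longrightarrow> nw (bk t) \<le> nw (bk t')"
    and qt'_pos: "k < n \<Longrightarrow> 0 < qt (\<not> d) (nw k)"
begin

definition sel :: "(nat \<Rightarrow> nat) \<Rightarrow> 'e set" where
  "sel m = ed ` {k. k < n \<and> m k \<noteq> 0}"

lemma ed_inj: "j < n \<Longrightarrow> k < n \<Longrightarrow> ed j = ed k \<longleftrightarrow> j = k"
  using rk_ed by metis

lemma ed_in_E: "k < n \<Longrightarrow> ed k \<in> E"
  using ed by auto

lemma E_cases: "e \<in> E \<Longrightarrow> (\<And>k. k < n \<Longrightarrow> e = ed k \<Longrightarrow> P) \<Longrightarrow> P"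
  using ed by auto

lemma ed_in_sel: "k < n \<Longrightarrow> ed k \<in> sel m \<longleftrightarrow> m k \<noteq> 0"
  using ed_inj by (auto simp: sel_def)

lemma sel_subset: "sel m \<subseteq> E"
  using ed_in_E by (auto simp: sel_def)

lemma card_star_sel: "card (star d' v (sel m)) = card {k. k < n \<and> m k \<noteq> 0 \<and> vt d' (ed k) = v}"
proof -
  have "star d' v (sel m) = ed ` {k. k < n \<and> m k \<noteq> 0 \<and> vt d' (ed k) = v}"
    by (auto simp: sel_def)
  moreover have "inj_on ed {k. k < n \<and> m k \<noteq> 0 \<and> vt d' (ed k) = v}"
    using ed_inj by (auto simp: inj_on_def)
  ultimately show ?thesis by (simp add: card_image)
qed

lemma worse_sel:
  "k < n \<Longrightarrow> worse d (sel m) (ed k) \<longleftrightarrow> (\<forall>j<n. m j \<noteq> 0 \<longrightarrow> nu j = nu k \<longrightarrow> j < k)"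
  unfolding worse_def Ball_def mem_star sel_def by (auto simp: rk_ed vt_ed)

lemma worse'_sel:
  "k < n \<Longrightarrow> worse (\<not> d) (sel m) (ed k) \<longleftrightarrow> (\<forall>j<n. m j \<noteq> 0 \<longrightarrow> nw j = nw k \<longrightarrow> cr j < cr k)"
  unfolding worse_def Ball_def mem_star sel_def by (auto simp: rk'_ed vt'_ed)

lemma worst'_sel:
  "k < n \<Longrightarrow> worst (\<not> d) (sel m) (ed k) \<longleftrightarrow>
     m k \<noteq> 0 \<and> (\<forall>j<n. m j \<noteq> 0 \<longrightarrow> nw j = nw k \<longrightarrow> cr j \<le> cr k)"
  unfolding worst_def Ball_def mem_star ed_in_sel unfolding sel_def by (auto simp: rk'_ed vt'_ed)

text \<open>\<open>p v\<close> is the next position of \<open>v\<close> to be examined (outside the block of \<open>v\<close> once the list is exhausted).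
  \<open>thr w\<close> is an upper bound for the worst edge held by \<open>w\<close>, as a position in the other listing; it is lowered
  lazily, one step at a time, so that the total time for finding worst edges is linear.\<close>

definition in_block :: "(nat \<Rightarrow> nat) \<Rightarrow> nat \<Rightarrow> bool" where
  "in_block p v \<longleftrightarrow> p v < n \<and> nu (p v) = v"

text \<open>Says only that a pointer is not before its block; the first position need not be named,
  because monotonicity of \<open>nu\<close> does the rest.\<close>

definition ptr_inv :: "(nat \<Rightarrow> nat) \<Rightarrow> bool" where
  "ptr_inv p \<longleftrightarrow> (\<forall>k<n. \<exists>j<n. nu j = nu k \<and> j \<le> p (nu k))"

definition thr_inv :: "(nat \<Rightarrow> nat) \<Rightarrow> (nat \<Rightarrow> nat) \<Rightarrow> bool" where
  "thr_inv thr m \<longleftrightarrow> (\<forall>k<n. thr (nw k) < n \<and> nw (bk (thr (nw k))) = nw k \<and>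
     (m k \<noteq> 0 \<longrightarrow> cr k \<le> thr (nw k)))"

definition ptr_pot :: "(nat \<Rightarrow> nat) \<Rightarrow> nat" where
  "ptr_pot p = card {k. k < n \<and> p (nu k) \<le> k}"

definition thr_pot :: "(nat \<Rightarrow> nat) \<Rightarrow> nat" where
  "thr_pot thr = card {t. t < n \<and> t \<le> thr (nw (bk t))}"

lemma ptr_pot_le: "ptr_pot p \<le> n"
  unfolding ptr_pot_def using card_mono[of "{..<n}" "{k. k < n \<and> p (nu k) \<le> k}"] by auto

lemma thr_pot_le: "thr_pot thr \<le> n"
  unfolding thr_pot_def using card_mono[of "{..<n}" "{t. t < n \<and> t \<le> thr (nw (bk t))}"] by auto

lemma ptr_inv_advance:
  assumes "ptr_inv p" shows "ptr_inv (p(v := Suc (p v)))"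
  unfolding ptr_inv_def
proof (intro allI impI)
  fix k assume "k < n"
  then obtain j where "j < n" "nu j = nu k" "j \<le> p (nu k)" using assms by (auto simp: ptr_inv_def)
  then show "\<exists>j<n. nu j = nu k \<and> j \<le> (p(v := Suc (p v))) (nu k)" by (intro exI[of _ j]) auto
qed

lemma ptr_pot_advance:
  assumes "in_block p v" shows "Suc (ptr_pot (p(v := Suc (p v)))) = ptr_pot p"
proof -
  have "{k. k < n \<and> p (nu k) \<le> k} = insert (p v) {k. k < n \<and> (p(v := Suc (p v))) (nu k) \<le> k}"
    using assms by (auto simp: in_block_def)
  moreover have "p v \<notin> {k. k < n \<and> (p(v := Suc (p v))) (nu k) \<le> k}"
    using assms by (auto simp: in_block_def)
  ultimately show ?thesis by (simp add: ptr_pot_def)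
qed

text \<open>Blocks are intervals, so a pointer squeezed between two positions of a block lies in
  it.\<close>

lemma in_block_between:
  assumes p: "ptr_inv p" and k: "k < n" "p (nu k) \<le> k" shows "in_block p (nu k)"
proof -
  obtain j where "j < n" "nu j = nu k" "j \<le> p (nu k)" using p k by (auto simp: ptr_inv_def)
  then have "nu (p (nu k)) = nu k"
    using nu_mono[of j "p (nu k)"] nu_mono[of "p (nu k)" k] k by auto
  then show ?thesis using k by (auto simp: in_block_def)
qed

lemma thr_inv_change:
  assumes "thr_inv thr m" "\<And>k. k < n \<Longrightarrow> m' k \<noteq> 0 \<Longrightarrow> m k \<noteq> 0 \<or> cr k \<le> thr (nw k)"
  shows "thr_inv thr m'"
  using assms unfolding thr_inv_def by blast

text \<open>The held edge \<open>j\<close> lies strictly below the unheld edge at the threshold, so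
  after the decrement the threshold is still inside the block of \<open>nw j\<close>.\<close>

lemma thr_inv_dec:
  assumes t: "thr_inv thr m" and j: "j < n" "m j \<noteq> 0" and m: "m (bk (thr (nw j))) = 0"
  shows "thr_inv (thr(nw j := thr (nw j) - 1)) m" "thr_pot (thr(nw j := thr (nw j) - 1)) < thr_pot thr"
proof -
  let ?w = "nw j"
  have tw: "thr ?w < n" "nw (bk (thr ?w)) = ?w" using t j by (auto simp: thr_inv_def)
  have le: "cr k < thr ?w" if "k < n" "nw k = ?w" "m k \<noteq> 0" for k
  proof -
    have "cr k \<le> thr ?w" using t that by (auto simp: thr_inv_def)
    moreover have "cr k \<noteq> thr ?w" using bk_cr that m by metis
    ultimately show ?thesis by simp
  qed
  have "nw (bk (thr ?w - 1)) = ?w"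
    using nv_mono[of "cr j" "thr ?w - 1"] nv_mono[of "thr ?w - 1" "thr ?w"] le[of j] j tw bk_cr[of j]
    by auto
  then show "thr_inv (thr(?w := thr ?w - 1)) m"
    unfolding thr_inv_def using t le tw by (auto simp: thr_inv_def) (metis less_Suc_eq_le Suc_pred le less_zeroE not_gr_zero)
  have "{t. t < n \<and> t \<le> (thr(?w := thr ?w - 1)) (nw (bk t))} \<subset> {t. t < n \<and> t \<le> thr (nw (bk t))}"
  proof
    show "{t. t < n \<and> t \<le> (thr(?w := thr ?w - 1)) (nw (bk t))} \<subseteq> {t. t < n \<and> t \<le> thr (nw (bk t))}"
      by (auto split: if_splits)
    have "thr ?w \<in> {t. t < n \<and> t \<le> thr (nw (bk t))}" using tw by auto
    moreover have "thr ?w \<notin> {t. t < n \<and> t \<le> (thr(?w := thr ?w - 1)) (nw (bk t))}"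
      using tw le[of j] j by auto
    ultimately show "{t. t < n \<and> t \<le> (thr(?w := thr ?w - 1)) (nw (bk t))} \<noteq> {t. t < n \<and> t \<le> thr (nw (bk t))}"
      by blast
  qed
  then show "thr_pot (thr(?w := thr ?w - 1)) < thr_pot thr"
    unfolding thr_pot_def by (intro psubset_card_mono) auto
qed

section \<open>Deferred acceptance\<close>

definition settled :: "(nat \<Rightarrow> nat) \<Rightarrow> (nat \<Rightarrow> nat) \<Rightarrow> nat \<Rightarrow> bool" where
  "settled p m v \<longleftrightarrow> (in_block p v \<longrightarrow> m (p v) \<noteq> 0)"

definition held :: "(nat \<Rightarrow> nat) \<Rightarrow> nat \<Rightarrow> nat set" where
  "held m w = {k. k < n \<and> m k \<noteq> 0 \<and> nw k = w}"

lemma finite_held: "finite (held m w)" by (auto simp: held_def)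

text \<open>The current proposer \<open>v\<close> is encoded as \<open>u = Suc v\<close>; \<open>u = 0\<close> means that there is none.\<close>

definition da_inv :: "(nat \<Rightarrow> nat) \<Rightarrow> (nat \<Rightarrow> nat) \<Rightarrow> (nat \<Rightarrow> nat) \<Rightarrow> (nat \<Rightarrow> nat) \<Rightarrow> nat \<Rightarrow> nat \<Rightarrow> bool" where
  "da_inv p thr m cnt u i \<longleftrightarrow> ptr_inv p \<and> thr_inv thr m \<and>
     (\<forall>k<n. m k \<noteq> 0 \<longrightarrow> p (nu k) = k) \<and>
     (\<forall>k<n. cnt (nw k) = card (held m (nw k)) \<and> cnt (nw k) \<le> qt (\<not> d) (nw k)) \<and>
     (\<forall>k<n. cnt (nw k) < qt (\<not> d) (nw k) \<longrightarrow> cr k \<le> thr (nw k)) \<and>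
     (\<forall>k<n. k < p (nu k) \<longrightarrow> cnt (nw k) = qt (\<not> d) (nw k) \<and> (\<forall>j \<in> held m (nw k). cr j < cr k)) \<and>
     (\<forall>k<n. k < i \<or> u \<noteq> 0 \<and> k = i \<longrightarrow> settled p m (nu k) \<or> u = Suc (nu k)) \<and>
     (u \<noteq> 0 \<longrightarrow> i < n \<and> (\<exists>k<n. u = Suc (nu k))) \<and> i \<le> n"

text \<open>The weight 2 on \<open>n - i\<close> pays for finishing \<open>i\<close> and for the
  unit that returns when \<open>u\<close> becomes 0; that unit pays for starting the next
  proposer.\<close>

definition da_pot :: "(nat \<Rightarrow> nat) \<Rightarrow> (nat \<Rightarrow> nat) \<Rightarrow> nat \<Rightarrow> nat \<Rightarrow> nat" where
  "da_pot p thr u i = ptr_pot p + thr_pot thr + 2 * (n - i) + (if u = 0 then 1 else 0)"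

lemma da_start:
  assumes "da_inv p thr m cnt 0 i" "i < n"
  shows "da_inv p thr m cnt (Suc (nu i)) i" "da_pot p thr (Suc (nu i)) i < da_pot p thr 0 i"
  using assms by (auto simp: da_inv_def da_pot_def)

lemma da_settle:
  assumes "da_inv p thr m cnt (Suc v) i" "i < n" "settled p m v"
  shows "da_inv p thr m cnt 0 (Suc i)" "da_pot p thr 0 (Suc i) < da_pot p thr (Suc v) i"
  using assms by (auto simp: da_inv_def da_pot_def less_Suc_eq)

text \<open>Nobody is displaced, so the chain of proposals begun at \<open>i\<close> ends. The new
  edge respects the threshold because the invariant keeps it above all edges of a vertex with a free
  place.\<close>

lemma da_accept:
  assumes inv: "da_inv p thr m cnt (Suc v) i" and b: "in_block p v" "m (p v) = 0"
    and c: "cnt (nw (p v)) < qt (\<not> d) (nw (p v))" and e: "e = p v"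
  shows "da_inv p thr (m(e := 1)) (cnt(nw e := Suc (cnt (nw e)))) 0 (Suc i)"
    "da_pot p thr 0 (Suc i) < da_pot p thr (Suc v) i"
proof -
  have en: "e < n" "nu e = v" "m e = 0" using b e by (auto simp: in_block_def)
  have held: "held (m(e := 1)) w = (if w = nw e then insert e (held m w) else held m w)" for w
    using en by (auto simp: held_def)
  have eh: "e \<notin> held m w" for w using en by (auto simp: held_def)
  have i: "i < n" "i \<le> n" using inv by (auto simp: da_inv_def)
  have "cr e \<le> thr (nw e)" using inv c en unfolding da_inv_def e by auto
  moreover have "thr_inv thr m" using inv by (simp add: da_inv_def)
  ultimately have t: "thr_inv thr (m(e := 1))"
    by (elim thr_inv_change) (auto split: if_splits)
  show "da_inv p thr (m(e := 1)) (cnt(nw e := Suc (cnt (nw e)))) 0 (Suc i)"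
    unfolding da_inv_def
  proof (intro conjI allI impI)
    fix k assume k: "k < n"
    show "(cnt(nw e := Suc (cnt (nw e)))) (nw k) = card (held (m(e := 1)) (nw k))"
      using inv k eh finite_held en unfolding da_inv_def held by auto
    show "(cnt(nw e := Suc (cnt (nw e)))) (nw k) \<le> qt (\<not> d) (nw k)"
      using inv k c unfolding da_inv_def e by auto
  next
    fix k assume k: "k < n" "k < p (nu k)"
    have "cnt (nw k) = qt (\<not> d) (nw k) \<and> (\<forall>j \<in> held m (nw k). cr j < cr k)"
      using inv k by (auto simp: da_inv_def)
    then show "(cnt(nw e := Suc (cnt (nw e)))) (nw k) = qt (\<not> d) (nw k)"
      "\<forall>j \<in> held (m(e := 1)) (nw k). cr j < cr k"
      using c unfolding e[symmetric] held by auto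
  next
    fix k assume k: "k < n" "k < Suc i \<or> (0::nat) \<noteq> 0 \<and> k = Suc i"
    then have "settled p m (nu k) \<or> Suc v = Suc (nu k)"
      using inv unfolding da_inv_def by (auto simp: less_Suc_eq)
    then show "settled p (m(e := 1)) (nu k) \<or> 0 = Suc (nu k)" using e by (auto simp: settled_def)
  qed (use inv t i e en in \<open>auto simp: da_inv_def split: if_splits\<close>)
  show "da_pot p thr 0 (Suc i) < da_pot p thr (Suc v) i"
    using i by (auto simp: da_pot_def)
qed

lemma full_held:
  assumes "e < n" "card (held m (nw e)) = qt (\<not> d) (nw e)"
  obtains j where "j < n" "m j \<noteq> 0" "nw j = nw e"
proof -
  have "held m (nw e) \<noteq> {}" using qt'_pos[OF assms(1)] assms(2) by auto
  then show ?thesis using that by (auto simp: held_def)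
qed

text \<open>A full vertex with positive quota holds an edge, as \<open>thr_inv_dec\<close> requires;
  a vertex with a free place never has its threshold lowered.\<close>

lemma da_lower:
  assumes inv: "da_inv p thr m cnt u i" and b: "e < n"
    and c: "\<not> cnt (nw e) < qt (\<not> d) (nw e)" and m: "m (bk (thr (nw e))) = 0"
  shows "da_inv p (thr(nw e := thr (nw e) - 1)) m cnt u i"
    "da_pot p (thr(nw e := thr (nw e) - 1)) u i < da_pot p thr u i"
proof -
  have "card (held m (nw e)) = qt (\<not> d) (nw e)" using inv c b by (force simp: da_inv_def)
  then obtain j where j: "j < n" "m j \<noteq> 0" "nw j = nw e" using full_held[OF b] by metis
  have t: "thr_inv thr m" using inv by (auto simp: da_inv_def)
  have t': "thr_inv (thr(nw e := thr (nw e) - 1)) m" "thr_pot (thr(nw e := thr (nw e) - 1)) < thr_pot thr"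
    using thr_inv_dec[OF t j(1,2)] m j(3) by auto
  then show "da_inv p (thr(nw e := thr (nw e) - 1)) m cnt u i"
    using inv c unfolding da_inv_def by auto
  show "da_pot p (thr(nw e := thr (nw e) - 1)) u i < da_pot p thr u i"
    using t' by (auto simp: da_pot_def)
qed

text \<open>The threshold need not be exact: an upper bound that already beats the candidate shows
  that all held edges beat it.\<close>

lemma da_reject:
  assumes inv: "da_inv p thr m cnt (Suc v) i" and b: "in_block p v" "m (p v) = 0"
    and c: "\<not> cnt (nw (p v)) < qt (\<not> d) (nw (p v))" and t: "thr (nw (p v)) < cr (p v)"
  shows "da_inv (p(v := Suc (p v))) thr m cnt (Suc v) i"
    "da_pot (p(v := Suc (p v))) thr (Suc v) i < da_pot p thr (Suc v) i"
proof -
  have en: "p v < n" "nu (p v) = v" using b by (auto simp: in_block_def)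
  have rej: "cnt (nw (p v)) = qt (\<not> d) (nw (p v)) \<and> (\<forall>j \<in> held m (nw (p v)). cr j < cr (p v))"
    using inv c t en by (force simp: da_inv_def thr_inv_def held_def)
  show "da_inv (p(v := Suc (p v))) thr m cnt (Suc v) i"
    unfolding da_inv_def
  proof (intro conjI allI impI)
    fix k assume k: "k < n" "k < (p(v := Suc (p v))) (nu k)"
    then have "k < p (nu k) \<or> k = p v" by (auto split: if_splits)
    then have "cnt (nw k) = qt (\<not> d) (nw k) \<and> (\<forall>j \<in> held m (nw k). cr j < cr k)"
      using inv k rej by (auto simp: da_inv_def)
    then show "cnt (nw k) = qt (\<not> d) (nw k)" "\<forall>j \<in> held m (nw k). cr j < cr k" by auto
  next
    fix k assume k: "k < n" "k < i \<or> Suc v \<noteq> 0 \<and> k = i"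
    then have "settled p m (nu k) \<or> Suc v = Suc (nu k)" using inv unfolding da_inv_def by auto
    then show "settled (p(v := Suc (p v))) m (nu k) \<or> Suc v = Suc (nu k)"
      by (auto simp: settled_def in_block_def)
  next
    fix k assume k: "k < n" "m k \<noteq> 0"
    then have "p (nu k) = k" using inv by (auto simp: da_inv_def)
    then show "(p(v := Suc (p v))) (nu k) = k" using b k by auto
  qed (use inv ptr_inv_advance in \<open>auto simp: da_inv_def\<close>)
  show "da_pot (p(v := Suc (p v))) thr (Suc v) i < da_pot p thr (Suc v) i"
    using ptr_pot_advance[OF b(1)] by (auto simp: da_pot_def)
qed

text \<open>A held edge sits at the pointer of its owner, so writing \<open>Suc f\<close> advances
  that pointer by one. The displaced owner becomes the proposer, and \<open>i\<close> stays because
  the chain begun there goes on.\<close>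

lemma da_replace:
  assumes inv: "da_inv p thr m cnt (Suc v) i" and b: "in_block p v" "m (p v) = 0"
    and c: "\<not> cnt (nw (p v)) < qt (\<not> d) (nw (p v))" and t: "\<not> thr (nw (p v)) < cr (p v)"
    and e: "e = p v" and f: "f = bk (thr (nw e))" "m f \<noteq> 0"
  shows "da_inv (p(nu f := Suc f)) thr (m(e := 1, f := 0)) cnt (Suc (nu f)) i"
    "da_pot (p(nu f := Suc f)) thr (Suc (nu f)) i < da_pot p thr (Suc v) i"
proof -
  have en: "e < n" "nu e = v" "m e = 0" using b e by (auto simp: in_block_def)
  have T: "thr_inv thr m" "ptr_inv p" using inv by (auto simp: da_inv_def)
  have fn: "f < n" "nw f = nw e" "cr f = thr (nw e)"
    using T en bk_less cr_bk unfolding f(1) by (auto simp: thr_inv_def)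
  have pf: "p (nu f) = f" using inv fn f(2) by (auto simp: da_inv_def)
  have ef: "e \<noteq> f" "nu f \<noteq> v" using f(2) en e pf by auto
  have lt: "cr e < cr f"
  proof -
    have "cr e \<noteq> cr f" using bk_cr en(1) fn(1) ef by metis
    then show ?thesis using t fn unfolding e by simp
  qed
  have held: "held (m(e := 1, f := 0)) w = (if w = nw e then insert e (held m w - {f}) else held m w)" for w
    using en fn ef by (auto simp: held_def)
  have mem: "e \<notin> held m w" "f \<in> held m (nw e)" for w using en fn f by (auto simp: held_def)
  have card: "card (held (m(e := 1, f := 0)) w) = card (held m w)" for w
  proof (cases "w = nw e")
    case True
    then have "card (held (m(e := 1, f := 0)) w) = Suc (card (held m w - {f}))"
      unfolding held using finite_held mem(1)[of w] by simp
    then show ?thesis using card_Suc_Diff1[OF finite_held mem(2)] True by simp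
  qed (simp only: held if_False)
  have maxf: "cr j \<le> cr f" if "j \<in> held m (nw e)" for j
  proof -
    have "j < n" "m j \<noteq> 0" "nw j = nw e" using that by (auto simp: held_def)
    then have "cr j \<le> thr (nw e)" using T(1) unfolding thr_inv_def by metis
    then show ?thesis using fn(3) by simp
  qed
  have full: "cnt (nw e) = qt (\<not> d) (nw e)" using inv c en unfolding e by (force simp: da_inv_def)
  have t': "thr_inv thr (m(e := 1, f := 0))"
    by (rule thr_inv_change[OF T(1)]) (use t e in \<open>auto split: if_splits\<close>)
  have p: "p(nu f := Suc f) = p(nu f := Suc (p (nu f)))" using pf by simp
  have bf: "in_block p (nu f)" using pf fn by (auto simp: in_block_def)
  show "da_inv (p(nu f := Suc f)) thr (m(e := 1, f := 0)) cnt (Suc (nu f)) i"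
    unfolding da_inv_def
  proof (intro conjI allI impI)
    show "ptr_inv (p(nu f := Suc f))" unfolding p by (rule ptr_inv_advance[OF T(2)])
    show "thr_inv thr (m(e := 1, f := 0))" by (rule t')
    fix k assume k: "k < n" "k < (p(nu f := Suc f)) (nu k)"
    have *: "cnt (nw k) = qt (\<not> d) (nw k) \<and> (\<forall>j \<in> held (m(e := 1, f := 0)) (nw k). cr j < cr k)"
    proof (cases "k = f")
      case True
      have "cr j < cr f" if "j \<in> held m (nw e)" "j \<noteq> f" for j
      proof -
        have "cr j \<noteq> cr f" using that bk_cr fn(1) by (metis (mono_tags, lifting) held_def mem_Collect_eq)
        then show ?thesis using maxf[OF that(1)] by simp
      qed
      then show ?thesis using True full fn lt unfolding held by auto
    next
      case False
      then have "k < p (nu k)" using k pf by (auto split: if_splits)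
      then have "cnt (nw k) = qt (\<not> d) (nw k) \<and> (\<forall>j \<in> held m (nw k). cr j < cr k)"
        using inv k by (auto simp: da_inv_def)
      then show ?thesis unfolding held using mem(2) lt by (auto intro: less_trans)
    qed
    then show "cnt (nw k) = qt (\<not> d) (nw k)" by simp
    show "\<forall>j \<in> held (m(e := 1, f := 0)) (nw k). cr j < cr k" using * by simp
  next
    fix k assume k: "k < n" "(m(e := 1, f := 0)) k \<noteq> 0"
    then have "k = e \<or> m k \<noteq> 0 \<and> k \<noteq> f" by (auto split: if_splits)
    then show "(p(nu f := Suc f)) (nu k) = k"
    proof
      assume "k = e" then show ?thesis using ef en e by simp
    next
      assume a: "m k \<noteq> 0 \<and> k \<noteq> f"
      then have "p (nu k) = k" using inv k(1) by (auto simp: da_inv_def)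
      then show ?thesis using a pf by auto
    qed
  next
    fix k assume k: "k < n" "k < i \<or> Suc (nu f) \<noteq> 0 \<and> k = i"
    then have "settled p m (nu k) \<or> v = nu k" using inv unfolding da_inv_def by auto
    then show "settled (p(nu f := Suc f)) (m(e := 1, f := 0)) (nu k) \<or> Suc (nu f) = Suc (nu k)"
      using e ef unfolding settled_def in_block_def by auto
  qed (use inv card fn in \<open>auto simp: da_inv_def\<close>)
  show "da_pot (p(nu f := Suc f)) thr (Suc (nu f)) i < da_pot p thr (Suc v) i"
    using ptr_pot_advance[OF bf] unfolding p by (auto simp: da_pot_def)
qed

text \<open>A passed edge is rejected by its full receiver. An edge not yet passed is at or after
  the pointer of a settled proposer, whose single place is then filled by an edge at least as
  good.\<close>

lemma da_final:
  assumes inv: "da_inv p thr m cnt u n" and q: "\<And>v. qt d v = 1"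
  shows "asg (sel m)" "\<forall>e \<in> E. \<not> blk (sel m) e"
proof -
  have u: "u = 0" using inv by (auto simp: da_inv_def)
  have cardheld: "card (star (\<not> d) w (sel m)) = card (held m w)" for w
    unfolding card_star_sel held_def by (intro arg_cong[of _ _ card]) (auto simp: vt'_ed)
  show "asg (sel m)"
    unfolding asg_def
  proof (intro conjI allI)
    show "sel m \<subseteq> E" by (rule sel_subset)
    fix d' v
    show "card (star d' v (sel m)) \<le> qt d' v"
    proof (cases "d' = d")
      case True
      have "{k. k < n \<and> m k \<noteq> 0 \<and> vt d (ed k) = v} \<subseteq> {p v}"
        using inv by (auto simp: da_inv_def vt_ed)
      then have "card {k. k < n \<and> m k \<noteq> 0 \<and> vt d (ed k) = v} \<le> 1"
        using card_mono[of "{p v}"] by force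
      then show ?thesis using True q by (simp add: card_star_sel)
    next
      case False
      then have d': "d' = (\<not> d)" by auto
      show ?thesis
      proof (cases "held m v = {}")
        case True
        then show ?thesis unfolding d' cardheld by simp
      next
        case False
        then obtain k where "k < n" "nw k = v" by (auto simp: held_def)
        then show ?thesis using inv unfolding d' cardheld by (auto simp: da_inv_def)
      qed
    qed
  qed
  show "\<forall>e \<in> E. \<not> blk (sel m) e"
  proof
    fix e assume "e \<in> E"
    then obtain k where k: "k < n" "e = ed k" by (rule E_cases)
    show "\<not> blk (sel m) e"
    proof (cases "k < p (nu k)")
      case True
      then have "rej (\<not> d) (sel m) (ed k)"
        using inv k(1) unfolding rej_def full_def vt'_ed[OF k(1)] cardheld worse'_sel[OF k(1)]
        by (auto simp: da_inv_def held_def)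
      then show ?thesis by (auto simp: blk_def k)
    next
      case False
      have "in_block p (nu k)" using False k inv by (intro in_block_between) (auto simp: da_inv_def)
      moreover have "settled p m (nu k)" using inv k u by (auto simp: da_inv_def)
      ultimately have pk: "p (nu k) < n" "nu (p (nu k)) = nu k" "m (p (nu k)) \<noteq> 0"
        by (auto simp: settled_def in_block_def)
      show ?thesis
      proof (cases "m k = 0")
        case True
        have "p (nu k) \<noteq> k" using pk True by metis
        then have lt: "p (nu k) < k" using False by simp
        have "worse d (sel m) (ed k)"
          using inv lt k unfolding worse_sel[OF k(1)] da_inv_def by metis
        moreover have "star d (nu k) (sel m) \<noteq> {}"
          using pk ed_in_sel[of "p (nu k)" m] vt_ed[of "p (nu k)"] by (metis empty_iff mem_star)
        then have "1 \<le> card (star d (nu k) (sel m))"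
          using finite_star finite_subset[OF sel_subset finite_E] by (simp add: Suc_le_eq card_gt_0_iff)
        ultimately have "rej d (sel m) (ed k)" by (simp add: rej_def full_def vt_ed k q)
        then show ?thesis by (auto simp: blk_def k)
      next
        case False
        then show ?thesis using k by (simp add: blk_def ed_in_sel)
      qed
    qed
  qed
qed

end

text \<open>The \<open>let\<close> abbreviates expressions that are evaluated anew at each use. The
  displaced edge is stored in an array of its own because the write to \<open>u\<close> changes what
  \<open>v\<close>, \<open>e\<close> and \<open>f\<close> denote.\<close>

definition da_body :: com where
  "da_body =
    (let v = Pred (var ''u''); e = Read ''p'' v; w = Read ''student_list_b'' e;
         t = Read ''thr'' w; f = Read ''xpos'' t in
     Cond (Equal (var ''u'') (Const 0)) (set_var ''u'' (Succ (Read ''student_list_a'' (var ''i''))))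
     (Cond (Neg (Conj (Conj (Less e (var ''edges'')) (Equal (Read ''student_list_a'' e) v))
          (Equal (Read ''m'' e) (Const 0))))
       (set_var ''u'' (Const 0) ;; set_var ''i'' (Succ (var ''i'')))
     (Cond (Less (Read ''cnt'' w) (Read ''quota'' w))
       (Write ''m'' e (Const 1) ;; Write ''cnt'' w (Succ (Read ''cnt'' w)) ;;
        set_var ''u'' (Const 0) ;; set_var ''i'' (Succ (var ''i'')))
     (Cond (Equal (Read ''m'' f) (Const 0)) (Write ''thr'' w (Pred t))
     (Cond (Less t (Read ''ypos'' e)) (Write ''p'' v (Succ e))
       (set_var ''f'' f ;; Write ''m'' e (Const 1) ;; Write ''m'' (var ''f'') (Const 0) ;;
        set_var ''u'' (Succ (Read ''student_list_a'' (var ''f''))) ;;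
        Write ''p'' (Read ''student_list_a'' (var ''f'')) (Succ (var ''f''))))))))"

definition da_prog :: com where
  "da_prog = (set_var ''i'' (Const 0) ;; set_var ''u'' (Const 0)) ;;
     While (Less (var ''i'') (var ''edges'')) da_body"

text \<open>The potential is at most \<open>4 * n + 1\<close>, hence at most
  \<open>5 * max 1 n\<close>; the sixth share absorbs initialisation and the last test.\<close>

definition da_cost :: nat where
  "da_cost = (max_cost da_body + 20) * 6"

context edge_lists
begin

lemma da_correct:
  assumes n: "s ''edges'' 0 = n" and nu: "s ''student_list_a'' = nu" and nw: "s ''student_list_b'' = nw"
    and cr: "s ''ypos'' = cr" and bk: "s ''xpos'' = bk"
    and quota: "\<forall>k<n. s ''quota'' (nw k) = qt (\<not> d) (nw k)" and q: "\<And>v. qt d v = 1"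
    and m: "s ''m'' = (\<lambda>_. 0)" and cnt: "s ''cnt'' = (\<lambda>_. 0)"
    and p: "\<forall>k<n. s ''p'' (nu k) \<le> k \<and> nu (s ''p'' (nu k)) = nu k"
    and t: "\<forall>t<n. t \<le> s ''thr'' (nw (bk t)) \<and> s ''thr'' (nw (bk t)) < n \<and>
      nw (bk (s ''thr'' (nw (bk t)))) = nw (bk t)"
  shows "halts da_prog s (da_cost * max 1 n) (\<lambda>s'. asg (sel (s' ''m'')) \<and>
    (\<forall>e \<in> E. \<not> blk (sel (s' ''m'')) e) \<and> (\<forall>k<n. s' ''cnt'' (nw k) = card (star (\<not> d) (nw k) (sel (s' ''m'')))))"
proof -
  let ?b = "Less (var ''i'') (var ''edges'')" and ?s = "s(''i'' := (s ''i'')(0 := 0), ''u'' := (s ''u'')(0 := 0))"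
  define J where "J = (\<lambda>s::memory. s ''edges'' 0 = n \<and> s ''student_list_a'' = nu \<and> s ''student_list_b'' = nw \<and>
     s ''ypos'' = cr \<and> s ''xpos'' = bk \<and> (\<forall>k<n. s ''quota'' (nw k) = qt (\<not> d) (nw k)) \<and>
     da_inv (s ''p'') (s ''thr'') (s ''m'') (s ''cnt'') (s ''u'' 0) (s ''i'' 0))"
  define \<phi> where "\<phi> = (\<lambda>s::memory. da_pot (s ''p'') (s ''thr'') (s ''u'' 0) (s ''i'' 0))"
  have step: "J (exec da_body s) \<and> \<phi> (exec da_body s) < \<phi> s" if J: "J s" and b: "bval ?b s" for s
  proof (cases "s ''u'' 0")
    case 0
    have "exec da_body s = s(''u'' := (s ''u'')(0 := Suc (nu (s ''i'' 0))))"
      using 0 J by (simp add: da_body_def Let_def J_def)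
    then show ?thesis
      using J b 0 da_start[of "s ''p''" "s ''thr''" "s ''m''" "s ''cnt''" "s ''i'' 0"]
      by (simp add: J_def \<phi>_def)
  next
    case (Suc v)
    let ?p = "s ''p''" and ?thr = "s ''thr''" and ?m = "s ''m''" and ?cnt = "s ''cnt''" and ?i = "s ''i'' 0"
    let ?e = "?p v"
    have inv: "da_inv ?p ?thr ?m ?cnt (Suc v) ?i" using J Suc by (simp add: J_def)
    have i: "?i < n" using J b by (simp add: J_def)
    show ?thesis
    proof (cases "in_block ?p v \<and> ?m ?e = 0")
      case False
      then have "exec da_body s = s(''u'' := (s ''u'')(0 := 0), ''i'' := (s ''i'')(0 := Suc ?i))"
        using Suc J unfolding in_block_def by (simp add: da_body_def Let_def J_def)
      then show ?thesis
        using J Suc da_settle[OF inv i] False by (simp add: J_def \<phi>_def settled_def)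
    next
      case True
      then have e: "?e < n" "nu ?e = v" "?m ?e = 0" by (auto simp: in_block_def)
      have Q: "s ''quota'' (nw ?e) = qt (\<not> d) (nw ?e)" using J e by (simp add: J_def)
      show ?thesis
      proof (cases "?cnt (nw ?e) < qt (\<not> d) (nw ?e)")
        case c: True
        then have "exec da_body s = s(''m'' := ?m(?e := 1), ''cnt'' := ?cnt(nw ?e := Suc (?cnt (nw ?e))),
            ''u'' := (s ''u'')(0 := 0), ''i'' := (s ''i'')(0 := Suc ?i))"
          using Suc J e Q by (simp add: da_body_def Let_def J_def)
        then show ?thesis
          using J Suc da_accept[OF inv _ _ c refl] True by (simp add: J_def \<phi>_def)
      next
        case c: False
        show ?thesis
        proof (cases "?m (bk (?thr (nw ?e))) = 0")
          case f: True
          then have "exec da_body s = s(''thr'' := ?thr(nw ?e := ?thr (nw ?e) - 1))"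
            using Suc J e Q c by (simp add: da_body_def Let_def J_def)
          then show ?thesis
            using J Suc da_lower[OF inv e(1) c f] by (simp add: J_def \<phi>_def)
        next
          case f: False
          show ?thesis
          proof (cases "?thr (nw ?e) < cr ?e")
            case t: True
            then have "exec da_body s = s(''p'' := ?p(v := Suc ?e))"
              using Suc J e Q c f by (simp add: da_body_def Let_def J_def)
            then show ?thesis
              using J Suc da_reject[OF inv _ _ c t] True by (simp add: J_def \<phi>_def)
          next
            case t: False
            let ?f = "bk (?thr (nw ?e))"
            have "exec da_body s = s(''f'' := (s ''f'')(0 := ?f), ''m'' := ?m(?e := 1, ?f := 0),
                ''u'' := (s ''u'')(0 := Suc (nu ?f)), ''p'' := ?p(nu ?f := Suc ?f))"
              using Suc J e Q c f t by (simp add: da_body_def Let_def J_def)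
            then show ?thesis
              using J Suc da_replace[OF inv _ _ c t refl refl f] True by (simp add: J_def \<phi>_def)
          qed
        qed
      qed
    qed
  qed
  have init: "da_inv (s ''p'') (s ''thr'') (s ''m'') (s ''cnt'') 0 0"
  proof -
    have "ptr_inv (s ''p'')" unfolding ptr_inv_def
    proof (intro allI impI)
      fix k assume "k < n"
      then show "\<exists>j<n. nu j = nu k \<and> j \<le> s ''p'' (nu k)"
        using p by (intro exI[of _ "s ''p'' (nu k)"]) (auto intro: le_less_trans)
    qed
    moreover have thr: "s ''thr'' (nw k) < n \<and> nw (bk (s ''thr'' (nw k))) = nw k \<and> cr k \<le> s ''thr'' (nw k)" if "k < n" for k
      using t[rule_format, OF cr_less[OF that]] bk_cr[OF that] by simp
    then have "thr_inv (s ''thr'') (s ''m'')" by (simp add: thr_inv_def)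
    moreover have "\<not> k < s ''p'' (nu k)" if "k < n" for k using p that by (simp add: not_less)
    ultimately show ?thesis using thr m cnt qt'_pos by (simp add: da_inv_def held_def)
  qed
  have "halts (set_var ''i'' (Const 0) ;; set_var ''u'' (Const 0)) s
     (max_cost (set_var ''i'' (Const 0) ;; set_var ''u'' (Const 0))) (\<lambda>s'. s' = ?s)"
    by (rule halts_exec) auto
  moreover have "halts (While ?b da_body) s' ((max_cost da_body + 1 + bcost ?b) * (4 * n + 1) + 1 + bcost ?b)
      (\<lambda>s'. J s' \<and> \<not> bval ?b s')" if s': "s' = ?s" for s'
  proof (rule halts_mono[OF halts_While_exec[where J = J and \<phi> = \<phi>]])
    show "J s'" using n nu nw cr bk quota init unfolding s' J_def by simp
    have "\<phi> s' \<le> 4 * n + 1"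
      using ptr_pot_le[of "s' ''p''"] thr_pot_le[of "s' ''thr''"] unfolding \<phi>_def da_pot_def
      by (auto intro: le_SucI)
    then have "(max_cost da_body + 1 + bcost ?b) * \<phi> s' \<le> (max_cost da_body + 1 + bcost ?b) * (4 * n + 1)"
      by (rule mult_le_mono2)
    then show "(max_cost da_body + 1 + bcost ?b) * \<phi> s' + 1 + bcost ?b
      \<le> (max_cost da_body + 1 + bcost ?b) * (4 * n + 1) + 1 + bcost ?b" by simp
  qed (use step in \<open>auto simp: da_body_def Let_def\<close>)
  ultimately have "halts da_prog s
      (max_cost (set_var ''i'' (Const 0) ;; set_var ''u'' (Const 0)) +
       ((max_cost da_body + 1 + bcost ?b) * (4 * n + 1) + 1 + bcost ?b)) (\<lambda>s'. J s' \<and> \<not> bval ?b s')"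
    unfolding da_prog_def by (rule halts_Seq)
  then show ?thesis
  proof (rule halts_mono)
    have "(max_cost da_body + 6) * (4 * n + 1) + 12 \<le> (max_cost da_body + 20) * (5 * max 1 n) + 12 * max 1 n"
      by (intro add_mono mult_mono) auto
    then show "max_cost (set_var ''i'' (Const 0) ;; set_var ''u'' (Const 0)) +
       ((max_cost da_body + 1 + bcost ?b) * (4 * n + 1) + 1 + bcost ?b) \<le> da_cost * max 1 n"
      by (simp add: da_cost_def algebra_simps)
  next
    fix s' assume "J s' \<and> \<not> bval ?b s'"
    then have inv: "da_inv (s' ''p'') (s' ''thr'') (s' ''m'') (s' ''cnt'') (s' ''u'' 0) n"
      by (auto simp: J_def da_inv_def)
    have "s' ''cnt'' (nw k) = card (star (\<not> d) (nw k) (sel (s' ''m'')))" if "k < n" for k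
    proof -
      have "s' ''cnt'' (nw k) = card (held (s' ''m'') (nw k))" using inv that by (simp add: da_inv_def)
      also have "\<dots> = card (star (\<not> d) (nw k) (sel (s' ''m'')))"
        unfolding card_star_sel held_def by (intro arg_cong[of _ _ card]) (auto simp: vt'_ed)
      finally show ?thesis .
    qed
    then show "asg (sel (s' ''m'')) \<and> (\<forall>e \<in> E. \<not> blk (sel (s' ''m'')) e) \<and>
       (\<forall>k<n. s' ''cnt'' (nw k) = card (star (\<not> d) (nw k) (sel (s' ''m''))))"
      using da_final[OF inv q] by simp
  qed
qed

end

section \<open>Rotating and removing\<close>

locale phase = edge_lists E vt rk qt d n ed nu nw cr bk
  for E :: "'e set" and vt rk qt d n ed nu nw cr bk +
  fixes M0 :: "'e set" and fl :: "nat \<Rightarrow> nat"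
  assumes M0: "asg M0" "\<forall>e \<in> E. \<not> blk M0 e"
    and fl: "k < n \<Longrightarrow> fl (nw k) \<noteq> 0 \<longleftrightarrow> full (\<not> d) M0 (nw k)"
begin

text \<open>The third conjunct makes passed edges useless as proposals, so the edge at the pointer
  is the next one available; the fourth guarantees that this edge has not been removed.\<close>

definition trace :: "(nat \<Rightarrow> nat) \<Rightarrow> (nat \<Rightarrow> nat) \<Rightarrow> (nat \<Rightarrow> nat) \<Rightarrow> 'e set \<Rightarrow> 'e set set \<Rightarrow> bool" where
  "trace p m mk R C \<longleftrightarrow> reach d M0 (sel m) R C \<and> sel mk = \<Union>C \<and>
     (\<forall>k<n. k < p (nu k) \<longrightarrow> m k \<noteq> 0 \<or> ed k \<in> R \<or> \<not> worse d (sel m) (ed k)) \<and>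
     (\<forall>k<n. ed k \<in> R \<longrightarrow> k < p (nu k))"

text \<open>\<open>u\<close> would propose next to a vertex whose worst edge belongs to \<open>u'\<close>. The stack follows these links until it
  reaches a dead vertex (then a removal is due) or closes a cycle (a rotation).\<close>

definition link :: "(nat \<Rightarrow> nat) \<Rightarrow> (nat \<Rightarrow> nat) \<Rightarrow> (nat \<Rightarrow> nat) \<Rightarrow> nat \<Rightarrow> nat \<Rightarrow> bool" where
  "link p thr m u u' \<longleftrightarrow> in_block p u \<and> m (p u) = 0 \<and> fl (nw (p u)) \<noteq> 0 \<and>
     m (bk (thr (nw (p u)))) \<noteq> 0 \<and> cr (p u) < thr (nw (p u)) \<and> nu (bk (thr (nw (p u)))) = u'"

text \<open>Distinct entries that own edges bound the height by \<open>n\<close>. The bottom belongs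
  to position \<open>i\<close>, so reaching \<open>i = n\<close> forces an empty stack.\<close>

definition stack_inv :: "(nat \<Rightarrow> nat) \<Rightarrow> (nat \<Rightarrow> nat) \<Rightarrow> nat \<Rightarrow> nat \<Rightarrow> bool" where
  "stack_inv ons stk sp i \<longleftrightarrow> inj_on stk {..<sp} \<and> stk ` {..<sp} \<subseteq> nu ` {..<n} \<and>
     (\<forall>v. ons v \<noteq> 0 \<longleftrightarrow> v \<in> stk ` {..<sp}) \<and> (0 < sp \<longrightarrow> stk 0 = nu i \<and> i < n) \<and> i \<le> n"

definition exhausted :: "(nat \<Rightarrow> nat) \<Rightarrow> nat \<Rightarrow> bool" where
  "exhausted p i \<longleftrightarrow> (\<forall>j<i. \<forall>k<n. nu k = nu j \<longrightarrow> k < p (nu j))"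

definition phase_inv where
  "phase_inv p thr m mk ons stk sp i \<longleftrightarrow> ptr_inv p \<and> thr_inv thr m \<and> (\<exists>R C. trace p m mk R C) \<and>
     stack_inv ons stk sp i \<and> (\<forall>a. Suc a < sp \<longrightarrow> link p thr m (stk a) (stk (Suc a))) \<and> exhausted p i"

text \<open>An edge passed by a pointer pays twice: for pushing the displaced vertex and for popping it.\<close>

definition phase_pot where
  "phase_pot p thr sp i = 2 * ptr_pot p + thr_pot thr + (n + 1 - sp) + 2 * (n - i)"

lemma stack_le: "stack_inv ons stk sp i \<Longrightarrow> sp \<le> n"
proof -
  assume a: "stack_inv ons stk sp i"
  then have "sp = card (stk ` {..<sp})" by (simp add: stack_inv_def card_image)
  also have "\<dots> \<le> card (nu ` {..<n})" using a by (intro card_mono) (auto simp: stack_inv_def)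
  also have "\<dots> \<le> n" using card_image_le[of "{..<n}" nu] by simp
  finally show ?thesis .
qed

lemma in_blockD: "in_block p u \<Longrightarrow> p u < n" "in_block p u \<Longrightarrow> nu (p u) = u"
  by (auto simp: in_block_def)

lemma ptr_inv_mono:
  assumes "ptr_inv p" "\<And>v. p v \<le> p' v" shows "ptr_inv p'"
  using assms unfolding ptr_inv_def by (meson order_trans)

lemma exhausted_mono:
  assumes "exhausted p i" "\<And>v. p v \<le> p' v" shows "exhausted p' i"
  using assms unfolding exhausted_def by (meson less_le_trans)

lemma reach_full:
  assumes "trace p m mk R C" "k < n"
  shows "fl (nw k) \<noteq> 0 \<longleftrightarrow> full (\<not> d) (sel m) (nw k)"
  using fl[OF assms(2)] reach_card_star[OF M0, of d "sel m" R C "\<not> d" "nw k"] assms(1)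
  by (simp add: full_def trace_def)

lemma thr_edge:
  assumes "thr_inv thr m" "k < n"
  shows "bk (thr (nw k)) < n" "nw (bk (thr (nw k))) = nw k" "cr (bk (thr (nw k))) = thr (nw k)"
  using assms bk_less cr_bk unfolding thr_inv_def by blast+

lemma thr_worst:
  assumes t: "thr_inv thr m" "k < n" and f: "f = bk (thr (nw k))" "m f \<noteq> 0"
  shows "worst (\<not> d) (sel m) (ed f)"
proof -
  note f' = thr_edge[OF t, folded f(1)]
  have "cr j \<le> cr f" if "j < n" "m j \<noteq> 0" "nw j = nw f" for j
    using t(1) that f' unfolding thr_inv_def by metis
  then show ?thesis using f(2) f'(1) by (simp add: worst'_sel)
qed

text \<open>The receiving end does not reject the candidate, which beats a held edge there; being
  neither removed nor blocking, the candidate must be rejected by the proposing side.\<close>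

lemma link_worse:
  assumes tr: "trace p m mk R C" and t: "thr_inv thr m" and l: "link p thr m u u'"
  shows "worse d (sel m) (ed (p u))" "ed (p u) \<notin> R"
proof -
  let ?e = "p u" and ?f = "bk (thr (nw (p u)))"
  have e: "?e < n" "nu ?e = u" "m ?e = 0" using l by (auto simp: link_def in_block_def)
  show R: "ed ?e \<notin> R" using tr e by (auto simp: trace_def)
  note f = thr_edge[OF t e(1)]
  have "m ?f \<noteq> 0" "cr ?e < cr ?f" using l f(3) by (auto simp: link_def)
  then have "\<not> worse (\<not> d) (sel m) (ed ?e)" using f unfolding worse'_sel[OF e(1)] by (metis less_asym)
  moreover have "\<not> blk (sel m) (ed ?e)"
    using reach_chain[OF M0, of d "sel m" R C] tr R ed_in_E[OF e(1)] by (auto simp: trace_def)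
  ultimately show "worse d (sel m) (ed ?e)"
    using e ed_in_E[OF e(1)] unfolding blk_def rej_def by (cases d) (auto simp: ed_in_sel all_bool_eq)
qed

lemma trace_advance:
  assumes tr: "trace p m mk R C" and u: "in_block p u"
    and e: "m (p u) \<noteq> 0 \<or> \<not> worse d (sel m) (ed (p u)) \<or> removable d (sel m) R (ed (p u))"
  shows "\<exists>R'. trace (p(u := Suc (p u))) m mk R' C"
proof -
  note e' = in_blockD[OF u]
  have lt: "k < (p(u := Suc (p u))) (nu k) \<longleftrightarrow> k < p (nu k) \<or> k = p u" for k
    using e' by auto
  show ?thesis
  proof (cases "removable d (sel m) R (ed (p u))")
    case True
    then have "reach d M0 (sel m) (insert (ed (p u)) R) C"
      using tr reach.remove by (auto simp: trace_def)
    then have "trace (p(u := Suc (p u))) m mk (insert (ed (p u)) R) C"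
      using tr e' ed_inj[of _ "p u"] unfolding trace_def lt by auto
    then show ?thesis by blast
  next
    case False
    then have "trace (p(u := Suc (p u))) m mk R C" using tr e unfolding trace_def lt by auto
    then show ?thesis by blast
  qed
qed

text \<open>Only the top entry moves its pointer, and every link below depends on the pointer of a
  different vertex.\<close>

lemma links_advance:
  assumes inj: "inj_on stk {..<sp}" and l: "\<forall>a. Suc a < sp \<longrightarrow> link p thr m (stk a) (stk (Suc a))" and "0 < sp"
  shows "\<forall>a. Suc a < sp \<longrightarrow> link (p(stk (sp - 1) := x)) thr m (stk a) (stk (Suc a))"
proof (intro allI impI)
  fix a assume a: "Suc a < sp"
  then have "stk a \<noteq> stk (sp - 1)" using inj_onD[OF inj, of a "sp - 1"] by auto
  then show "link (p(stk (sp - 1) := x)) thr m (stk a) (stk (Suc a))"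
    using l a by (auto simp: link_def in_block_def)
qed

lemma phase_push_first:
  assumes inv: "phase_inv p thr m mk ons stk 0 i" and i: "i < n"
  shows "phase_inv p thr m mk (ons(nu i := 1)) (stk(0 := nu i)) 1 i"
    "phase_pot p thr 1 i < phase_pot p thr 0 i"
  using inv i by (auto simp: phase_inv_def stack_inv_def phase_pot_def inj_on_def)

text \<open>The passed edge need not be removed: it may be held or rank above a held edge. Otherwise
  the flag or the threshold supplies one of the first two cases of \<open>removable\<close>.\<close>

lemma phase_skip:
  assumes inv: "phase_inv p thr m mk ons stk sp i" and sp: "0 < sp" and u: "u = stk (sp - 1)"
    and b: "in_block p u" and e: "m (p u) \<noteq> 0 \<or> fl (nw (p u)) = 0 \<or> thr (nw (p u)) < cr (p u)"
  shows "phase_inv (p(u := Suc (p u))) thr m mk ons stk sp i"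
    "phase_pot (p(u := Suc (p u))) thr sp i < phase_pot p thr sp i"
proof -
  note e' = in_blockD[OF b]
  obtain R C where tr: "trace p m mk R C" using inv by (auto simp: phase_inv_def)
  have t: "thr_inv thr m" using inv by (auto simp: phase_inv_def)
  have "removable d (sel m) R (ed (p u))" if "m (p u) = 0" "worse d (sel m) (ed (p u))"
  proof -
    have "worse (\<not> d) (sel m) (ed (p u))" if "thr (nw (p u)) < cr (p u)"
      using t that unfolding worse'_sel[OF e'(1)] thr_inv_def by (metis le_less_trans)
    moreover have "\<not> full (\<not> d) (sel m) (nw (p u))" if "fl (nw (p u)) = 0"
      using reach_full[OF tr e'(1)] that by simp
    ultimately show ?thesis
      using that e ed_in_E[OF e'(1)] ed_in_sel[OF e'(1)] vt'_ed[OF e'(1)] by (auto simp: removable_def)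
  qed
  then obtain R' where "trace (p(u := Suc (p u))) m mk R' C" using trace_advance[OF tr b] by blast
  moreover have "exhausted (p(u := Suc (p u))) i"
    by (rule exhausted_mono[of p]) (use inv in \<open>auto simp: phase_inv_def\<close>)
  ultimately show "phase_inv (p(u := Suc (p u))) thr m mk ons stk sp i"
    using inv sp links_advance[of stk sp p thr m] ptr_inv_advance
    unfolding phase_inv_def stack_inv_def u by blast
  show "phase_pot (p(u := Suc (p u))) thr sp i < phase_pot p thr sp i"
    using ptr_pot_advance[OF b] by (simp add: phase_pot_def)
qed

lemma trace_dead:
  assumes tr: "trace p m mk R C" and p: "ptr_inv p" and u: "\<not> in_block p u"
  shows "dead d (sel m) R u"
  unfolding dead_def
proof (intro ballI impI)
  fix e assume e: "e \<in> E - sel m" "vt d e = u" "worse d (sel m) e"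
  obtain k where k: "k < n" "e = ed k" using e(1) by (auto elim: E_cases)
  then have "nu k = u" using e vt_ed by simp
  then have "k < p (nu k)" using in_block_between[OF p k(1)] u by (meson not_le)
  then show "e \<in> R" using tr k e ed_in_sel[OF k(1)] by (auto simp: trace_def)
qed

lemma phase_pop_last:
  assumes inv: "phase_inv p thr m mk ons stk 1 i" and b: "\<not> in_block p (stk 0)"
  shows "phase_inv p thr m mk (ons(stk 0 := 0)) stk 0 (Suc i)"
    "phase_pot p thr 0 (Suc i) < phase_pot p thr 1 i"
proof -
  have i: "stk 0 = nu i" "i < n" and p: "ptr_inv p" using inv by (auto simp: phase_inv_def stack_inv_def)
  have "k < p (nu i)" if "k < n" "nu k = nu i" for k
    using in_block_between[OF p that(1)] that(2) b i(1) by (metis not_le)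
  then show "phase_inv p thr m mk (ons(stk 0 := 0)) stk 0 (Suc i)"
    using inv i by (auto simp: phase_inv_def stack_inv_def exhausted_def less_Suc_eq)
  show "phase_pot p thr 0 (Suc i) < phase_pot p thr 1 i"
    using i by (auto simp: phase_pot_def)
qed

text \<open>The dead top owns the worst edge where the entry below wants to propose: the third case
  of \<open>removable\<close>. Passing that candidate frees two units, one of which covers the
  regained stack slot.\<close>

lemma phase_pop:
  assumes inv: "phase_inv p thr m mk ons stk (Suc (Suc a)) i" and b: "\<not> in_block p (stk (Suc a))"
  shows "phase_inv (p(stk a := Suc (p (stk a)))) thr m mk (ons(stk (Suc a) := 0)) stk (Suc a) i"
    "phase_pot (p(stk a := Suc (p (stk a)))) thr (Suc a) i < phase_pot p thr (Suc (Suc a)) i"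
proof -
  let ?e = "p (stk a)"
  obtain R C where tr: "trace p m mk R C" using inv by (auto simp: phase_inv_def)
  have t: "thr_inv thr m" "ptr_inv p" and st: "stack_inv ons stk (Suc (Suc a)) i"
    using inv by (auto simp: phase_inv_def)
  have l: "link p thr m (stk a) (stk (Suc a))" using inv by (auto simp: phase_inv_def)
  then have ib: "in_block p (stk a)" by (simp add: link_def)
  note e = in_blockD[OF ib]
  have "removable d (sel m) R (ed ?e)"
    unfolding removable_def
  proof (intro conjI disjI2 exI)
    let ?f = "bk (thr (nw ?e))"
    show "ed ?e \<in> E - sel m" using l e ed_in_E ed_in_sel by (auto simp: link_def)
    show "worse d (sel m) (ed ?e)" by (rule link_worse[OF tr t(1) l])
    note f = thr_edge[OF t(1) e(1)]
    show "vt (\<not> d) (ed ?f) = vt (\<not> d) (ed ?e)" using f e vt'_ed by simp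
    show "worst (\<not> d) (sel m) (ed ?f)" using thr_worst[OF t(1) e(1) refl] l by (simp add: link_def)
    have "vt d (ed ?f) = stk (Suc a)" using l f vt_ed by (simp add: link_def)
    then show "dead d (sel m) R (vt d (ed ?f))" using trace_dead[OF tr t(2) b] by simp
  qed
  then obtain R' where "trace (p(stk a := Suc ?e)) m mk R' C" using trace_advance[OF tr ib] by blast
  moreover have "exhausted (p(stk a := Suc ?e)) i"
    by (rule exhausted_mono[of p]) (use inv in \<open>auto simp: phase_inv_def\<close>)
  moreover have "stack_inv (ons(stk (Suc a) := 0)) stk (Suc a) i"
    using st unfolding stack_inv_def by (auto simp: lessThan_Suc)
  moreover have "\<forall>b. Suc b < Suc a \<longrightarrow> link (p(stk a := Suc ?e)) thr m (stk b) (stk (Suc b))"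
    using links_advance[of stk "Suc a" p thr m] inv by (auto simp: phase_inv_def stack_inv_def lessThan_Suc)
  ultimately show "phase_inv (p(stk a := Suc ?e)) thr m mk (ons(stk (Suc a) := 0)) stk (Suc a) i"
    using t ptr_inv_advance unfolding phase_inv_def by blast
  show "phase_pot (p(stk a := Suc ?e)) thr (Suc a) i < phase_pot p thr (Suc (Suc a)) i"
    using ptr_pot_advance[OF ib] stack_le[OF st] by (simp add: phase_pot_def)
qed

text \<open>Existing links rest on thresholds whose edge is held, so lowering an unheld one affects
  none of them.\<close>

lemma phase_lower:
  assumes inv: "phase_inv p thr m mk ons stk sp i" and e: "e < n" "fl (nw e) \<noteq> 0"
    and m: "m (bk (thr (nw e))) = 0"
  shows "phase_inv p (thr(nw e := thr (nw e) - 1)) m mk ons stk sp i"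
    "phase_pot p (thr(nw e := thr (nw e) - 1)) sp i < phase_pot p thr sp i"
proof -
  obtain R C where tr: "trace p m mk R C" using inv by (auto simp: phase_inv_def)
  have t: "thr_inv thr m" using inv by (auto simp: phase_inv_def)
  have "full (\<not> d) (sel m) (nw e)" using reach_full[OF tr e(1)] e(2) by simp
  then have "star (\<not> d) (nw e) (sel m) \<noteq> {}" using qt'_pos[OF e(1)] by (auto simp: full_def)
  then obtain j where j: "j < n" "m j \<noteq> 0" "nw j = nw e"
    unfolding star_def sel_def by (auto simp: vt'_ed)
  have t': "thr_inv (thr(nw e := thr (nw e) - 1)) m" "thr_pot (thr(nw e := thr (nw e) - 1)) < thr_pot thr"
    using thr_inv_dec[OF t j(1,2)] m j(3) by auto
  have "link p (thr(nw e := thr (nw e) - 1)) m u u'" if "link p thr m u u'" for u u'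
  proof -
    have "nw (p u) \<noteq> nw e" using that m by (auto simp: link_def)
    then show ?thesis using that by (simp add: link_def)
  qed
  then show "phase_inv p (thr(nw e := thr (nw e) - 1)) m mk ons stk sp i"
    using inv t' unfolding phase_inv_def by blast
  show "phase_pot p (thr(nw e := thr (nw e) - 1)) sp i < phase_pot p thr sp i"
    using t' by (simp add: phase_pot_def)
qed

lemma phase_push:
  assumes inv: "phase_inv p thr m mk ons stk sp i" and sp: "0 < sp"
    and l: "link p thr m (stk (sp - 1)) u'" and o: "ons u' = 0"
  shows "phase_inv p thr m mk (ons(u' := 1)) (stk(sp := u')) (Suc sp) i"
    "phase_pot p thr (Suc sp) i < phase_pot p thr sp i"
proof -
  have t: "thr_inv thr m" and st: "stack_inv ons stk sp i"
    using inv by (auto simp: phase_inv_def)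
  have "in_block p (stk (sp - 1))" using l by (simp add: link_def)
  note e = in_blockD[OF this]
  have u': "u' \<in> nu ` {..<n}" using thr_edge[OF t e(1)] l by (auto simp: link_def)
  have new: "u' \<notin> stk ` {..<sp}" using st o unfolding stack_inv_def by blast
  then have "inj_on (stk(sp := u')) {..<Suc sp}"
    using st unfolding stack_inv_def lessThan_Suc by (auto simp: inj_on_def)
  moreover have "(stk(sp := u')) ` {..<Suc sp} = insert u' (stk ` {..<sp})"
    by (auto simp: lessThan_Suc image_iff)
  ultimately have st': "stack_inv (ons(u' := 1)) (stk(sp := u')) (Suc sp) i"
    using st u' sp unfolding stack_inv_def by simp
  have "link p thr m ((stk(sp := u')) a) ((stk(sp := u')) (Suc a))" if "Suc a < Suc sp" for a
  proof (cases "Suc a = sp")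
    case True
    then have "sp - 1 = a" by simp
    then show ?thesis using l True by auto
  next
    case False
    then show ?thesis using inv that by (auto simp: phase_inv_def)
  qed
  then show "phase_inv p thr m mk (ons(u' := 1)) (stk(sp := u')) (Suc sp) i"
    using inv st' unfolding phase_inv_def by blast
  show "phase_pot p thr (Suc sp) i < phase_pot p thr sp i"
    using stack_le[OF st'] by (simp add: phase_pot_def)
qed

text \<open>Effect of popping the stack entries \<open>c, \<dots>, sp - 1\<close> while executing their part of the rotation.\<close>

definition popped :: "(nat \<Rightarrow> nat) \<Rightarrow> nat \<Rightarrow> nat \<Rightarrow> nat set" where
  "popped stk sp c = stk ` {c..<sp}"

definition incoming :: "(nat \<Rightarrow> nat) \<Rightarrow> (nat \<Rightarrow> nat) \<Rightarrow> nat \<Rightarrow> nat \<Rightarrow> nat set" where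
  "incoming p stk sp c = p ` popped stk sp c"

definition outgoing :: "(nat \<Rightarrow> nat) \<Rightarrow> (nat \<Rightarrow> nat) \<Rightarrow> (nat \<Rightarrow> nat) \<Rightarrow> nat \<Rightarrow> nat \<Rightarrow> nat set" where
  "outgoing p thr stk sp c = (\<lambda>k. bk (thr (nw k))) ` incoming p stk sp c"

definition rot_p where
  "rot_p p stk sp c v = (if v \<in> popped stk sp c then Suc (p v) else p v)"

definition rot_m :: "(nat \<Rightarrow> nat) \<Rightarrow> (nat \<Rightarrow> nat) \<Rightarrow> (nat \<Rightarrow> nat) \<Rightarrow> (nat \<Rightarrow> nat) \<Rightarrow> nat \<Rightarrow> nat \<Rightarrow> nat \<Rightarrow> nat" where
  "rot_m p thr m stk sp c k =
     (if k \<in> incoming p stk sp c then 1 else if k \<in> outgoing p thr stk sp c then 0 else m k)"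

definition rot_mk :: "(nat \<Rightarrow> nat) \<Rightarrow> (nat \<Rightarrow> nat) \<Rightarrow> (nat \<Rightarrow> nat) \<Rightarrow> nat \<Rightarrow> nat \<Rightarrow> nat \<Rightarrow> nat" where
  "rot_mk p mk stk sp c k = (if k \<in> incoming p stk sp c then 1 else mk k)"

definition rot_ons :: "(nat \<Rightarrow> nat) \<Rightarrow> (nat \<Rightarrow> nat) \<Rightarrow> nat \<Rightarrow> nat \<Rightarrow> nat \<Rightarrow> nat" where
  "rot_ons ons stk sp c v = (if v \<in> popped stk sp c then 0 else ons v)"

lemma popped_step: "c < sp \<Longrightarrow> popped stk sp c = insert (stk c) (popped stk sp (Suc c))"
  unfolding popped_def image_insert[symmetric] by (intro arg_cong[of _ _ "image stk"]) auto

text \<open>Before the rotation entering edges are unheld and leaving edges are held, so the two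
  families are disjoint and can be written entry by entry.\<close>

lemma rot_step:
  assumes inj: "inj_on stk {..<sp}" and c: "c < sp"
    and e: "e = rot_p p stk sp (Suc c) (stk c)" and f: "f = bk (thr (nw e))"
    and m: "\<forall>k \<in> incoming p stk sp c. m k = 0 \<and> m (bk (thr (nw k))) \<noteq> 0"
  shows "(rot_p p stk sp (Suc c))(stk c := Suc e) = rot_p p stk sp c"
    "(rot_m p thr m stk sp (Suc c))(f := 0, e := 1) = rot_m p thr m stk sp c"
    "(rot_mk p mk stk sp (Suc c))(e := 1) = rot_mk p mk stk sp c"
    "(rot_ons ons stk sp (Suc c))(stk c := 0) = rot_ons ons stk sp c"
proof -
  have new: "stk c \<notin> popped stk sp (Suc c)"
    unfolding popped_def using inj_onD[OF inj, of c] c by fastforce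
  then have e': "e = p (stk c)" using e by (simp add: rot_p_def)
  note ps = popped_step[OF c, of stk]
  have inc: "incoming p stk sp c = insert e (incoming p stk sp (Suc c))" by (simp add: incoming_def ps e')
  then have out: "outgoing p thr stk sp c = insert f (outgoing p thr stk sp (Suc c))"
    by (simp add: outgoing_def f)
  show "(rot_p p stk sp (Suc c))(stk c := Suc e) = rot_p p stk sp c"
    "(rot_mk p mk stk sp (Suc c))(e := 1) = rot_mk p mk stk sp c"
    "(rot_ons ons stk sp (Suc c))(stk c := 0) = rot_ons ons stk sp c"
    by (auto simp: fun_eq_iff rot_p_def rot_mk_def rot_ons_def ps inc e')
  have "f \<notin> incoming p stk sp c" using m inc f by force
  then show "(rot_m p thr m stk sp (Suc c))(f := 0, e := 1) = rot_m p thr m stk sp c"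
    by (auto simp: fun_eq_iff rot_m_def inc out)
qed

text \<open>\<open>nx\<close> is the cyclic successor on the entries from \<open>j\<close> to the
  top; the link from the top back to \<open>j\<close> closes the cycle.\<close>

lemma rotation_links:
  assumes inv: "phase_inv p thr m mk ons stk sp i" and j: "j < sp"
    and top: "link p thr m (stk (sp - 1)) (stk j)"
  defines "nx \<equiv> \<lambda>a. if Suc a < sp then stk (Suc a) else stk j"
  shows "j \<le> a \<Longrightarrow> a < sp \<Longrightarrow> link p thr m (stk a) (nx a)"
    "inj_on nx {j..<sp}" "nx ` {j..<sp} = stk ` {j..<sp}"
proof -
  have inj: "inj_on stk {..<sp}" using inv by (auto simp: phase_inv_def stack_inv_def)
  show "link p thr m (stk a) (nx a)" if "j \<le> a" "a < sp"
  proof (cases "Suc a < sp")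
    case True
    then show ?thesis using inv by (auto simp: phase_inv_def nx_def)
  next
    case False
    then have "a = sp - 1" using that by simp
    then show ?thesis using top j by (simp add: nx_def)
  qed
  let ?s = "\<lambda>a. if Suc a < sp then Suc a else j"
  have nx: "nx a = stk (?s a)" for a by (simp add: nx_def)
  have si: "inj_on ?s {j..<sp}" by (auto simp: inj_on_def split: if_splits)
  have sm: "?s ` {j..<sp} = {j..<sp}"
  proof
    show "?s ` {j..<sp} \<subseteq> {j..<sp}" using j by auto
    show "{j..<sp} \<subseteq> ?s ` {j..<sp}"
    proof
      fix a assume a: "a \<in> {j..<sp}"
      show "a \<in> ?s ` {j..<sp}"
      proof (cases "a = j")
        case True
        then show ?thesis using j by (intro image_eqI[of _ _ "sp - 1"]) auto
      next
        case False
        then show ?thesis using a by (intro image_eqI[of _ _ "a - 1"]) auto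
      qed
    qed
  qed
  have "inj_on stk (?s ` {j..<sp})" unfolding sm using inj by (rule inj_on_subset) auto
  then show "inj_on nx {j..<sp}" unfolding nx using comp_inj_on[OF si] by (simp add: comp_def)
  show "nx ` {j..<sp} = stk ` {j..<sp}" unfolding nx using sm by (metis image_image)
qed

text \<open>The cycle is a rotation because candidates are next available proposals and thresholds
  are exact on links. Links among entries below \<open>j\<close> involve other proposers and other
  displaced owners, so they survive.\<close>

lemma phase_rotate:
  assumes inv: "phase_inv p thr m mk ons stk sp i" and j: "j < sp"
    and top: "link p thr m (stk (sp - 1)) (stk j)"
  shows "phase_inv (rot_p p stk sp j) thr (rot_m p thr m stk sp j) (rot_mk p mk stk sp j)
      (rot_ons ons stk sp j) stk j i"
    "phase_pot (rot_p p stk sp j) thr j i + (sp - j) = phase_pot p thr sp i"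
    "\<forall>k \<in> incoming p stk sp j. m k = 0 \<and> m (bk (thr (nw k))) \<noteq> 0"
proof -
  obtain R C where tr: "trace p m mk R C" using inv by (auto simp: phase_inv_def)
  have t: "thr_inv thr m" "ptr_inv p" and st: "stack_inv ons stk sp i" and ex: "exhausted p i"
    and lk: "\<forall>a. Suc a < sp \<longrightarrow> link p thr m (stk a) (stk (Suc a))"
    using inv by (auto simp: phase_inv_def)
  have inj: "inj_on stk {..<sp}" using st by (simp add: stack_inv_def)
  define nx where "nx = (\<lambda>a. if Suc a < sp then stk (Suc a) else stk j)"
  have nx: "\<And>a. j \<le> a \<Longrightarrow> a < sp \<Longrightarrow> link p thr m (stk a) (nx a)"
    "inj_on nx {j..<sp}" "nx ` {j..<sp} = stk ` {j..<sp}"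
    unfolding nx_def using rotation_links[OF inv j top] by simp_all
  let ?P = "popped stk sp j" and ?X = "incoming p stk sp j" and ?F = "outgoing p thr stk sp j"
  let ?f = "\<lambda>k. bk (thr (nw k))"
  have ib: "in_block p u" if "u \<in> ?P" for u using nx(1) that by (auto simp: popped_def link_def)
  have X: "\<exists>a. j \<le> a \<and> a < sp \<and> k = p (stk a) \<and> nu k = stk a \<and> k < n \<and> m k = 0 \<and> fl (nw k) \<noteq> 0 \<and>
      m (?f k) \<noteq> 0 \<and> cr k < thr (nw k) \<and> nu (?f k) = nx a \<and> ed k \<notin> R \<and> worse d (sel m) (ed k)"
    if kX: "k \<in> ?X" for k
  proof -
    obtain a where a: "j \<le> a" "a < sp" "k = p (stk a)" using kX by (auto simp: incoming_def popped_def)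
    have l: "link p thr m (stk a) (nx a)" by (rule nx(1)[OF a(1,2)])
    then show ?thesis using a link_worse[OF tr t(1) l] by (intro exI[of _ a]) (auto simp: link_def in_block_def)
  qed
  show mX: "\<forall>k \<in> ?X. m k = 0 \<and> m (?f k) \<noteq> 0" using X by blast
  have Xn: "k < n" if "k \<in> ?X" for k using X[OF that] by blast
  have XP: "k \<in> ?X \<longleftrightarrow> nu k \<in> ?P \<and> k = p (nu k)" if "k < n" for k
    using ib unfolding incoming_def by (auto simp: in_block_def)
  have FP: "nu k \<in> ?P" if "k \<in> ?F" for k
  proof -
    obtain k' where k': "k' \<in> ?X" "k = ?f k'" using \<open>k \<in> ?F\<close> by (auto simp: outgoing_def)
    then obtain a where "j \<le> a" "a < sp" "nu k = nx a" using X[OF k'(1)] by blast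
    then have "nu k \<in> nx ` {j..<sp}" by auto
    then show ?thesis using nx(3) by (simp add: popped_def)
  qed
  have Fn: "k < n \<and> m k \<noteq> 0" if kF: "k \<in> ?F" for k
  proof -
    obtain k' where k': "k' \<in> ?X" "k = ?f k'" using kF by (auto simp: outgoing_def)
    then show ?thesis using thr_edge(1)[OF t(1) Xn[OF k'(1)]] mX by simp
  qed
  let ?p = "rot_p p stk sp j" and ?m = "rot_m p thr m stk sp j" and ?mk = "rot_mk p mk stk sp j"
  have le: "p v \<le> ?p v" for v by (simp add: rot_p_def)
  \<comment> \<open>\<open>rk d\<close> inverts \<open>ed\<close>, which turns the map on positions
    into a map on edges.\<close>
  let ?h = "\<lambda>e. ed (?f (rk d e))"
  have h: "?h (ed k) = ed (?f k)" if "k < n" for k using rk_ed[OF that] by simp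
  have selm: "sel ?m = sel m - ?h ` ed ` ?X \<union> ed ` ?X"
  proof -
    have hX: "?h ` ed ` ?X = ed ` ?F"
      unfolding outgoing_def image_image using Xn rk_ed by (intro image_cong) auto
    have "ed k \<in> ed ` ?F \<longleftrightarrow> k \<in> ?F" "ed k \<in> ed ` ?X \<longleftrightarrow> k \<in> ?X" if "k < n" for k
      using that Xn Fn ed_inj[OF that] by (auto simp: image_iff)
    then show ?thesis
      unfolding hX using Xn Fn by (auto simp: sel_def rot_m_def split: if_splits)
  qed
  have rot: "rotation d (sel m) R (ed ` ?X) ?h"
    unfolding rotation_def
  proof (intro conjI ballI impI)
    show "ed ` ?X \<subseteq> E - sel m - R"
      using X ed_in_E ed_in_sel by fastforce
    fix e assume "e \<in> ed ` ?X"
    then obtain k where k: "e = ed k" "k \<in> ?X" by auto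
    note kn = Xn[OF k(2)]
    note f = thr_edge[OF t(1) kn]
    from X[OF k(2)] obtain a where a: "nu k = stk a" "k = p (stk a)" "m k = 0" "fl (nw k) \<noteq> 0" "m (?f k) \<noteq> 0" "cr k < thr (nw k)"
      "worse d (sel m) (ed k)" by blast
    show "worse d (sel m) e" using a k by simp
    show "worst (\<not> d) (sel m) (?h e)" using thr_worst[OF t(1) kn refl a(5)] rk_ed[OF kn] k(1) by simp
    show "vt (\<not> d) (?h e) = vt (\<not> d) e" using f kn vt'_ed rk_ed k(1) by simp
    show "rk (\<not> d) e < rk (\<not> d) (?h e)" using f kn rk'_ed rk_ed k(1) a by simp
    show "full (\<not> d) (sel m) (vt (\<not> d) e)" unfolding k(1) vt'_ed[OF kn] using reach_full[OF tr kn] a by simp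
    fix e' assume e': "e' \<in> E - sel m - R" "vt d e' = vt d e" "worse d (sel m) e'"
    obtain k' where k': "k' < n" "e' = ed k'" using e'(1) by (auto elim: E_cases)
    \<comment> \<open>By \<open>trace\<close>, an available edge below the held ones has not been
      passed, so it comes no earlier than the candidate.\<close>
    have "\<not> k' < p (nu k')" using tr k' e' ed_in_sel[OF k'(1)] by (auto simp: trace_def)
    moreover have "nu k' = stk a" using e'(2) k k' kn a vt_ed by simp
    ultimately show "rk d e \<le> rk d e'" using k k' kn a rk_ed by simp
  next
    have injX: "inj_on nu ?X"
      by (rule inj_onI) (metis X)
    show "inj_on (vt d) (ed ` ?X)" using injX Xn vt_ed unfolding inj_on_def by fastforce
    have fnx: "?f k = ?f k' \<Longrightarrow> k = k'" "nu (?f k) = nu (?f k') \<Longrightarrow> k = k'" if kX: "k \<in> ?X" "k' \<in> ?X" for k k'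
    proof -
      obtain a a' where a: "j \<le> a" "a < sp" "k = p (stk a)" "nu (?f k) = nx a"
        "j \<le> a'" "a' < sp" "k' = p (stk a')" "nu (?f k') = nx a'"
        using X[OF kX(1)] X[OF kX(2)] by blast
      then show "nu (?f k) = nu (?f k') \<Longrightarrow> k = k'" using inj_onD[OF nx(2), of a a'] by auto
      then show "?f k = ?f k' \<Longrightarrow> k = k'" by simp
    qed
    show "inj_on (vt (\<not> d)) (ed ` ?X)"
    proof (rule inj_onI)
      fix x y assume "x \<in> ed ` ?X" "y \<in> ed ` ?X" and v: "vt (\<not> d) x = vt (\<not> d) y"
      then obtain k k' where k: "x = ed k" "k \<in> ?X" "y = ed k'" "k' \<in> ?X" by auto
      then have "nw k = nw k'" using v Xn vt'_ed by simp
      then show "x = y" using fnx(1)[OF k(2,4)] k by simp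
    qed
    have hv: "vt d (?h (ed k)) = nu (?f k)" if "k \<in> ?X" for k
      using h[OF Xn[OF that]] vt_ed thr_edge(1)[OF t(1) Xn[OF that]] by simp
    show "inj_on (\<lambda>e. vt d (?h e)) (ed ` ?X)"
    proof (rule inj_onI)
      fix x y assume "x \<in> ed ` ?X" "y \<in> ed ` ?X" and v: "vt d (?h x) = vt d (?h y)"
      then obtain k k' where k: "x = ed k" "k \<in> ?X" "y = ed k'" "k' \<in> ?X" by auto
      then have "nu (?f k) = nu (?f k')" using v hv by metis
      then show "x = y" using fnx(2)[OF k(2,4)] k by simp
    qed
    have "(\<lambda>e. vt d (?h e)) ` ed ` ?X = (\<lambda>k. nu (?f k)) ` ?X"
      unfolding image_image by (intro image_cong refl hv)
    also have "\<dots> = nx ` {j..<sp}"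
    proof -
      have "nu (?f (p (stk a))) = nx a" if "a \<in> {j..<sp}" for a
        using nx(1) that by (auto simp: link_def)
      then show ?thesis unfolding incoming_def popped_def image_image by (intro image_cong) auto
    qed
    also have "\<dots> = nu ` ?X" unfolding nx(3) incoming_def popped_def image_image
      using ib in_blockD(2) by (intro image_cong refl) (auto simp: popped_def)
    also have "\<dots> = vt d ` ed ` ?X" unfolding image_image using Xn vt_ed by (intro image_cong) auto
    finally show "(\<lambda>e. vt d (?h e)) ` ed ` ?X = vt d ` ed ` ?X" .
  qed
  have tr': "trace ?p ?m ?mk R (insert (sel ?m) C)"
    unfolding trace_def
  proof (intro conjI allI impI)
    show "reach d M0 (sel ?m) R (insert (sel ?m) C)"
      using reach.rotate[OF _ rot selm] tr by (simp add: trace_def)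
    have "sel ?mk = sel mk \<union> ed ` ?X"
      unfolding sel_def rot_mk_def using Xn by (auto split: if_splits)
    moreover have "sel m \<subseteq> \<Union>C" using reach_chain[OF M0, of d "sel m" R C] tr by (auto simp: trace_def)
    ultimately show "sel ?mk = \<Union>(insert (sel ?m) C)" using selm tr by (auto simp: trace_def)
    fix k assume k: "k < n"
    show "k < ?p (nu k)" if "ed k \<in> R" using tr that k le by (auto simp: trace_def intro: less_le_trans)
    assume kp: "k < ?p (nu k)"
    show "?m k \<noteq> 0 \<or> ed k \<in> R \<or> \<not> worse d (sel ?m) (ed k)"
    \<comment> \<open>For a proposer on the cycle the passed edge is the new one, or precedes it and
      is no longer worse; all other proposers keep their edges.\<close>
    proof (cases "nu k \<in> ?P")
      case True
      show ?thesis
      proof (cases "k = p (nu k)")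
        case eq: True
        then have "k \<in> ?X" using XP[OF k] True by simp
        then show ?thesis by (simp add: rot_m_def)
      next
        case False
        have b: "p (nu k) < n" "nu (p (nu k)) = nu k" using in_blockD[OF ib[OF True]] by auto
        have "p (nu k) \<in> ?X" using True by (auto simp: incoming_def)
        then have "?m (p (nu k)) \<noteq> 0" by (simp add: rot_m_def)
        moreover have "k < p (nu k)" using kp False True by (simp add: rot_p_def)
        ultimately have "\<not> worse d (sel ?m) (ed k)"
          unfolding worse_sel[OF k] using b by (metis less_asym)
        then show ?thesis by simp
      qed
    next
      case False
      have same: "?m k' = m k'" if "nu k' = nu k" "k' < n" for k'
      proof -
        have "k' \<notin> ?X" using XP that False by simp
        moreover have "k' \<notin> ?F" using FP[of k'] that False by auto
        ultimately show ?thesis by (simp add: rot_m_def)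
      qed
      have "m k \<noteq> 0 \<or> ed k \<in> R \<or> \<not> worse d (sel m) (ed k)"
        using tr k kp False by (auto simp: trace_def rot_p_def)
      then show ?thesis unfolding worse_sel[OF k] using same k by (metis)
    qed
  qed
  have below: "stk a \<notin> ?P" if "a < j" for a
  proof
    assume "stk a \<in> ?P"
    then obtain b where "stk a = stk b" "j \<le> b" "b < sp" by (auto simp: popped_def)
    then show False using inj_onD[OF inj, of a b] that j by auto
  qed
  have st': "stack_inv (rot_ons ons stk sp j) stk j i"
  proof -
    have split: "stk ` {..<sp} = stk ` {..<j} \<union> ?P"
      unfolding popped_def using j by (simp add: image_Un[symmetric] ivl_disj_un(8) less_imp_le)
    have "stk ` {..<j} \<inter> ?P = {}" using below by auto
    then have "rot_ons ons stk sp j v \<noteq> 0 \<longleftrightarrow> v \<in> stk ` {..<j}" for v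
      using st split unfolding stack_inv_def rot_ons_def by auto
    then show ?thesis using st j unfolding stack_inv_def split
      by (auto intro: inj_on_subset)
  qed
  have lk': "link ?p thr ?m (stk a) (stk (Suc a))" if a: "Suc a < j" for a
  proof -
    have l: "link p thr m (stk a) (stk (Suc a))" using lk a j by simp
    have nP: "stk a \<notin> ?P" "stk (Suc a) \<notin> ?P" using below a by auto
    have b: "p (stk a) < n" "nu (p (stk a)) = stk a" using l by (auto simp: link_def in_block_def)
    have "p (stk a) \<notin> ?X" using XP[OF b(1)] b(2) nP by simp
    then have "?m (p (stk a)) = 0" using l by (simp add: rot_m_def link_def)
    moreover have "?f (p (stk a)) \<notin> ?F" using FP[of "?f (p (stk a))"] l nP by (auto simp: link_def)
    then have "?m (?f (p (stk a))) \<noteq> 0" using l by (simp add: rot_m_def link_def)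
    moreover have "?p (stk a) = p (stk a)" using nP by (simp add: rot_p_def)
    ultimately show ?thesis using l by (simp add: link_def in_block_def)
  qed
  have "thr_inv thr ?m"
    by (rule thr_inv_change[OF t(1)]) (use X in \<open>fastforce simp: rot_m_def split: if_splits\<close>)
  then show "phase_inv ?p thr ?m ?mk (rot_ons ons stk sp j) stk j i"
    using tr' st' lk' ptr_inv_mono[OF t(2) le] exhausted_mono[OF ex le] unfolding phase_inv_def by blast
  have Xset: "?X = {k. k < n \<and> nu k \<in> ?P \<and> k = p (nu k)}" using XP Xn by blast
  have "{k. k < n \<and> p (nu k) \<le> k} = {k. k < n \<and> ?p (nu k) \<le> k} \<union> ?X"
    unfolding Xset by (auto simp: rot_p_def split: if_splits)
  moreover have "{k. k < n \<and> ?p (nu k) \<le> k} \<inter> ?X = {}"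
    unfolding Xset by (auto simp: rot_p_def split: if_splits)
  moreover have fX: "finite ?X" by (simp add: incoming_def popped_def)
  moreover have "card ?X = sp - j"
  proof -
    have "inj_on p ?P" by (rule inj_onI) (metis ib in_blockD(2))
    moreover have "inj_on stk {j..<sp}" using inj by (rule inj_on_subset) auto
    ultimately show ?thesis by (simp add: incoming_def popped_def card_image)
  qed
  \<comment> \<open>Each popped vertex passes one edge. Doubled in \<open>phase_pot\<close>, this
    covers the regained stack slots and leaves one unit per entry for the loop.\<close>
  ultimately have "ptr_pot p = ptr_pot ?p + (sp - j)"
    unfolding ptr_pot_def by (simp add: card_Un_disjoint)
  then show "phase_pot ?p thr j i + (sp - j) = phase_pot p thr sp i"
    using stack_le[OF st] j by (simp add: phase_pot_def)
qed

text \<open>Once all positions are exhausted every pointer has left its block. The empty stack and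
  cleared flags let the other side start without any clearing.\<close>

lemma phase_final:
  assumes inv: "phase_inv p thr m mk ons stk sp n"
  shows "\<exists>M R C. reach d M0 M R C \<and> sel mk = \<Union>C \<and> (\<forall>u. dead d M R u)"
    "\<forall>v. ons v = 0" "sp = 0"
proof -
  show sp: "sp = 0" using inv by (auto simp: phase_inv_def stack_inv_def)
  then show "\<forall>v. ons v = 0" using inv by (auto simp: phase_inv_def stack_inv_def)
  obtain R C where tr: "trace p m mk R C" using inv by (auto simp: phase_inv_def)
  have p: "ptr_inv p" and ex: "exhausted p n" using inv by (auto simp: phase_inv_def)
  have "\<not> in_block p u" for u
    using ex unfolding exhausted_def in_block_def by (metis less_irrefl)
  then have "dead d (sel m) R u" for u by (rule trace_dead[OF tr p])
  then show "\<exists>M R C. reach d M0 M R C \<and> sel mk = \<Union>C \<and> (\<forall>u. dead d M R u)"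
    using tr unfolding trace_def by blast
qed

lemma phase_init:
  assumes p: "\<forall>k<n. p (nu k) \<le> k \<and> nu (p (nu k)) = nu k"
    and t: "\<forall>t<n. t \<le> thr (nw (bk t)) \<and> thr (nw (bk t)) < n \<and> nw (bk (thr (nw (bk t)))) = nw (bk t)"
    and m: "sel m = M0" "sel mk = M0" and ons: "\<forall>v. ons v = 0"
  shows "phase_inv p thr m mk ons stk 0 0"
proof -
  have "ptr_inv p" unfolding ptr_inv_def
  proof (intro allI impI)
    fix k assume "k < n"
    then show "\<exists>j<n. nu j = nu k \<and> j \<le> p (nu k)"
      using p by (intro exI[of _ "p (nu k)"]) (auto intro: le_less_trans)
  qed
  moreover have "thr (nw k) < n \<and> nw (bk (thr (nw k))) = nw k \<and> cr k \<le> thr (nw k)" if "k < n" for k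
    using t[rule_format, OF cr_less[OF that]] bk_cr[OF that] by simp
  then have "thr_inv thr m" by (simp add: thr_inv_def)
  moreover have "\<not> k < p (nu k)" if "k < n" for k using p that by (simp add: not_less)
  then have "trace p m mk {} {M0}" using m reach.init by (auto simp: trace_def)
  then have "\<exists>R C. trace p m mk R C" by blast
  ultimately show ?thesis using ons by (simp add: phase_inv_def stack_inv_def exhausted_def)
qed

end

section \<open>The program of one phase and its running time\<close>

definition stack_top :: aexp where "stack_top = Read ''stk'' (Pred (var ''sp''))"
definition cand :: aexp where "cand = Read ''p'' stack_top"
definition cand_end :: "string \<Rightarrow> aexp" where "cand_end nwN = Read nwN cand"
definition thr_pos :: "string \<Rightarrow> aexp" where "thr_pos nwN = Read ''thr'' (cand_end nwN)"
definition thr_edge_exp :: "string \<Rightarrow> string \<Rightarrow> aexp" where "thr_edge_exp nwN bkN = Read bkN (thr_pos nwN)"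

lemmas exp_defs = stack_top_def cand_def cand_end_def thr_pos_def thr_edge_exp_def

definition rot_body :: "string \<Rightarrow> string \<Rightarrow> com" where
  "rot_body nwN bkN =
     set_var ''e'' (Read ''p'' stack_top) ;;
     set_var ''f'' (Read bkN (Read ''thr'' (Read nwN (var ''e'')))) ;;
     Write ''m'' (var ''f'') (Const 0) ;; Write ''m'' (var ''e'') (Const 1) ;;
     Write ''mk'' (var ''e'') (Const 1) ;; Write ''ons'' stack_top (Const 0) ;;
     Write ''p'' stack_top (Succ (var ''e'')) ;; set_var ''sp'' (Pred (var ''sp''))"

text \<open>\<open>g\<close> is the vertex that closes the cycle; popping clears flags, so the loop
  stops just after removing the entry of \<open>g\<close>.\<close>

definition rot_guard :: bexp where
  "rot_guard = Neg (Equal (Read ''ons'' (var ''g'')) (Const 0))"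

text \<open>After the decrement of \<open>sp\<close> in the popping branch, \<open>stack_top\<close>
  and \<open>cand\<close> denote the entry below, whose candidate is then passed.\<close>

definition simple_body :: "string \<Rightarrow> string \<Rightarrow> string \<Rightarrow> string \<Rightarrow> string \<Rightarrow> com" where
  "simple_body nuN nwN crN bkN flN =
    (Cond (Equal (var ''sp'') (Const 0))
       (Write ''stk'' (Const 0) (Read nuN (var ''i'')) ;; Write ''ons'' (Read nuN (var ''i'')) (Const 1) ;;
        set_var ''sp'' (Const 1))
     (Cond (Neg (Conj (Less cand (var ''edges'')) (Equal (Read nuN cand) stack_top)))
       (Write ''ons'' stack_top (Const 0) ;; set_var ''sp'' (Pred (var ''sp'')) ;;
        Cond (Equal (var ''sp'') (Const 0)) (set_var ''i'' (Succ (var ''i''))) (Write ''p'' stack_top (Succ cand)))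
     (Cond (Neg (Conj (Equal (Read ''m'' cand) (Const 0)) (Neg (Equal (Read flN (cand_end nwN)) (Const 0)))))
       (Write ''p'' stack_top (Succ cand))
     (Cond (Equal (Read ''m'' (thr_edge_exp nwN bkN)) (Const 0)) (Write ''thr'' (cand_end nwN) (Pred (thr_pos nwN)))
     (Cond (Less (thr_pos nwN) (Read crN cand)) (Write ''p'' stack_top (Succ cand))
       (set_var ''g'' (Read nuN (thr_edge_exp nwN bkN)) ;; Write ''stk'' (var ''sp'') (var ''g'') ;;
        Write ''ons'' (var ''g'') (Const 1) ;; set_var ''sp'' (Succ (var ''sp''))))))))"

text \<open>Isolates the only branch that contains a loop, so that all others are covered by
  \<open>exec\<close>. The cost counts all conjuncts, and reads are total, so unguarded ones are
  harmless.\<close>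

definition cycle_test :: "string \<Rightarrow> string \<Rightarrow> string \<Rightarrow> string \<Rightarrow> string \<Rightarrow> bexp" where
  "cycle_test nuN nwN crN bkN flN =
    (Conj (Conj (Conj (Less (Const 0) (var ''sp'')) (Conj (Less cand (var ''edges'')) (Equal (Read nuN cand) stack_top)))
       (Conj (Equal (Read ''m'' cand) (Const 0)) (Neg (Equal (Read flN (cand_end nwN)) (Const 0)))))
       (Conj (Conj (Neg (Equal (Read ''m'' (thr_edge_exp nwN bkN)) (Const 0))) (Neg (Less (thr_pos nwN) (Read crN cand))))
         (Neg (Equal (Read ''ons'' (Read nuN (thr_edge_exp nwN bkN))) (Const 0)))))"

definition phase_body :: "string \<Rightarrow> string \<Rightarrow> string \<Rightarrow> string \<Rightarrow> string \<Rightarrow> com" where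
  "phase_body nuN nwN crN bkN flN =
     Cond (cycle_test nuN nwN crN bkN flN)
       (set_var ''g'' (Read nuN (thr_edge_exp nwN bkN)) ;;
        While rot_guard (rot_body nwN bkN))
       (simple_body nuN nwN crN bkN flN)"

definition phase_prog :: "string \<Rightarrow> string \<Rightarrow> string \<Rightarrow> string \<Rightarrow> string \<Rightarrow> com" where
  "phase_prog nuN nwN crN bkN flN =
     set_var ''i'' (Const 0) ;; While (Less (var ''i'') (var ''edges'')) (phase_body nuN nwN crN bkN flN)"

definition phase_step_cost :: "string \<Rightarrow> string \<Rightarrow> string \<Rightarrow> string \<Rightarrow> string \<Rightarrow> nat" where
  "phase_step_cost nuN nwN crN bkN flN = 40 + bcost (cycle_test nuN nwN crN bkN flN) +
     max_cost (rot_body nwN bkN) + max_cost (simple_body nuN nwN crN bkN flN)"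

text \<open>The potential is at most \<open>6 * n + 1\<close>, hence at most
  \<open>7 * max 1 n\<close>; the eighth share absorbs the fixed overhead.\<close>

definition phase_cost :: "string \<Rightarrow> string \<Rightarrow> string \<Rightarrow> string \<Rightarrow> string \<Rightarrow> nat" where
  "phase_cost nuN nwN crN bkN flN = (phase_step_cost nuN nwN crN bkN flN + 20) * 8"

text \<open>Exactly the arrays that a phase writes; the table names, which are parameters, have to
  avoid them.\<close>

definition scratch :: "string set" where
  "scratch = {''p'', ''thr'', ''m'', ''mk'', ''ons'', ''stk'', ''sp'', ''i'', ''e'', ''f'', ''g''}"

lemma scratchD:
  assumes "x \<notin> scratch"
  shows "x \<noteq> ''p''" "x \<noteq> ''thr''" "x \<noteq> ''m''" "x \<noteq> ''mk''" "x \<noteq> ''ons''" "x \<noteq> ''stk''" "x \<noteq> ''sp''"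
    "x \<noteq> ''i''" "x \<noteq> ''e''" "x \<noteq> ''f''" "x \<noteq> ''g''"
  using assms by (auto simp: scratch_def)

context phase
begin

definition tables :: "string \<Rightarrow> string \<Rightarrow> string \<Rightarrow> string \<Rightarrow> string \<Rightarrow> memory \<Rightarrow> bool" where
  "tables nuN nwN crN bkN flN s \<longleftrightarrow> s ''edges'' 0 = n \<and> s nuN = nu \<and> s nwN = nw \<and> s crN = cr \<and>
     s bkN = bk \<and> s flN = fl"

definition phase_mem :: "memory \<Rightarrow> bool" where
  "phase_mem s \<longleftrightarrow>
     phase_inv (s ''p'') (s ''thr'') (s ''m'') (s ''mk'') (s ''ons'') (s ''stk'') (s ''sp'' 0) (s ''i'' 0)"

definition mem_pot :: "memory \<Rightarrow> nat" where
  "mem_pot s = phase_pot (s ''p'') (s ''thr'') (s ''sp'' 0) (s ''i'' 0)"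

lemma rot_loop:
  assumes names: "{nuN, nwN, crN, bkN, flN} \<inter> scratch = {}"
    and tab: "tables nuN nwN crN bkN flN s" and inv: "phase_mem s"
    and p: "p = s ''p''" and thr: "thr = s ''thr''" and m: "m = s ''m''" and stk: "stk = s ''stk''" and sp: "sp = s ''sp'' 0"
    and j: "j < sp" and top: "link p thr m (stk (sp - 1)) (stk j)" and g: "s ''g'' 0 = stk j"
  shows "halts (While rot_guard (rot_body nwN bkN)) s
     ((max_cost (rot_body nwN bkN) + 1 + bcost rot_guard) * (sp - j) + 1 + bcost rot_guard)
     (\<lambda>s'. tables nuN nwN crN bkN flN s' \<and> phase_mem s' \<and> mem_pot s' + (sp - j) = mem_pot s)"
proof -
  have ns: "nuN \<notin> scratch" "nwN \<notin> scratch" "crN \<notin> scratch" "bkN \<notin> scratch" "flN \<notin> scratch"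
    using names by simp_all
  note ne5 = ns[THEN scratchD(1)] ns[THEN scratchD(2)] ns[THEN scratchD(3)] ns[THEN scratchD(4)]
    ns[THEN scratchD(5)] ns[THEN scratchD(6)] ns[THEN scratchD(7)] ns[THEN scratchD(8)]
    ns[THEN scratchD(9)] ns[THEN scratchD(10)] ns[THEN scratchD(11)]
  define mk ons i where "mk = s ''mk''" and "ons = s ''ons''" and "i = s ''i''"
  have inv': "phase_inv p thr m mk ons stk sp (i 0)"
    using inv unfolding phase_mem_def p thr m stk sp mk_def ons_def i_def .
  have inj: "inj_on stk {..<sp}" and onj: "ons (stk j) \<noteq> 0"
    using inv' j unfolding phase_inv_def stack_inv_def by blast+
  note rot = phase_rotate[OF inv' j top]
  define J where "J = (\<lambda>s'::memory. tables nuN nwN crN bkN flN s' \<and> j \<le> s' ''sp'' 0 \<and> s' ''sp'' 0 \<le> sp \<and>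
     s' ''p'' = rot_p p stk sp (s' ''sp'' 0) \<and> s' ''m'' = rot_m p thr m stk sp (s' ''sp'' 0) \<and>
     s' ''mk'' = rot_mk p mk stk sp (s' ''sp'' 0) \<and> s' ''ons'' = rot_ons ons stk sp (s' ''sp'' 0) \<and>
     s' ''stk'' = stk \<and> s' ''thr'' = thr \<and> s' ''i'' = i \<and> s' ''g'' 0 = stk j)"
  have init: "J s"
    using tab j g unfolding J_def
    by (simp add: fun_eq_iff rot_p_def rot_m_def rot_mk_def rot_ons_def incoming_def outgoing_def popped_def
        p thr m stk sp mk_def ons_def i_def flip: sp)
  have step: "J (exec (rot_body nwN bkN) s') \<and> exec (rot_body nwN bkN) s' ''sp'' 0 - j < s' ''sp'' 0 - j"
    if J: "J s'" and b: "bval rot_guard s'" for s'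
  proof -
    \<comment> \<open>Popping entry \<open>j\<close> clears its flag, so a true guard means that the
      entry is still on the stack.\<close>
    have "s' ''sp'' 0 \<noteq> j"
    proof
      assume "s' ''sp'' 0 = j"
      then have "s' ''ons'' (stk j) = 0" using J j by (auto simp: J_def rot_ons_def popped_def)
      then show False using b J by (auto simp: rot_guard_def J_def)
    qed
    then obtain a where a: "s' ''sp'' 0 = Suc a" "j \<le> a" "a < sp"
      using J unfolding J_def by (cases "s' ''sp'' 0") auto
    define e where "e = rot_p p stk sp (Suc a) (stk a)"
    define f where "f = bk (thr (nw e))"
    have "incoming p stk sp a \<subseteq> incoming p stk sp j"
      unfolding incoming_def popped_def using a(2) by (intro image_mono) auto
    then have "\<forall>k \<in> incoming p stk sp a. m k = 0 \<and> m (bk (thr (nw k))) \<noteq> 0" using rot(3) by blast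
    note rs = rot_step[OF inj a(3) e_def f_def this]
    have "exec (rot_body nwN bkN) s' = s'(''e'' := (s' ''e'')(0 := e), ''f'' := (s' ''f'')(0 := f),
        ''m'' := rot_m p thr m stk sp a, ''mk'' := rot_mk p mk stk sp a, ''ons'' := rot_ons ons stk sp a,
        ''p'' := rot_p p stk sp a, ''sp'' := (s' ''sp'')(0 := a))"
      using J a(1) unfolding rs[symmetric] rot_body_def stack_top_def
      by (simp add: J_def tables_def e_def f_def ne5)
    then show ?thesis using J a by (simp add: J_def tables_def ne5)
  qed
  show ?thesis
  proof (rule halts_mono[OF halts_While_exec[where J = J and \<phi> = "\<lambda>s. s ''sp'' 0 - j", OF init _ step]])
    show "loop_free (rot_body nwN bkN)" by (simp add: rot_body_def)
    show "(max_cost (rot_body nwN bkN) + 1 + bcost rot_guard) * (s ''sp'' 0 - j) + 1 + bcost rot_guard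
      \<le> (max_cost (rot_body nwN bkN) + 1 + bcost rot_guard) * (sp - j) + 1 + bcost rot_guard" by (simp add: sp)
    fix s' assume s': "J s' \<and> \<not> bval rot_guard s'"
    then have "rot_ons ons stk sp (s' ''sp'' 0) (stk j) = 0" by (auto simp: J_def rot_guard_def)
    then have "stk j \<in> popped stk sp (s' ''sp'' 0)" using onj by (auto simp: rot_ons_def split: if_splits)
    then obtain b where "stk j = stk b" "s' ''sp'' 0 \<le> b" "b < sp" by (auto simp: popped_def)
    then have "s' ''sp'' 0 \<le> j" using inj_onD[OF inj, of j b] j by auto
    then have "s' ''sp'' 0 = j" using s' by (auto simp: J_def)
    then show "tables nuN nwN crN bkN flN s' \<and> phase_mem s' \<and> mem_pot s' + (sp - j) = mem_pot s"
      using s' rot(1,2) unfolding J_def phase_mem_def mem_pot_def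
      by (simp add: p thr stk sp i_def)
  qed
qed

lemma simple_step:
  assumes names: "{nuN, nwN, crN, bkN, flN} \<inter> scratch = {}"
    and tab: "tables nuN nwN crN bkN flN s" and inv: "phase_mem s" and i: "s ''i'' 0 < n"
    and nc: "\<not> bval (cycle_test nuN nwN crN bkN flN) s"
  defines "s' \<equiv> exec (simple_body nuN nwN crN bkN flN) s"
  shows "tables nuN nwN crN bkN flN s' \<and> phase_mem s' \<and> mem_pot s' < mem_pot s"
proof -
  have ns: "nuN \<notin> scratch" "nwN \<notin> scratch" "crN \<notin> scratch" "bkN \<notin> scratch" "flN \<notin> scratch"
    using names by simp_all
  note ne5 = ns[THEN scratchD(1)] ns[THEN scratchD(2)] ns[THEN scratchD(3)] ns[THEN scratchD(4)]
    ns[THEN scratchD(5)] ns[THEN scratchD(6)] ns[THEN scratchD(7)] ns[THEN scratchD(8)]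
    ns[THEN scratchD(9)] ns[THEN scratchD(10)] ns[THEN scratchD(11)]
  let ?p = "s ''p''" and ?thr = "s ''thr''" and ?m = "s ''m''" and ?mk = "s ''mk''" and ?ons = "s ''ons''"
    and ?stk = "s ''stk''" and ?sp = "s ''sp'' 0" and ?i = "s ''i'' 0"
  note body = simple_body_def[of nuN nwN crN bkN flN] s'_def
  have T: "s ''edges'' 0 = n" "s nuN = nu" "s nwN = nw" "s crN = cr" "s bkN = bk" "s flN = fl"
    using tab by (auto simp: tables_def)
  have inv': "phase_inv ?p ?thr ?m ?mk ?ons ?stk ?sp ?i" using inv by (simp add: phase_mem_def)
  show ?thesis
  proof (cases "?sp = 0")
    case True
    have "s' = s(''stk'' := ?stk(0 := nu ?i), ''ons'' := ?ons(nu ?i := 1), ''sp'' := (s ''sp'')(0 := 1))"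
      by (simp add: body True T ne5)
    then show ?thesis
      using phase_push_first[of ?p ?thr ?m ?mk ?ons ?stk ?i] inv' True i
      by (simp add: phase_mem_def mem_pot_def tables_def T ne5)
  next
    case sp: False
    define u where "u = ?stk (?sp - 1)"
    have u': "?stk (?sp - Suc 0) = u" by (simp add: u_def)
    show ?thesis
    proof (cases "in_block ?p u")
      case b: False
      show ?thesis
      proof (cases "?sp = 1")
        case True
        have "s' = s(''ons'' := ?ons(?stk 0 := 0), ''sp'' := (s ''sp'')(0 := 0), ''i'' := (s ''i'')(0 := Suc ?i))"
          using b by (simp add: body exp_defs u_def in_block_def True T ne5)
        then show ?thesis
          using phase_pop_last[of ?p ?thr ?m ?mk ?ons ?stk ?i] inv' True b
          by (simp add: phase_mem_def mem_pot_def tables_def u_def T ne5)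
      next
        case False
        then obtain a where a: "?sp = Suc (Suc a)" using sp by (metis One_nat_def not0_implies_Suc)
        have "s' = s(''ons'' := ?ons(?stk (Suc a) := 0), ''sp'' := (s ''sp'')(0 := Suc a),
            ''p'' := ?p(?stk a := Suc (?p (?stk a))))"
          using b by (simp add: body exp_defs u_def in_block_def a T ne5)
        then show ?thesis
          using phase_pop[of ?p ?thr ?m ?mk ?ons ?stk a ?i] inv' a b
          by (simp add: phase_mem_def mem_pot_def tables_def u_def T ne5)
      qed
    next
      case b: True
      let ?e = "?p u"
      have e: "?e < n" "nu ?e = u" using b by (auto simp: in_block_def)
      have av: "aval stack_top s = u" "aval cand s = ?e" "aval (cand_end nwN) s = nw ?e"
        "aval (thr_pos nwN) s = ?thr (nw ?e)" "aval (thr_edge_exp nwN bkN) s = bk (?thr (nw ?e))"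
        by (simp_all add: exp_defs T u')
      have skip: ?thesis if h: "?m ?e \<noteq> 0 \<or> fl (nw ?e) = 0 \<or> ?thr (nw ?e) < cr ?e"
        and s': "s' = s(''p'' := ?p(u := Suc ?e))"
      proof -
        have "0 < ?sp" using sp by simp
        note st = phase_skip[OF inv' this u_def b h]
        have "phase_mem s'" unfolding s' phase_mem_def using st(1) by simp
        moreover have "mem_pot s' < mem_pot s" unfolding s' mem_pot_def using st(2) by simp
        moreover have "tables nuN nwN crN bkN flN s'" unfolding s' by (simp add: tables_def T ne5)
        ultimately show ?thesis by simp
      qed
      show ?thesis
      proof (cases "?m ?e = 0")
        case False
        then have "s' = s(''p'' := ?p(u := Suc ?e))" by (simp add: body T ne5 av sp e)
        then show ?thesis using skip False by blast
      next
        case m: True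
        show ?thesis
        proof (cases "fl (nw ?e) = 0")
          case True
          then have "s' = s(''p'' := ?p(u := Suc ?e))" using m by (simp add: body T ne5 av sp e)
          then show ?thesis using skip True by blast
        next
          case False
          then have me: "?m ?e = 0 \<and> fl (nw ?e) \<noteq> 0" and fl0: "0 < fl (nw ?e)" using m by simp_all
          show ?thesis
          proof (cases "?m (bk (?thr (nw ?e))) = 0")
            case True
            have "s' = s(''thr'' := ?thr(nw ?e := ?thr (nw ?e) - 1))"
              by (simp add: body T ne5 av sp e m fl0 True)
            then show ?thesis
              using phase_lower[OF inv' e(1) _ True] me
              by (simp add: phase_mem_def mem_pot_def tables_def T ne5)
          next
            case f: False
            show ?thesis
            proof (cases "?thr (nw ?e) < cr ?e")
              case True
              then have "s' = s(''p'' := ?p(u := Suc ?e))" by (simp add: body T ne5 av sp e m fl0 f)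
              then show ?thesis using skip True by blast
            next
              case t: False
              let ?f = "bk (?thr (nw ?e))"
              have "?thr (nw ?e) \<noteq> cr ?e" using me f bk_cr[OF e(1)] by metis
              then have l: "link ?p ?thr ?m u (nu ?f)" using b me f t by (simp add: link_def)
              have o: "?ons (nu ?f) = 0"
                using nc by (simp add: cycle_test_def T av sp e m fl0 f t)
              have "s' = s(''g'' := (s ''g'')(0 := nu ?f), ''stk'' := ?stk(?sp := nu ?f),
                  ''ons'' := ?ons(nu ?f := 1), ''sp'' := (s ''sp'')(0 := Suc ?sp))"
                by (simp add: body T ne5 av sp e m fl0 f t)
              then show ?thesis
                using phase_push[OF inv' _ l[unfolded u_def] o[unfolded u_def]] sp
                by (simp add: phase_mem_def mem_pot_def tables_def u_def T ne5)
            qed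
          qed
        qed
      qed
    qed
  qed
qed

text \<open>A rotation takes time proportional to the number of popped entries and lowers the
  potential by exactly that number; every other step has constant cost and lowers it by at least
  one.\<close>

lemma phase_step:
  assumes names: "{nuN, nwN, crN, bkN, flN} \<inter> scratch = {}"
    and tab: "tables nuN nwN crN bkN flN s" and inv: "phase_mem s" and i: "s ''i'' 0 < n"
  shows "\<exists>T. halts (phase_body nuN nwN crN bkN flN) s T (\<lambda>s'. (tables nuN nwN crN bkN flN s' \<and> phase_mem s') \<and>
     mem_pot s' < mem_pot s \<and> T \<le> phase_step_cost nuN nwN crN bkN flN * (mem_pot s - mem_pot s'))"
proof (cases "bval (cycle_test nuN nwN crN bkN flN) s")
  case False
  let ?q = "simple_body nuN nwN crN bkN flN"
  have lf: "loop_free ?q" by (simp add: simple_body_def)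
  note st = simple_step[OF names tab inv i False]
  have h: "halts (phase_body nuN nwN crN bkN flN) s (1 + bcost (cycle_test nuN nwN crN bkN flN) + max_cost ?q)
      (\<lambda>s'. s' = exec ?q s)"
    unfolding phase_body_def by (rule halts_Cond_False[OF False halts_exec[OF lf]]) simp
  have "1 + bcost (cycle_test nuN nwN crN bkN flN) + max_cost ?q \<le>
      phase_step_cost nuN nwN crN bkN flN * (mem_pot s - mem_pot (exec ?q s))"
  proof -
    have "1 + bcost (cycle_test nuN nwN crN bkN flN) + max_cost ?q \<le> phase_step_cost nuN nwN crN bkN flN * 1"
      by (simp add: phase_step_cost_def)
    also have "\<dots> \<le> phase_step_cost nuN nwN crN bkN flN * (mem_pot s - mem_pot (exec ?q s))"
      using st by (intro mult_le_mono2) (metis One_nat_def Suc_leI zero_less_diff)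
    finally show ?thesis .
  qed
  then show ?thesis
    using st by (intro exI[of _ "1 + bcost (cycle_test nuN nwN crN bkN flN) + max_cost ?q"]
        halts_mono[OF h order_refl]) auto
next
  case True
  have ns: "nuN \<notin> scratch" "nwN \<notin> scratch" "crN \<notin> scratch" "bkN \<notin> scratch" "flN \<notin> scratch"
    using names by simp_all
  note ne5 = ns[THEN scratchD(11)]
  let ?p = "s ''p''" and ?thr = "s ''thr''" and ?m = "s ''m''" and ?mk = "s ''mk''" and ?ons = "s ''ons''"
    and ?stk = "s ''stk''" and ?sp = "s ''sp'' 0" and ?i = "s ''i'' 0"
  have T: "s ''edges'' 0 = n" "s nuN = nu" "s nwN = nw" "s crN = cr" "s bkN = bk" "s flN = fl"
    using tab by (auto simp: tables_def)
  let ?e = "?p (?stk (?sp - 1))" let ?f = "bk (?thr (nw ?e))"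
  have c: "0 < ?sp" "in_block ?p (?stk (?sp - 1))" "?m ?e = 0" "fl (nw ?e) \<noteq> 0" "?m ?f \<noteq> 0" "\<not> ?thr (nw ?e) < cr ?e"
    "?ons (nu ?f) \<noteq> 0"
    using True T by (auto simp: cycle_test_def exp_defs in_block_def)
  have "?thr (nw ?e) \<noteq> cr ?e" using c(3,5) bk_cr[OF in_blockD(1)[OF c(2)]] by metis
  then have l: "link ?p ?thr ?m (?stk (?sp - 1)) (nu ?f)" using c by (simp add: link_def)
  have "nu ?f \<in> ?stk ` {..<?sp}"
    using inv c(7) unfolding phase_mem_def phase_inv_def stack_inv_def by blast
  then obtain j where j: "j < ?sp" "nu ?f = ?stk j" by auto
  let ?s = "s(''g'' := (s ''g'')(0 := ?stk j))"
  have "halts (set_var ''g'' (Read nuN (thr_edge_exp nwN bkN))) s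
     (max_cost (set_var ''g'' (Read nuN (thr_edge_exp nwN bkN)))) (\<lambda>s'. s' = ?s)"
    by (rule halts_exec) (use T j in \<open>auto simp: exp_defs\<close>)
  moreover have "halts (While rot_guard (rot_body nwN bkN)) s'
     ((max_cost (rot_body nwN bkN) + 1 + bcost rot_guard) * (?sp - j) + 1 + bcost rot_guard)
     (\<lambda>s'. tables nuN nwN crN bkN flN s' \<and> phase_mem s' \<and> mem_pot s' + (?sp - j) = mem_pot s)" if s': "s' = ?s" for s'
  proof -
    have eq: "mem_pot s' = mem_pot s" "phase_mem s'" "tables nuN nwN crN bkN flN s'"
      using s' inv tab by (simp_all add: mem_pot_def phase_mem_def tables_def ne5)
    show ?thesis
      unfolding eq(1)[symmetric]
      by (rule rot_loop[OF names eq(3,2)]) (use s' j l in auto)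
  qed
  ultimately have h: "halts (phase_body nuN nwN crN bkN flN) s (1 + bcost (cycle_test nuN nwN crN bkN flN) +
     (max_cost (set_var ''g'' (Read nuN (thr_edge_exp nwN bkN))) +
      ((max_cost (rot_body nwN bkN) + 1 + bcost rot_guard) * (?sp - j) + 1 + bcost rot_guard)))
     (\<lambda>s'. tables nuN nwN crN bkN flN s' \<and> phase_mem s' \<and> mem_pot s' + (?sp - j) = mem_pot s)"
    (is "halts _ _ ?T _")
    unfolding phase_body_def by (intro halts_Cond_True[OF True] halts_Seq)
  have "?T \<le> phase_step_cost nuN nwN crN bkN flN * (?sp - j)"
  proof -
    define D where "D = ?sp - j"
    have "(30 + bcost (cycle_test nuN nwN crN bkN flN)) * 1 \<le> (30 + bcost (cycle_test nuN nwN crN bkN flN)) * D"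
      using j unfolding D_def by (intro mult_le_mono2) simp
    then show ?thesis
      unfolding D_def[symmetric] by (simp add: phase_step_cost_def rot_guard_def exp_defs algebra_simps)
  qed
  note bound = this
  show ?thesis
  proof (intro exI[of _ ?T] halts_mono[OF h order_refl])
    fix s' assume s': "tables nuN nwN crN bkN flN s' \<and> phase_mem s' \<and> mem_pot s' + (?sp - j) = mem_pot s"
    then have "mem_pot s - mem_pot s' = ?sp - j" "mem_pot s' < mem_pot s" using j by linarith+
    then show "(tables nuN nwN crN bkN flN s' \<and> phase_mem s') \<and> mem_pot s' < mem_pot s \<and>
      ?T \<le> phase_step_cost nuN nwN crN bkN flN * (mem_pot s - mem_pot s')" using s' bound by metis
  qed
qed

lemma phase_correct:
  assumes names: "{nuN, nwN, crN, bkN, flN} \<inter> scratch = {}"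
    and tab: "tables nuN nwN crN bkN flN s"
    and p: "\<forall>k<n. s ''p'' (nu k) \<le> k \<and> nu (s ''p'' (nu k)) = nu k"
    and t: "\<forall>t<n. t \<le> s ''thr'' (nw (bk t)) \<and> s ''thr'' (nw (bk t)) < n \<and>
      nw (bk (s ''thr'' (nw (bk t)))) = nw (bk t)"
    and m: "sel (s ''m'') = M0" "sel (s ''mk'') = M0" and ons: "\<forall>v. s ''ons'' v = 0" and sp: "s ''sp'' 0 = 0"
  shows "halts (phase_prog nuN nwN crN bkN flN) s (phase_cost nuN nwN crN bkN flN * max 1 n)
    (\<lambda>s'. (\<exists>M R C. reach d M0 M R C \<and> sel (s' ''mk'') = \<Union>C \<and> (\<forall>u. dead d M R u)) \<and>
      (\<forall>v. s' ''ons'' v = 0) \<and> s' ''sp'' 0 = 0)"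
proof -
  have ns: "nuN \<notin> scratch" "nwN \<notin> scratch" "crN \<notin> scratch" "bkN \<notin> scratch" "flN \<notin> scratch"
    using names by simp_all
  note ne5 = ns[THEN scratchD(8)]
  let ?b = "Less (var ''i'') (var ''edges'')" and ?s = "s(''i'' := (s ''i'')(0 := 0))"
  let ?q = "phase_body nuN nwN crN bkN flN" and ?c = "phase_step_cost nuN nwN crN bkN flN"
  define J where "J = (\<lambda>s::memory. tables nuN nwN crN bkN flN s \<and> phase_mem s)"
  have "halts (set_var ''i'' (Const 0)) s (max_cost (set_var ''i'' (Const 0))) (\<lambda>s'. s' = ?s)"
    by (rule halts_exec) auto
  moreover have "halts (While ?b ?q) s' ((?c + 1 + bcost ?b) * (6 * n + 1) + 1 + bcost ?b)
      (\<lambda>s'. J s' \<and> \<not> bval ?b s')" if s': "s' = ?s" for s'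
  proof (rule halts_mono[OF halts_While[where J = J and \<phi> = mem_pot and c = ?c]])
    have "tables nuN nwN crN bkN flN s'" using tab by (simp add: s' tables_def ne5)
    moreover have "phase_mem s'" unfolding phase_mem_def s' using phase_init[OF p t m ons] sp by simp
    ultimately show "J s'" by (simp add: J_def)
    have "mem_pot s' \<le> 6 * n + 1"
      using ptr_pot_le[of "s' ''p''"] thr_pot_le[of "s' ''thr''"] unfolding mem_pot_def phase_pot_def by linarith
    then have "(?c + 1 + bcost ?b) * mem_pot s' \<le> (?c + 1 + bcost ?b) * (6 * n + 1)"
      by (rule mult_le_mono2)
    then show "(?c + 1 + bcost ?b) * mem_pot s' + 1 + bcost ?b \<le> (?c + 1 + bcost ?b) * (6 * n + 1) + 1 + bcost ?b"
      by simp
    show "\<exists>T. halts ?q s T (\<lambda>s'. J s' \<and> mem_pot s' < mem_pot s \<and> T \<le> ?c * (mem_pot s - mem_pot s'))"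
      if "J s" "bval ?b s" for s
      using that phase_step[OF names, of s] unfolding J_def by (simp add: tables_def)
  qed
  ultimately have "halts (phase_prog nuN nwN crN bkN flN) s
      (max_cost (set_var ''i'' (Const 0)) + ((?c + 1 + bcost ?b) * (6 * n + 1) + 1 + bcost ?b))
      (\<lambda>s'. J s' \<and> \<not> bval ?b s')"
    unfolding phase_prog_def by (rule halts_Seq)
  then show ?thesis
  proof (rule halts_mono)
    have "(?c + 6) * (6 * n + 1) + 12 \<le> (?c + 20) * (7 * max 1 n) + 12 * max 1 n"
      by (intro add_mono mult_mono) auto
    then show "max_cost (set_var ''i'' (Const 0)) + ((?c + 1 + bcost ?b) * (6 * n + 1) + 1 + bcost ?b)
      \<le> phase_cost nuN nwN crN bkN flN * max 1 n"
      by (simp add: phase_cost_def algebra_simps)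
  next
    fix s' assume s': "J s' \<and> \<not> bval ?b s'"
    then have "s' ''i'' 0 = n"
      by (auto simp: J_def tables_def phase_mem_def phase_inv_def stack_inv_def)
    then have "phase_inv (s' ''p'') (s' ''thr'') (s' ''m'') (s' ''mk'') (s' ''ons'') (s' ''stk'') (s' ''sp'' 0) n"
      using s' by (simp add: J_def phase_mem_def)
    note fin = phase_final[OF this]
    show "(\<exists>M R C. reach d M0 M R C \<and> sel (s' ''mk'') = \<Union>C \<and> (\<forall>u. dead d M R u)) \<and>
      (\<forall>v. s' ''ons'' v = 0) \<and> s' ''sp'' 0 = 0"
      by (intro conjI fin)
  qed
qed

end

section \<open>The complete program\<close>

text \<open>\<open>fa\<close> and \<open>fb\<close> flag the students and schools that are full in the stable assignment, and hence in every
  assignment reached from it; \<open>m2\<close> is the stable assignment indexed by the schools' listing.\<close>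

definition save_body :: com where
  "save_body =
     Write ''mk'' (var ''i'') (Read ''m'' (var ''i'')) ;;
     Write ''m2'' (Read ''ypos'' (var ''i'')) (Read ''m'' (var ''i'')) ;;
     Cond (Equal (Read ''m'' (var ''i'')) (Const 0)) Skip
       (Write ''fa'' (Read ''student_list_a'' (var ''i'')) (Const 1)) ;;
     Cond (Equal (Read ''cnt'' (Read ''student_list_b'' (var ''i''))) (Read ''quota'' (Read ''student_list_b'' (var ''i''))))
       (Write ''fb'' (Read ''student_list_b'' (var ''i'')) (Const 1)) Skip ;;
     set_var ''i'' (Succ (var ''i''))"

definition switch_body :: com where
  "switch_body =
     Write ''mk1'' (var ''i'') (Read ''mk'' (var ''i'')) ;;
     Write ''m'' (var ''i'') (Read ''m2'' (var ''i'')) ;;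
     Write ''mk'' (var ''i'') (Read ''m2'' (var ''i'')) ;;
     set_var ''i'' (Succ (var ''i''))"

definition out_body :: com where
  "out_body =
     Cond (Conj (Equal (Read ''mk1'' (var ''i'')) (Const 0))
         (Equal (Read ''mk'' (Read ''ypos'' (var ''i''))) (Const 0))) Skip
       (Write ''out_a'' (var ''out_edges'') (Read ''student_list_a'' (var ''i'')) ;;
        Write ''out_b'' (var ''out_edges'') (Read ''student_list_b'' (var ''i'')) ;;
        set_var ''out_edges'' (Succ (var ''out_edges''))) ;;
     set_var ''i'' (Succ (var ''i''))"

abbreviation student_phase :: com where
  "student_phase \<equiv> phase_prog ''student_list_a'' ''student_list_b'' ''ypos'' ''xpos'' ''fb''"

abbreviation school_phase :: com where
  "school_phase \<equiv> phase_prog ''school_list_b'' ''school_list_a'' ''xpos'' ''ypos'' ''fa''"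

definition main_prog :: com where
  "main_prog =
     for_edges link_body ;; match_prog ;;
     prep_prog ''student_list_a'' ''school_list_b'' ;; da_prog ;; for_edges save_body ;;
     prep_prog ''student_list_a'' ''school_list_b'' ;; student_phase ;; for_edges switch_body ;;
     prep_prog ''school_list_b'' ''student_list_a'' ;; school_phase ;; for_edges out_body ;;
     (set_var ''out_students'' (var ''students'') ;; set_var ''out_schools'' (var ''schools''))"

lemma writes_link: "writes (for_edges link_body) = {''i'', ''nxt'', ''head''}"
  by (auto simp: for_edges_def link_body_def)

lemma writes_match: "writes match_prog = {''j'', ''c'', ''xpos'', ''ypos'', ''tmp''}"
  by (auto simp: match_prog_def match_body_def)

lemma writes_prep: "writes (prep_prog nu nv) = {''i'', ''j'', ''p'', ''thr''}"
  by (auto simp: prep_prog_def prep_body_def for_edges_def)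

lemma writes_da: "writes da_prog = {''i'', ''u'', ''m'', ''cnt'', ''thr'', ''p'', ''f''}"
  by (auto simp: da_prog_def da_body_def Let_def)

lemma writes_save: "writes (for_edges save_body) = {''i'', ''mk'', ''m2'', ''fa'', ''fb''}"
  by (auto simp: for_edges_def save_body_def)

lemma writes_phase: "writes (phase_prog a b c d e) = scratch"
  by (auto simp: phase_prog_def phase_body_def simple_body_def rot_body_def scratch_def)

lemma writes_switch: "writes (for_edges switch_body) = {''i'', ''mk1'', ''m'', ''mk''}"
  by (auto simp: for_edges_def switch_body_def)

lemma writes_out: "writes (for_edges out_body) = {''i'', ''out_a'', ''out_b'', ''out_edges''}"
  by (auto simp: for_edges_def out_body_def)

section \<open>Encoded instances\<close>

locale listing =
  fixes I :: "(nat, nat) assignment_instance" and xs ys :: "(nat \<times> nat) list"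
  assumes num: "numbered_instance I" and xl: "student_listing I xs" and yl: "school_listing I ys"
begin

definition vt :: "bool \<Rightarrow> nat \<times> nat \<Rightarrow> nat" where
  "vt d e = (if d then fst e else snd e)"

definition listed :: "bool \<Rightarrow> (nat \<times> nat) list" where
  "listed d = (if d then xs else ys)"

text \<open>The position in the whole listing rather than in the list of one vertex: only edges with
  a common endpoint are compared, and global positions double as edge addresses.\<close>

definition rk :: "bool \<Rightarrow> nat \<times> nat \<Rightarrow> nat" where
  "rk d = the_inv_into {..<length (listed d)} ((!) (listed d))"

definition qt :: "bool \<Rightarrow> nat \<Rightarrow> nat" where
  "qt d v = (if d then 1 else quota I v)"

abbreviation n where "n \<equiv> card (edges I)"

definition ord :: "bool \<Rightarrow> nat \<Rightarrow> (nat \<times> nat) set" where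
  "ord d = (if d then student_ord I else school_ord I)"

lemma inst: "stable_assignment_instance I" using num by (simp add: numbered_instance_def)

lemma set_listed: "set (listed d) = edges I"
  using xl yl by (simp add: listed_def student_listing_def school_listing_def)

lemma sorted_listed:
  "sorted_wrt (\<lambda>e f. vt d e < vt d f \<or> vt d e = vt d f \<and> (vt (\<not> d) f, vt (\<not> d) e) \<in> ord d (vt d e)) (listed d)"
  using xl yl by (auto simp: listed_def student_listing_def school_listing_def vt_def ord_def split_def)

lemma ord_props:
  assumes "e \<in> edges I"
  shows "trans (ord d (vt d e))" "irrefl (ord d (vt d e))"
  using inst assms unfolding stable_assignment_instance_def strict_total_order_of_def
    strict_linear_order_on_def ord_def vt_def by auto

lemma listed_less:
  assumes "i < j" "j < length (listed d)"
  shows "vt d (listed d ! i) < vt d (listed d ! j) \<or> vt d (listed d ! i) = vt d (listed d ! j) \<and>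
    (vt (\<not> d) (listed d ! j), vt (\<not> d) (listed d ! i)) \<in> ord d (vt d (listed d ! i))"
  using sorted_wrt_nth_less[OF sorted_listed assms] .

lemma distinct_listed: "distinct (listed d)"
proof -
  have "listed d ! i \<noteq> listed d ! j" if "i < j" "j < length (listed d)" for i j
  proof
    assume e: "listed d ! i = listed d ! j"
    have "listed d ! i \<in> edges I" using that set_listed[of d] by (metis nth_mem less_trans)
    then show False using listed_less[OF that] e ord_props(2)[of "listed d ! i" d] by (auto simp: irrefl_def)
  qed
  then show ?thesis unfolding distinct_conv_nth by (metis linorder_neqE_nat)
qed

lemma length_listed: "length (listed d) = n"
  using distinct_card[OF distinct_listed] set_listed by metis

lemma rk_nth: "k < n \<Longrightarrow> rk d (listed d ! k) = k"
  unfolding rk_def length_listed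
  by (rule the_inv_into_f_f) (use distinct_listed[of d] length_listed[of d] in \<open>auto simp: inj_on_def nth_eq_iff_index_eq\<close>)

lemma listed_cases:
  assumes "e \<in> edges I" obtains k where "k < n" "e = listed d ! k"
  using assms set_listed[of d] length_listed[of d] by (metis in_set_conv_nth)

lemma rk_less_iff:
  assumes e: "e \<in> edges I" and f: "f \<in> edges I" and v: "vt d e = vt d f"
  shows "rk d e < rk d f \<longleftrightarrow> (vt (\<not> d) f, vt (\<not> d) e) \<in> ord d (vt d e)"
proof -
  obtain j where j: "j < n" "e = listed d ! j" using listed_cases[OF e] by blast
  obtain k where k: "k < n" "f = listed d ! k" using listed_cases[OF f] by blast
  have r: "rk d e = j" "rk d f = k" using j k rk_nth by auto
  show ?thesis
  proof
    assume "rk d e < rk d f"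
    then show "(vt (\<not> d) f, vt (\<not> d) e) \<in> ord d (vt d e)"
      using listed_less[of j k d] r j k v length_listed by auto
  next
    assume o: "(vt (\<not> d) f, vt (\<not> d) e) \<in> ord d (vt d e)"
    show "rk d e < rk d f"
    proof (rule ccontr)
      assume "\<not> rk d e < rk d f"
      then consider "j = k" | "k < j" using r by linarith
      then show False
      proof cases
        case 1
        then show False using o j k ord_props(2)[OF e] by (auto simp: irrefl_def)
      next
        case 2
        then have "(vt (\<not> d) e, vt (\<not> d) f) \<in> ord d (vt d e)"
          using listed_less[of k j d] j k v length_listed by auto
        then have "(vt (\<not> d) f, vt (\<not> d) f) \<in> ord d (vt d e)"
          using o ord_props(1)[OF e] by (meson transD)
        then show False using ord_props(2)[OF e] by (auto simp: irrefl_def)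
      qed
    qed
  qed
qed

sublocale two_sided "edges I" vt rk qt
proof
  show "finite (edges I)" using finite_edges[OF inst] .
  fix e f d assume "e \<in> edges I" "f \<in> edges I" "rk d e = rk d f"
  then show "e = f" by (metis listed_cases rk_nth)
qed

lemma card_Image: "card (M `` {a}) = card (star True a M)" "card (M\<inverse> `` {b}) = card (star False b M)"
proof -
  have "star True a M = Pair a ` (M `` {a})" by (auto simp: star_def vt_def)
  then show "card (M `` {a}) = card (star True a M)" by (simp add: card_image inj_on_def)
  have "star False b M = (\<lambda>a. (a, b)) ` (M\<inverse> `` {b})" by (auto simp: star_def vt_def)
  then show "card (M\<inverse> `` {b}) = card (star False b M)" by (simp add: card_image inj_on_def)
qed

text \<open>Numbers that are not vertices of \<open>I\<close> have empty stars, so quantifying over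
  all of them does no harm.\<close>

lemma is_assignment_iff: "is_assignment I M \<longleftrightarrow> asg M"
proof -
  have E: "edges I \<subseteq> students I \<times> schools I" using inst by (simp add: stable_assignment_instance_def)
  have "star True a M = {}" if "M \<subseteq> edges I" "a \<notin> students I" for a
    using that E by (auto simp: star_def vt_def)
  moreover have "star False b M = {}" if "M \<subseteq> edges I" "b \<notin> schools I" for b
    using that E by (auto simp: star_def vt_def)
  ultimately show ?thesis
    unfolding is_assignment_def asg_def card_Image(2) all_bool_eq
    unfolding card_Image(1)
    by (auto simp: qt_def)
qed

text \<open>With quota one, a student who is not full is unmatched, and an edge outside
  \<open>M\<close> that is not below the single held edge is strictly above it.\<close>

lemma edge_blocks_iff:
  assumes M: "asg M" and e: "e \<in> edges I"
  shows "edge_blocks I e M \<longleftrightarrow> blk M e"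
proof -
  obtain a b where ab: "e = (a, b)" by (cases e)
  have ME: "M \<subseteq> edges I" and fin: "finite M" using M asg_finite by (auto simp: asg_def)
  have st: "(b', b) \<in> student_ord I a \<longleftrightarrow> rk True e < rk True (a, b')" if "(a, b') \<in> M" for b'
    using rk_less_iff[of e "(a, b')" True] that ME e by (auto simp: ab vt_def ord_def)
  have sc: "(a', a) \<in> school_ord I b \<longleftrightarrow> rk False e < rk False (a', b)" if "(a', b) \<in> M" for a'
    using rk_less_iff[of e "(a', b)" False] that ME e by (auto simp: ab vt_def ord_def)
  have neq: "rk d e \<noteq> rk d f" if "f \<in> M" "e \<notin> M" "vt d f = vt d e" for d f
    using rk_inj[of e f d] that ME e by auto
  have rT: "rej True M e \<longleftrightarrow> 1 \<le> card (star True a M) \<and> (\<forall>b'. (a, b') \<in> M \<longrightarrow> rk True (a, b') < rk True e)"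
    by (auto simp: rej_def full_def worse_def ab vt_def qt_def star_def)
  have rF: "rej False M e \<longleftrightarrow> quota I b \<le> card (star False b M) \<and> (\<forall>a'. (a', b) \<in> M \<longrightarrow> rk False (a', b) < rk False e)"
    by (auto simp: rej_def full_def worse_def ab vt_def qt_def star_def)
  have one: "card (star True a M) \<le> 1" using M unfolding asg_def by (metis qt_def)
  have single: "b' = b''" if "(a, b') \<in> M" "(a, b'') \<in> M" for b' b''
  proof (rule ccontr)
    assume "b' \<noteq> b''"
    then have "card {(a, b'), (a, b'')} = 2" by simp
    moreover have "{(a, b'), (a, b'')} \<subseteq> star True a M" using that by (auto simp: vt_def)
    ultimately show False using one card_mono[OF finite_star[OF fin], of "{(a, b'), (a, b'')}" True a] by simp
  qed
  have emp: "\<not> 1 \<le> card (star True a M) \<longleftrightarrow> (\<forall>b'. (a, b') \<notin> M)"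
    using finite_star[OF fin, of True a] by (auto simp: Suc_le_eq card_gt_0_iff star_def vt_def)
  show ?thesis
  proof
    assume bl: "edge_blocks I e M"
    then have A: "\<And>b'. (a, b') \<in> M \<Longrightarrow> rk True e < rk True (a, b')"
      and B: "card (star False b M) < quota I b \<or> (\<exists>a'. (a', b) \<in> M \<and> rk False e < rk False (a', b))"
      using st sc by (auto simp: edge_blocks_def ab card_Image(2))
    have "e \<notin> M" using A ab by blast
    moreover have "\<not> rej True M e" using A emp unfolding rT by (metis less_asym)
    moreover have "\<not> rej False M e" using B unfolding rF by (metis less_asym not_le)
    ultimately show "blk M e" using e unfolding blk_def by (metis (full_types) DiffI)
  next
    assume bl: "blk M e"
    then have eM: "e \<notin> M" and r: "\<not> rej True M e" "\<not> rej False M e" by (auto simp: blk_def)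
    have "rk True e < rk True (a, b')" if b': "(a, b') \<in> M" for b'
    proof -
      have "1 \<le> card (star True a M)" using emp b' by blast
      then obtain b'' where "(a, b'') \<in> M" "\<not> rk True (a, b'') < rk True e" using r(1) rT by blast
      then have "\<not> rk True (a, b') < rk True e" using single[OF b'] by simp
      moreover have "rk True e \<noteq> rk True (a, b')" using neq[OF b' eM] by (simp add: vt_def ab)
      ultimately show ?thesis by simp
    qed
    moreover have "card (star False b M) < quota I b \<or> (\<exists>a'. (a', b) \<in> M \<and> rk False e < rk False (a', b))"
    proof (cases "quota I b \<le> card (star False b M)")
      case True
      then obtain a' where a': "(a', b) \<in> M" "\<not> rk False (a', b) < rk False e" using r(2) rF by blast
      moreover have "rk False e \<noteq> rk False (a', b)" using neq[OF a'(1) eM] by (simp add: vt_def ab)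
      ultimately have "rk False e < rk False (a', b)" by simp
      then show ?thesis using a'(1) by blast
    qed simp
    ultimately show "edge_blocks I e M"
      using e st sc by (auto simp: edge_blocks_def ab card_Image(2))
  qed
qed

lemma legal_property_iff: "legal_property I L \<longleftrightarrow> legal L"
proof -
  have b: "blocks I N M \<longleftrightarrow> \<not> unblocked N M" if "asg M" "asg N" for M N
  proof -
    have "N \<subseteq> edges I" using that by (simp add: asg_def)
    then show ?thesis using edge_blocks_iff[OF that(1)] unfolding blocks_def unblocked_def by blast
  qed
  show ?thesis
    unfolding legal_property_def legal_def is_assignment_iff
  proof
    assume l: "L \<subseteq> {M. asg M} \<and> {M. asg M \<and> (\<exists>M'\<in>L. blocks I M' M)} = {M. asg M} - L"
    show "L = {M. asg M \<and> (\<forall>N\<in>L. unblocked N M)}"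
    proof (intro set_eqI iffI)
      fix M assume "M \<in> L"
      then show "M \<in> {M. asg M \<and> (\<forall>N\<in>L. unblocked N M)}" using l b by blast
    next
      fix M assume "M \<in> {M. asg M \<and> (\<forall>N\<in>L. unblocked N M)}"
      then have "asg M" "\<not> (\<exists>M'\<in>L. blocks I M' M)" using l b by blast+
      then show "M \<in> L" using l by blast
    qed
  next
    assume l: "L = {M. asg M \<and> (\<forall>N\<in>L. unblocked N M)}"
    then have s: "\<And>M. M \<in> L \<Longrightarrow> asg M" by blast
    show "L \<subseteq> {M. asg M} \<and> {M. asg M \<and> (\<exists>M'\<in>L. blocks I M' M)} = {M. asg M} - L"
    proof (intro conjI set_eqI iffI)
      show "L \<subseteq> {M. asg M}" using s by blast
      fix M assume "M \<in> {M. asg M \<and> (\<exists>M'\<in>L. blocks I M' M)}"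
      then show "M \<in> {M. asg M} - L" using s b l by blast
    next
      fix M assume M: "M \<in> {M. asg M} - L"
      then obtain N where "N \<in> L" "\<not> unblocked N M" using l by blast
      then show "M \<in> {M. asg M \<and> (\<exists>M'\<in>L. blocks I M' M)}" using M s b by blast
    qed
  qed
qed

lemma legal_edges_eq:
  assumes M0: "asg M0" "\<forall>e \<in> edges I. \<not> blk M0 e"
    and R: "\<And>d. \<exists>M R. reach d M0 M R (C d) \<and> (\<forall>u. dead d M R u)"
  shows "legal_edges I = \<Union>(C True) \<union> \<Union>(C False)"
proof -
  obtain M R where MR: "\<And>d. reach d M0 (M d) (R d) (C d)" "\<And>d u. dead d (M d) (R d) u"
    using R by metis
  note ch = legal_characterization[OF M0 MR]
  have lp: "legal_property I = legal" by (simp add: fun_eq_iff legal_property_iff)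
  have l: "legal (legal_assignments I)"
    unfolding legal_assignments_def lp by (rule theI'[OF ch(1)])
  have "\<Union>(legal_assignments I) \<subseteq> edges I" using l unfolding legal_def asg_def by blast
  then have "legal_edges I = \<Union>(legal_assignments I)" unfolding legal_edges_def by blast
  also have "\<dots> = \<Union>(C True) \<union> \<Union>(C False)" unfolding ch(2)[OF l] by (auto simp: UNIV_bool)
  finally show ?thesis .
qed

end

section \<open>The stages of the program on encoded instances\<close>

context listing
begin

text \<open>Agrees with \<open>sel\<close> of \<open>edge_lists\<close>, but is available outside
  the interpretations, where both sides occur together.\<close>

definition pick :: "bool \<Rightarrow> (nat \<Rightarrow> nat) \<Rightarrow> (nat \<times> nat) set" where
  "pick d m = (!) (listed d) ` {k. k < n \<and> m k \<noteq> 0}"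

definition cross :: "(nat \<Rightarrow> nat) \<Rightarrow> (nat \<Rightarrow> nat) \<Rightarrow> bool" where
  "cross yp xp \<longleftrightarrow> (\<forall>x<n. yp x < n \<and> ys ! yp x = xs ! x) \<and> (\<forall>y<n. xp y < n \<and> xs ! xp y = ys ! y)"

definition static :: "memory \<Rightarrow> bool" where
  "static s \<longleftrightarrow> s ''edges'' 0 = n \<and>
     s ''student_list_a'' = array (map fst xs) \<and> s ''student_list_b'' = array (map snd xs) \<and>
     s ''school_list_a'' = array (map fst ys) \<and> s ''school_list_b'' = array (map snd ys) \<and>
     s ''quota'' = array (map (quota I) [0..<card (schools I)]) \<and>
     s ''students'' 0 = card (students I) \<and> s ''schools'' 0 = card (schools I)"

definition ready :: "bool \<Rightarrow> memory \<Rightarrow> bool" where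
  "ready d s \<longleftrightarrow>
     (\<forall>k<n. s ''p'' (vt d (listed d ! k)) \<le> k \<and>
        vt d (listed d ! s ''p'' (vt d (listed d ! k))) = vt d (listed d ! k)) \<and>
     (\<forall>t<n. t \<le> s ''thr'' (vt (\<not> d) (listed (\<not> d) ! t)) \<and> s ''thr'' (vt (\<not> d) (listed (\<not> d) ! t)) < n \<and>
        vt (\<not> d) (listed (\<not> d) ! s ''thr'' (vt (\<not> d) (listed (\<not> d) ! t))) = vt (\<not> d) (listed (\<not> d) ! t))"

lemma length_xs: "length xs = n" "length ys = n"
  using length_listed[of True] length_listed[of False] by (simp_all add: listed_def)

lemma distinct_xs: "distinct xs" "distinct ys"
  using distinct_listed[of True] distinct_listed[of False] by (simp_all add: listed_def)

lemma array_nth: "k < n \<Longrightarrow> length l = n \<Longrightarrow> array (map f l) k = f (l ! k)"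
  by (simp add: array_def)

lemma static_tables:
  assumes "static s"
  shows "s ''student_list_a'' = array (map (vt True) (listed True))"
    "s ''student_list_b'' = array (map (vt (\<not> True)) (listed True))"
    "s ''school_list_b'' = array (map (vt False) (listed False))"
    "s ''school_list_a'' = array (map (vt (\<not> False)) (listed False))"
  using assms by (simp_all add: static_def listed_def vt_def[abs_def])

lemma vt_mono:
  assumes "j \<le> k" "k < n" shows "vt d (listed d ! j) \<le> vt d (listed d ! k)"
  using listed_less[of j k d] length_listed[of d] assms by (cases "j = k") auto

lemma edge_lists_listed:
  assumes cr: "\<forall>k<n. cr k < n \<and> listed (\<not> d) ! cr k = listed d ! k"
    and bk: "\<forall>t<n. bk t < n \<and> listed d ! bk t = listed (\<not> d) ! t"
  shows "edge_lists (edges I) vt rk qt d n ((!) (listed d))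
    (array (map (vt d) (listed d))) (array (map (vt (\<not> d)) (listed d))) cr bk"
proof
  note a = array_nth[OF _ length_listed[of d]]
  note rk' = rk_nth[of _ "\<not> d"]
  show "(!) (listed d) ` {..<n} = edges I"
    using set_listed[of d] length_listed[of d] by (auto simp: set_conv_nth)
  fix k j t t'
  show "rk d (listed d ! k) = k" if "k < n" using that by (rule rk_nth)
  show "rk (\<not> d) (listed d ! k) = cr k" if "k < n" using rk'[of "cr k"] cr that by simp
  show "vt d (listed d ! k) = array (map (vt d) (listed d)) k" if "k < n" using a[OF that] by simp
  show "vt (\<not> d) (listed d ! k) = array (map (vt (\<not> d)) (listed d)) k" if "k < n" using a[OF that] by simp
  show "cr k < n" if "k < n" using cr that by simp
  show "bk t < n" if "t < n" using bk that by simp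
  show "bk (cr k) = k" if "k < n"
  proof -
    have "listed d ! bk (cr k) = listed d ! k" "bk (cr k) < n" using cr bk that by auto
    then show ?thesis using rk_nth[of k d] rk_nth[of "bk (cr k)" d] that by simp
  qed
  show "cr (bk t) = t" if "t < n"
  proof -
    have "listed (\<not> d) ! cr (bk t) = listed (\<not> d) ! t" "cr (bk t) < n" using cr bk that by auto
    then show ?thesis using rk'[of t] rk'[of "cr (bk t)"] that by simp
  qed
  show "array (map (vt d) (listed d)) j \<le> array (map (vt d) (listed d)) k" if "j \<le> k" "k < n"
    using that vt_mono a by simp
  show "array (map (vt (\<not> d)) (listed d)) (bk t) \<le> array (map (vt (\<not> d)) (listed d)) (bk t')"
    if "t \<le> t'" "t' < n" using that vt_mono[of t t' "\<not> d"] bk a by simp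
  show "0 < qt (\<not> d) (array (map (vt (\<not> d)) (listed d)) k)" if "k < n"
  proof (cases d)
    case True
    have "listed d ! k \<in> edges I" using that set_listed[of d] length_listed[of d] by (metis nth_mem)
    then have "snd (listed d ! k) \<in> schools I" using inst by (auto simp: stable_assignment_instance_def)
    then show ?thesis using inst True a[OF that] by (simp add: stable_assignment_instance_def qt_def vt_def)
  next
    case False
    then show ?thesis by (simp add: qt_def)
  qed
qed

lemma edge_lists_students:
  "cross yp xp \<Longrightarrow> edge_lists (edges I) vt rk qt True n ((!) (listed True))
    (array (map (vt True) (listed True))) (array (map (vt (\<not> True)) (listed True))) yp xp"
  by (rule edge_lists_listed) (auto simp: cross_def listed_def)

definition zeros :: "memory \<Rightarrow> bool" where
  "zeros s \<longleftrightarrow> s ''m'' = (\<lambda>_. 0) \<and> s ''cnt'' = (\<lambda>_. 0) \<and> s ''fa'' = (\<lambda>_. 0) \<and> s ''fb'' = (\<lambda>_. 0)"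

text \<open>Required at the start of each phase and restored at its end; \<open>out_edges\<close> is
  included because the output counts up from 0.\<close>

definition idle :: "memory \<Rightarrow> bool" where
  "idle s \<longleftrightarrow> (\<forall>v. s ''ons'' v = 0) \<and> s ''sp'' 0 = 0 \<and> s ''out_edges'' 0 = 0"

definition linked :: "memory \<Rightarrow> bool" where
  "linked s \<longleftrightarrow> (\<forall>b. s ''head'' b = last_occ (s ''student_list_b'') b n) \<and>
     (\<forall>x<n. s ''nxt'' x = last_occ (s ''student_list_b'') (s ''student_list_b'' x) x)"

lemma stage_link:
  "halts (for_edges link_body) (input_memory I xs ys) (for_cost link_body * max 1 n)
    (\<lambda>s. static s \<and> zeros s \<and> idle s \<and> linked s)"
proof -
  let ?s = "input_memory I xs ys"
  have s: "static ?s" "zeros ?s" "idle ?s" "?s ''head'' = (\<lambda>_. 0)"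
    by (simp_all add: static_def zeros_def idle_def input_memory_def array_def[of "[_]"])
  then have "?s ''edges'' 0 = n" by (simp add: static_def)
  from halts_unwritten[OF link_correct[OF s(4) this]] show ?thesis
  proof (rule halts_mono, goal_cases)
    case (2 s')
    then have eq: "s' x = ?s x" if "x \<notin> {''i'', ''nxt'', ''head''}" for x
      using that by (simp add: writes_link)
    have sb: "s' ''student_list_b'' = ?s ''student_list_b''" by (rule eq) simp
    have "linked s'" using 2 unfolding linked_def sb by blast
    moreover have "static s'" "zeros s'" "idle s'"
      using s unfolding static_def zeros_def idle_def by (simp_all add: eq)
    ultimately show ?case by blast
  qed simp
qed

lemma stage_match:
  assumes "static s" "zeros s" "idle s" "linked s"
  shows "halts match_prog s (match_cost * max 1 n)
    (\<lambda>s. static s \<and> zeros s \<and> idle s \<and> cross (s ''ypos'') (s ''xpos''))"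
proof -
  let ?xa = "array (map fst xs)" and ?xb = "array (map snd xs)"
    and ?ya = "array (map fst ys)" and ?yb = "array (map snd ys)"
  have S: "s ''edges'' 0 = n" "s ''student_list_a'' = ?xa" "s ''student_list_b'' = ?xb"
    "s ''school_list_a'' = ?ya" "s ''school_list_b'' = ?yb" using assms by (auto simp: static_def)
  note ax = array_nth[OF _ length_xs(1)] note ay = array_nth[OF _ length_xs(2)]
  have ix: "x = x'" if "x < n" "x' < n" "?xa x = ?xa x'" "?xb x = ?xb x'" for x x'
    using that ax distinct_xs(1) length_xs(1) by (metis nth_eq_iff_index_eq prod_eq_iff)
  have iy: "y = y'" if "y < n" "y' < n" "?ya y = ?ya y'" "?yb y = ?yb y'" for y y'
    using that ay distinct_xs(2) length_xs(2) by (metis nth_eq_iff_index_eq prod_eq_iff)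
  have sets: "set xs = set ys" using set_listed[of True] set_listed[of False] by (simp add: listed_def)
  have ex: "\<exists>x<n. ?xa x = ?ya y \<and> ?xb x = ?yb y" if "y < n" for y
  proof -
    have "ys ! y \<in> set xs" using that length_xs sets by simp
    then obtain x where "x < n" "xs ! x = ys ! y" using length_xs by (metis in_set_conv_nth)
    then show ?thesis using ax ay that by auto
  qed
  have mono: "?yb y \<le> ?yb y'" if "y \<le> y'" "y' < n" for y y'
    using vt_mono[of y y' False] that ay by (simp add: vt_def listed_def)
  have L: "\<forall>b. s ''head'' b = last_occ ?xb b n" "\<forall>x<n. s ''nxt'' x = last_occ ?xb (?xb x) x"
    using assms(4) S by (auto simp: linked_def)
  have "halts match_prog s (match_cost * max 1 n) (\<lambda>s'. \<forall>y<n. s' ''xpos'' y < n \<and>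
      ?xa (s' ''xpos'' y) = ?ya y \<and> ?xb (s' ''xpos'' y) = ?yb y \<and> s' ''ypos'' (s' ''xpos'' y) = y)"
    by (rule match_correct[OF S]) (fact ix iy ex mono L)+
  from halts_unwritten[OF this] show ?thesis
  proof (rule halts_mono, goal_cases)
    case (2 s')
    then have eq: "s' x = s x" if "x \<notin> {''j'', ''c'', ''xpos'', ''ypos'', ''tmp''}" for x
      using that by (simp add: writes_match)
    have xp: "s' ''xpos'' y < n" "xs ! s' ''xpos'' y = ys ! y" "s' ''ypos'' (s' ''xpos'' y) = y" if "y < n" for y
      using 2 that ax ay by (auto simp: prod_eq_iff)
    \<comment> \<open>\<open>match_correct\<close> describes \<open>ypos\<close> only on values of
      \<open>xpos\<close>; both listings contain the same edges, so every position is such a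
      value.\<close>
    have yp: "s' ''ypos'' x < n \<and> ys ! s' ''ypos'' x = xs ! x" if "x < n" for x
    proof -
      have "xs ! x \<in> set ys" using nth_mem[of x xs] that length_xs sets by simp
      then obtain y where y: "y < n" "ys ! y = xs ! x" using length_xs by (metis in_set_conv_nth)
      have "s' ''xpos'' y = x"
        using xp[OF y(1)] y(2) that distinct_xs(1) length_xs(1) by (metis nth_eq_iff_index_eq)
      then show ?thesis using xp(3)[OF y(1)] y by auto
    qed
    have "cross (s' ''ypos'') (s' ''xpos'')" using xp yp by (auto simp: cross_def)
    moreover have "static s'" "zeros s'" "idle s'"
      using assms unfolding static_def zeros_def idle_def by (simp_all add: eq)
    ultimately show ?case by blast
  qed simp
qed

lemma stage_prep:
  assumes "static s" and names: "{nu, nv} \<inter> {''thr'', ''p'', ''i'', ''j''} = {}"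
    and nu: "s nu = array (map (vt d) (listed d))" and nv: "s nv = array (map (vt (\<not> d)) (listed (\<not> d)))"
  shows "halts (prep_prog nu nv) s ((for_cost (prep_body nu nv) + 4) * max 1 n)
    (\<lambda>s'. ready d s' \<and> (\<forall>x. x \<notin> {''i'', ''j'', ''p'', ''thr''} \<longrightarrow> s' x = s x))"
proof -
  have "s ''edges'' 0 = n" using assms(1) by (simp add: static_def)
  from halts_unwritten[OF prep_correct[where nu = nu and nv = nv and s = s, OF this names]] show ?thesis
  proof (rule halts_mono, goal_cases)
    case (2 s')
    note a = array_nth[OF _ length_listed[of d]] note b = array_nth[OF _ length_listed[of "\<not> d"]]
    have "ready d s'" unfolding ready_def
    proof (intro conjI allI impI)
      fix k assume k: "k < n"
      have "s' ''p'' (s nu k) \<le> k \<and> s nu (s' ''p'' (s nu k)) = s nu k" using 2 k by blast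
      moreover have "s nu k = vt d (listed d ! k)" using nu a k by simp
      ultimately show "s' ''p'' (vt d (listed d ! k)) \<le> k"
        "vt d (listed d ! s' ''p'' (vt d (listed d ! k))) = vt d (listed d ! k)"
        using nu a[of "s' ''p'' (s nu k)"] k by auto
    next
      fix t assume t: "t < n"
      have "t \<le> s' ''thr'' (s nv t) \<and> s' ''thr'' (s nv t) < n \<and> s nv (s' ''thr'' (s nv t)) = s nv t"
        using 2 t by blast
      moreover have "s nv t = vt (\<not> d) (listed (\<not> d) ! t)" using nv b t by simp
      ultimately show "t \<le> s' ''thr'' (vt (\<not> d) (listed (\<not> d) ! t))"
        "s' ''thr'' (vt (\<not> d) (listed (\<not> d) ! t)) < n"
        "vt (\<not> d) (listed (\<not> d) ! s' ''thr'' (vt (\<not> d) (listed (\<not> d) ! t))) = vt (\<not> d) (listed (\<not> d) ! t)"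
        using nv b[of "s' ''thr'' (s nv t)"] by auto
    qed
    then show ?case using 2 by (simp add: writes_prep)
  qed simp
qed

lemma ready_tables:
  assumes bk: "\<forall>t<n. bk t < n \<and> listed d ! bk t = listed (\<not> d) ! t" and r: "ready d s"
  defines "nu \<equiv> array (map (vt d) (listed d))" and "nw \<equiv> array (map (vt (\<not> d)) (listed d))"
  shows "\<forall>k<n. s ''p'' (nu k) \<le> k \<and> nu (s ''p'' (nu k)) = nu k"
    "\<forall>t<n. t \<le> s ''thr'' (nw (bk t)) \<and> s ''thr'' (nw (bk t)) < n \<and> nw (bk (s ''thr'' (nw (bk t)))) = nw (bk t)"
proof -
  note a = array_nth[OF _ length_listed[of d]]
  show "\<forall>k<n. s ''p'' (nu k) \<le> k \<and> nu (s ''p'' (nu k)) = nu k"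
  proof (intro allI impI)
    fix k assume k: "k < n"
    have *: "s ''p'' (vt d (listed d ! k)) \<le> k" using r k by (simp add: ready_def)
    then show "s ''p'' (nu k) \<le> k \<and> nu (s ''p'' (nu k)) = nu k"
      using r k a[OF k] a[OF le_less_trans[OF * k]] unfolding nu_def ready_def by simp
  qed
  have w: "nw (bk t) = vt (\<not> d) (listed (\<not> d) ! t)" if "t < n" for t
    unfolding nw_def using a[of "bk t"] bk that by simp
  show "\<forall>t<n. t \<le> s ''thr'' (nw (bk t)) \<and> s ''thr'' (nw (bk t)) < n \<and> nw (bk (s ''thr'' (nw (bk t)))) = nw (bk t)"
    using r w by (simp add: ready_def)
qed

definition stable :: "(nat \<times> nat) set \<Rightarrow> bool" where
  "stable M \<longleftrightarrow> asg M \<and> (\<forall>e \<in> edges I. \<not> blk M e)"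

lemma stage_da:
  assumes s: "static s" "zeros s" "idle s" and c: "cross (s ''ypos'') (s ''xpos'')" and r: "ready True s"
  shows "halts da_prog s (da_cost * max 1 n)
    (\<lambda>s. static s \<and> idle s \<and> cross (s ''ypos'') (s ''xpos'') \<and> s ''fa'' = (\<lambda>_. 0) \<and> s ''fb'' = (\<lambda>_. 0) \<and>
      stable (pick True (s ''m'')) \<and>
      (\<forall>k<n. s ''cnt'' (snd (xs ! k)) = card (star False (snd (xs ! k)) (pick True (s ''m'')))))"
proof -
  interpret L: edge_lists "edges I" vt rk qt True n "(!) (listed True)"
    "array (map (vt True) (listed True))" "array (map (vt (\<not> True)) (listed True))" "s ''ypos''" "s ''xpos''"
    by (rule edge_lists_students[OF c])
  have sel: "L.sel m = pick True m" for m by (simp add: L.sel_def pick_def)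
  note a = array_nth[OF _ length_listed[of True]]
  have nw: "array (map (vt (\<not> True)) (listed True)) k = snd (xs ! k)" if "k < n" for k
    using a[OF that] by (simp add: vt_def listed_def)
  have bk: "\<forall>t<n. s ''xpos'' t < n \<and> listed True ! s ''xpos'' t = listed (\<not> True) ! t"
    using c by (simp add: cross_def listed_def)
  have q: "\<forall>k<n. s ''quota'' (array (map (vt (\<not> True)) (listed True)) k) = qt (\<not> True) (array (map (vt (\<not> True)) (listed True)) k)"
  proof (intro allI impI)
    fix k assume k: "k < n"
    have "xs ! k \<in> edges I" using k length_xs(1) set_listed[of True] by (simp add: listed_def) (metis nth_mem)
    then have "snd (xs ! k) \<in> schools I" using inst by (auto simp: stable_assignment_instance_def)
    then have "snd (xs ! k) < card (schools I)" using num unfolding numbered_instance_def by blast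
    then show "s ''quota'' (array (map (vt (\<not> True)) (listed True)) k) = qt (\<not> True) (array (map (vt (\<not> True)) (listed True)) k)"
      using s(1) unfolding nw[OF k] by (simp add: static_def array_def qt_def)
  qed
  have S: "s ''edges'' 0 = n" "s ''m'' = (\<lambda>_. 0)" "s ''cnt'' = (\<lambda>_. 0)" using s by (auto simp: static_def zeros_def)
  have qT: "qt True v = 1" for v by (simp add: qt_def)
  from halts_unwritten[OF L.da_correct[OF S(1) static_tables(1,2)[OF s(1)] refl refl q qT S(2,3) ready_tables[OF bk r]]]
  show ?thesis
  proof (rule halts_mono, goal_cases)
    case (2 s')
    then have eq: "s' x = s x" if "x \<notin> {''i'', ''u'', ''m'', ''cnt'', ''thr'', ''p'', ''f''}" for x
      using that by (simp add: writes_da)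
    have "s' ''cnt'' (snd (xs ! k)) = card (star False (snd (xs ! k)) (pick True (s' ''m'')))" if "k < n" for k
    proof -
      have "s' ''cnt'' (array (map (vt (\<not> True)) (listed True)) k) =
          card (star (\<not> True) (array (map (vt (\<not> True)) (listed True)) k) (L.sel (s' ''m'')))"
        using 2 that by blast
      then show ?thesis unfolding nw[OF that] sel by simp
    qed
    moreover have "stable (pick True (s' ''m''))" using 2 unfolding sel stable_def by blast
    moreover have "static s'" "idle s'" "cross (s' ''ypos'') (s' ''xpos'')" "s' ''fa'' = (\<lambda>_. 0)" "s' ''fb'' = (\<lambda>_. 0)"
      using s c unfolding static_def zeros_def idle_def by (simp_all add: eq)
    ultimately show ?case by blast
  qed simp
qed

definition saved :: "(nat \<times> nat) set \<Rightarrow> memory \<Rightarrow> bool" where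
  "saved M0 s \<longleftrightarrow> stable M0 \<and> pick False (s ''m2'') = M0 \<and>
     (\<forall>k<n. s ''fa'' (fst (ys ! k)) \<noteq> 0 \<longleftrightarrow> full True M0 (fst (ys ! k)))"

lemma cross_inv:
  assumes "cross yp xp"
  shows "x < n \<Longrightarrow> xp (yp x) = x" "y < n \<Longrightarrow> yp (xp y) = y"
  using assms distinct_xs length_xs unfolding cross_def by (metis nth_eq_iff_index_eq)+

lemma stage_save:
  assumes s: "static s" "idle s" and c: "cross (s ''ypos'') (s ''xpos'')"
    and f0: "s ''fa'' = (\<lambda>_. 0)" "s ''fb'' = (\<lambda>_. 0)"
    and M0: "M0 = pick True (s ''m'')" "stable M0"
    and cnt: "\<forall>k<n. s ''cnt'' (snd (xs ! k)) = card (star False (snd (xs ! k)) M0)"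
  shows "halts (for_edges save_body) s (for_cost save_body * max 1 n)
    (\<lambda>s. static s \<and> idle s \<and> cross (s ''ypos'') (s ''xpos'') \<and> saved M0 s \<and>
      pick True (s ''m'') = M0 \<and> pick True (s ''mk'') = M0 \<and>
      (\<forall>k<n. s ''fb'' (snd (xs ! k)) \<noteq> 0 \<longleftrightarrow> full False M0 (snd (xs ! k))))"
proof -
  define m yp xp ct qa xa xb where "m = s ''m''" and "yp = s ''ypos''" and "xp = s ''xpos''" and "ct = s ''cnt''"
    and "qa = s ''quota''" and "xa = s ''student_list_a''" and "xb = s ''student_list_b''"
  let ?J = "\<lambda>k s'. s' ''m'' = m \<and> s' ''ypos'' = yp \<and> s' ''cnt'' = ct \<and> s' ''quota'' = qa \<and>
    s' ''student_list_a'' = xa \<and> s' ''student_list_b'' = xb \<and>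
    (\<forall>x<k. s' ''mk'' x = m x \<and> s' ''m2'' (yp x) = m x) \<and>
    (\<forall>v. s' ''fa'' v \<noteq> 0 \<longleftrightarrow> (\<exists>x<k. m x \<noteq> 0 \<and> xa x = v)) \<and>
    (\<forall>v. s' ''fb'' v \<noteq> 0 \<longleftrightarrow> (\<exists>x<k. xb x = v \<and> ct v = qa v))"
  have n: "s ''edges'' 0 = n" using s by (simp add: static_def)
  have c': "cross yp xp" using c by (simp add: yp_def xp_def)
  have "halts (for_edges save_body) s (for_cost save_body * max 1 n) (?J n)"
  proof (rule halts_for_edges[where J = ?J and s = s and n = n, OF n])
    show "loop_free save_body" by (simp add: save_body_def)
    show "?J 0 (s(''i'' := (s ''i'')(0 := 0)))"
      using f0 by (simp add: m_def yp_def ct_def qa_def xa_def xb_def)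
    fix k s' assume k: "k < n" and J: "?J k s'" and i: "s' ''i'' 0 = k" and e: "s' ''edges'' 0 = n"
    have inj: "yp x \<noteq> yp k" if "x < k" for x
      using cross_inv(1)[OF c', of x] cross_inv(1)[OF c', of k] k that by auto
    have ex: "exec save_body s' = s'(''mk'' := (s' ''mk'')(k := m k), ''m2'' := (s' ''m2'')(yp k := m k),
       ''fa'' := (if m k = 0 then s' ''fa'' else (s' ''fa'')(xa k := 1)),
       ''fb'' := (if ct (xb k) = qa (xb k) then (s' ''fb'')(xb k := 1) else s' ''fb''),
       ''i'' := (s' ''i'')(0 := Suc k))"
      using J i by (auto simp: save_body_def fun_eq_iff)
    show "?J (Suc k) (exec save_body s') \<and> exec save_body s' ''i'' 0 = Suc k \<and> exec save_body s' ''edges'' 0 = n"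
      unfolding ex using J e inj by (auto simp: less_Suc_eq)
  qed
  from halts_unwritten[OF this] show ?thesis
  proof (rule halts_mono, goal_cases)
    case (2 s')
    then have eq: "s' x = s x" if "x \<notin> {''i'', ''mk'', ''m2'', ''fa'', ''fb''}" for x
      using that by (simp add: writes_save)
    have J: "?J n s'" using 2 by blast
    have st: "static s'" "idle s'" "cross (s' ''ypos'') (s' ''xpos'')"
      using s c unfolding static_def idle_def by (simp_all add: eq)
    have mk: "pick True (s' ''m'') = M0" "pick True (s' ''mk'') = M0"
      using J M0 by (auto simp: pick_def m_def)
    have m2: "s' ''m2'' y = m (xp y)" "xp y < n" "xs ! xp y = ys ! y" if "y < n" for y
      using J c' that cross_inv(2)[OF c' that] by (auto simp: cross_def)
    have "pick False (s' ''m2'') = M0"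
    proof
      show "pick False (s' ''m2'') \<subseteq> M0"
      proof
        fix e assume "e \<in> pick False (s' ''m2'')"
        then obtain y where "y < n" "s' ''m2'' y \<noteq> 0" "e = ys ! y" by (auto simp: pick_def listed_def)
        then have "xp y < n" "m (xp y) \<noteq> 0" "e = xs ! xp y" using m2[of y] by auto
        then show "e \<in> M0" unfolding M0(1) pick_def listed_def m_def by auto
      qed
      show "M0 \<subseteq> pick False (s' ''m2'')"
      proof
        fix e assume "e \<in> M0"
        then obtain x where x: "x < n" "m x \<noteq> 0" "e = xs ! x" by (auto simp: M0 pick_def listed_def m_def)
        then have "yp x < n" "ys ! yp x = e" "s' ''m2'' (yp x) \<noteq> 0" using c' J by (auto simp: cross_def)
        then show "e \<in> pick False (s' ''m2'')" unfolding pick_def listed_def by (auto intro!: image_eqI[of _ _ "yp x"])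
      qed
    qed
    moreover have "s' ''fa'' v \<noteq> 0 \<longleftrightarrow> full True M0 v" for v
    proof -
      have xa: "xa x = fst (xs ! x)" if "x < n" for x
        using s(1) array_nth[OF that length_xs(1)] by (simp add: static_def xa_def)
      have "finite (star True v M0)" using M0(2) asg_finite finite_star by (auto simp: stable_def)
      \<comment> \<open>With quota one a single held edge makes a student full, so \<open>fa\<close>
        needs no counter.\<close>
      then have "full True M0 v \<longleftrightarrow> star True v M0 \<noteq> {}"
        by (auto simp: full_def qt_def Suc_le_eq card_gt_0_iff)
      also have "\<dots> \<longleftrightarrow> (\<exists>x<n. m x \<noteq> 0 \<and> xa x = v)"
      proof
        assume "star True v M0 \<noteq> {}"
        then obtain e where "e \<in> M0" "fst e = v" by (auto simp: star_def vt_def)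
        then obtain x where "x < n" "m x \<noteq> 0" "fst (xs ! x) = v"
          unfolding M0(1) pick_def listed_def m_def by auto
        then show "\<exists>x<n. m x \<noteq> 0 \<and> xa x = v" using xa by auto
      next
        assume "\<exists>x<n. m x \<noteq> 0 \<and> xa x = v"
        then obtain x where "x < n" "m x \<noteq> 0" "fst (xs ! x) = v" using xa by auto
        then have "xs ! x \<in> star True v M0"
          unfolding M0(1) pick_def listed_def m_def by (simp add: vt_def)
        then show "star True v M0 \<noteq> {}" by blast
      qed
      finally show ?thesis using J by simp
    qed
    ultimately have "saved M0 s'" using M0(2) by (simp add: saved_def)
    moreover have "s' ''fb'' (snd (xs ! k)) \<noteq> 0 \<longleftrightarrow> full False M0 (snd (xs ! k))" if k: "k < n" for k
    proof -
      let ?b = "snd (xs ! k)"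
      have xb: "xb k = ?b" using s(1) array_nth[OF k length_xs(1)] by (simp add: static_def xb_def)
      have "xs ! k \<in> edges I" using k length_xs(1) set_listed[of True] by (simp add: listed_def) (metis nth_mem)
      then have "?b \<in> schools I" using inst by (auto simp: stable_assignment_instance_def)
      then have "?b < card (schools I)" using num unfolding numbered_instance_def by blast
      then have q: "qa ?b = quota I ?b" using s(1) by (simp add: qa_def static_def array_def)
      have "card (star False ?b M0) \<le> quota I ?b"
        using M0(2) unfolding stable_def asg_def by (metis qt_def)
      then have "full False M0 ?b \<longleftrightarrow> ct ?b = qa ?b"
        using cnt k q by (auto simp: full_def qt_def ct_def)
      also have "\<dots> \<longleftrightarrow> (\<exists>x<n. xb x = ?b \<and> ct ?b = qa ?b)" using xb k by blast
      finally show ?thesis using J by blast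
    qed
    ultimately show ?case using st mk by blast
  qed simp
qed

lemma stage_phase:
  assumes names: "{nuN, nwN, crN, bkN, flN} \<inter> scratch = {}"
    and s: "static s" "idle s" "ready d s" and M0: "stable M0"
    and nu: "s nuN = array (map (vt d) (listed d))" and nw: "s nwN = array (map (vt (\<not> d)) (listed d))"
    and cr: "\<forall>k<n. s crN k < n \<and> listed (\<not> d) ! s crN k = listed d ! k"
    and bk: "\<forall>t<n. s bkN t < n \<and> listed d ! s bkN t = listed (\<not> d) ! t"
    and fl: "\<forall>k<n. s flN (vt (\<not> d) (listed d ! k)) \<noteq> 0 \<longleftrightarrow> full (\<not> d) M0 (vt (\<not> d) (listed d ! k))"
    and m: "pick d (s ''m'') = M0" "pick d (s ''mk'') = M0"
  shows "halts (phase_prog nuN nwN crN bkN flN) s (phase_cost nuN nwN crN bkN flN * max 1 n)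
    (\<lambda>s'. idle s' \<and> (\<forall>x. x \<notin> scratch \<longrightarrow> s' x = s x) \<and>
      (\<exists>M R C. reach d M0 M R C \<and> (\<forall>u. dead d M R u) \<and> pick d (s' ''mk'') = \<Union>C))"
proof -
  interpret L: edge_lists "edges I" vt rk qt d n "(!) (listed d)"
    "array (map (vt d) (listed d))" "array (map (vt (\<not> d)) (listed d))" "s crN" "s bkN"
    by (rule edge_lists_listed[OF cr bk])
  interpret L: phase "edges I" vt rk qt d n "(!) (listed d)"
    "array (map (vt d) (listed d))" "array (map (vt (\<not> d)) (listed d))" "s crN" "s bkN" M0 "s flN"
  proof
    show "asg M0" "\<forall>e \<in> edges I. \<not> blk M0 e" using M0 by (auto simp: stable_def)
    fix k assume k: "k < n"
    show "s flN (array (map (vt (\<not> d)) (listed d)) k) \<noteq> 0 \<longleftrightarrow> full (\<not> d) M0 (array (map (vt (\<not> d)) (listed d)) k)"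
      using fl k array_nth[OF k length_listed[of d]] by simp
  qed
  have sel: "L.sel m = pick d m" for m by (simp add: L.sel_def pick_def)
  have tab: "L.tables nuN nwN crN bkN flN s" using s nu nw by (simp add: L.tables_def static_def)
  have o: "\<forall>v. s ''ons'' v = 0" "s ''sp'' 0 = 0" using s by (auto simp: idle_def)
  from halts_unwritten[OF L.phase_correct[OF names tab ready_tables[OF bk s(3)] m[folded sel] o]]
  show ?thesis
  proof (rule halts_mono, goal_cases)
    case (2 s')
    then have eq: "s' x = s x" if "x \<notin> scratch" for x using that by (simp add: writes_phase)
    have "s' ''out_edges'' = s ''out_edges''" by (rule eq) (simp add: scratch_def)
    then have "idle s'" using 2 s by (simp add: idle_def)
    then show ?case using 2 eq unfolding sel by blast
  qed simp
qed

lemma scratch_static: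
  assumes "\<forall>x. x \<notin> scratch \<longrightarrow> s' x = s x"
  shows "static s' \<longleftrightarrow> static s" "s' ''ypos'' = s ''ypos''" "s' ''xpos'' = s ''xpos''"
    "s' ''m2'' = s ''m2''" "s' ''fa'' = s ''fa''" "s' ''mk1'' = s ''mk1''"
  using assms by (simp_all add: static_def scratch_def)

definition explored :: "bool \<Rightarrow> (nat \<times> nat) set \<Rightarrow> (nat \<times> nat) set \<Rightarrow> bool" where
  "explored d M0 K \<longleftrightarrow> (\<exists>M R C. reach d M0 M R C \<and> (\<forall>u. dead d M R u) \<and> K = \<Union>C)"

lemma stage_student_phase:
  assumes s: "static s" "idle s" "ready True s" and c: "cross (s ''ypos'') (s ''xpos'')" and sv: "saved M0 s"
    and m: "pick True (s ''m'') = M0" "pick True (s ''mk'') = M0"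
    and fb: "\<forall>k<n. s ''fb'' (snd (xs ! k)) \<noteq> 0 \<longleftrightarrow> full False M0 (snd (xs ! k))"
  shows "halts student_phase s (phase_cost ''student_list_a'' ''student_list_b'' ''ypos'' ''xpos'' ''fb'' * max 1 n)
    (\<lambda>s. static s \<and> idle s \<and> cross (s ''ypos'') (s ''xpos'') \<and> saved M0 s \<and> explored True M0 (pick True (s ''mk'')))"
proof -
  have "halts student_phase s (phase_cost ''student_list_a'' ''student_list_b'' ''ypos'' ''xpos'' ''fb'' * max 1 n)
    (\<lambda>s'. idle s' \<and> (\<forall>x. x \<notin> scratch \<longrightarrow> s' x = s x) \<and>
      (\<exists>M R C. reach True M0 M R C \<and> (\<forall>u. dead True M R u) \<and> pick True (s' ''mk'') = \<Union>C))"
    by (rule stage_phase[OF _ s _ static_tables(1,2)[OF s(1)]])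
      (use c sv m fb in \<open>auto simp: scratch_def saved_def cross_def listed_def vt_def\<close>)
  then show ?thesis
  proof (rule halts_mono, goal_cases)
    case (2 s')
    then have eq: "\<forall>x. x \<notin> scratch \<longrightarrow> s' x = s x" by blast
    then have "static s'" "cross (s' ''ypos'') (s' ''xpos'')" "saved M0 s'"
      using s c sv by (simp_all add: scratch_static[OF eq] saved_def)
    then show ?case using 2 unfolding explored_def by blast
  qed simp
qed

lemma stage_switch:
  assumes s: "static s" "idle s" and c: "cross (s ''ypos'') (s ''xpos'')" and sv: "saved M0 s"
    and ex: "explored True M0 (pick True (s ''mk''))"
  shows "halts (for_edges switch_body) s (for_cost switch_body * max 1 n)
    (\<lambda>s. static s \<and> idle s \<and> cross (s ''ypos'') (s ''xpos'') \<and> saved M0 s \<and>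
      explored True M0 (pick True (s ''mk1'')) \<and> pick False (s ''m'') = M0 \<and> pick False (s ''mk'') = M0)"
proof -
  define mk m2 where "mk = s ''mk''" and "m2 = s ''m2''"
  let ?J = "\<lambda>k s'. s' ''m2'' = m2 \<and> (\<forall>x<k. s' ''mk1'' x = mk x \<and> s' ''m'' x = m2 x \<and> s' ''mk'' x = m2 x) \<and>
    (\<forall>x\<ge>k. s' ''mk'' x = mk x)"
  have n: "s ''edges'' 0 = n" using s by (simp add: static_def)
  have "halts (for_edges switch_body) s (for_cost switch_body * max 1 n) (?J n)"
    by (rule halts_for_edges[where J = ?J and s = s and n = n, OF n])
      (auto simp: switch_body_def mk_def m2_def less_Suc_eq)
  from halts_unwritten[OF this] show ?thesis
  proof (rule halts_mono, goal_cases)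
    case (2 s')
    then have eq: "s' x = s x" if "x \<notin> {''i'', ''mk1'', ''m'', ''mk''}" for x
      using that by (simp add: writes_switch)
    have J: "?J n s'" using 2 by blast
    have "static s'" "idle s'" "cross (s' ''ypos'') (s' ''xpos'')" "saved M0 s'"
      using s c sv unfolding static_def idle_def saved_def by (simp_all add: eq)
    moreover have "pick True (s' ''mk1'') = pick True mk" "pick False (s' ''m'') = pick False m2"
      "pick False (s' ''mk'') = pick False m2" using J by (auto simp: pick_def)
    ultimately show ?case using ex sv by (simp add: mk_def m2_def saved_def)
  qed simp
qed

lemma stage_school_phase:
  assumes s: "static s" "idle s" "ready False s" and c: "cross (s ''ypos'') (s ''xpos'')" and sv: "saved M0 s"
    and m: "pick False (s ''m'') = M0" "pick False (s ''mk'') = M0" and ex: "explored True M0 (pick True (s ''mk1''))"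
  shows "halts school_phase s (phase_cost ''school_list_b'' ''school_list_a'' ''xpos'' ''ypos'' ''fa'' * max 1 n)
    (\<lambda>s. static s \<and> idle s \<and> cross (s ''ypos'') (s ''xpos'') \<and> stable M0 \<and>
      explored True M0 (pick True (s ''mk1'')) \<and> explored False M0 (pick False (s ''mk'')))"
proof -
  have "halts school_phase s (phase_cost ''school_list_b'' ''school_list_a'' ''xpos'' ''ypos'' ''fa'' * max 1 n)
    (\<lambda>s'. idle s' \<and> (\<forall>x. x \<notin> scratch \<longrightarrow> s' x = s x) \<and>
      (\<exists>M R C. reach False M0 M R C \<and> (\<forall>u. dead False M R u) \<and> pick False (s' ''mk'') = \<Union>C))"
    by (rule stage_phase[OF _ s _ static_tables(3,4)[OF s(1)]])
      (use c sv m in \<open>auto simp: scratch_def saved_def cross_def listed_def vt_def\<close>)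
  then show ?thesis
  proof (rule halts_mono, goal_cases)
    case (2 s')
    then have eq: "\<forall>x. x \<notin> scratch \<longrightarrow> s' x = s x" by blast
    then have "static s'" "cross (s' ''ypos'') (s' ''xpos'')" "explored True M0 (pick True (s' ''mk1''))"
      using s c ex by (simp_all add: scratch_static[OF eq])
    then show ?case using 2 sv unfolding explored_def saved_def by blast
  qed simp
qed

text \<open>One scan of the students' listing consults the marks of both phases, the second through
  \<open>ypos\<close>, so an edge visited in both is output once.\<close>

lemma stage_out:
  assumes s: "static s" "idle s" and c: "cross (s ''ypos'') (s ''xpos'')"
  shows "halts (for_edges out_body) s (for_cost out_body * max 1 n)
    (\<lambda>s'. static s' \<and> distinct (output_edges s') \<and>
      set (output_edges s') = pick True (s ''mk1'') \<union> pick False (s ''mk''))"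
proof -
  define mk1 mk yp where "mk1 = s ''mk1''" and "mk = s ''mk''" and "yp = s ''ypos''"
  let ?sel = "\<lambda>x. \<not> (mk1 x = 0 \<and> mk (yp x) = 0)"
  have n: "s ''edges'' 0 = n" using s by (simp add: static_def)
  let ?J = "\<lambda>k s'. s' ''mk1'' = mk1 \<and> s' ''mk'' = mk \<and> s' ''ypos'' = yp \<and>
    s' ''student_list_a'' = array (map fst xs) \<and> s' ''student_list_b'' = array (map snd xs) \<and>
    output_edges s' = map ((!) xs) (filter ?sel [0..<k])"
  have "halts (for_edges out_body) s (for_cost out_body * max 1 n) (?J n)"
  proof (rule halts_for_edges[where J = ?J and s = s and n = n, OF n])
    show "loop_free out_body" by (simp add: out_body_def)
    show "?J 0 (s(''i'' := (s ''i'')(0 := 0)))"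
      using s by (simp add: static_def idle_def output_edges_def mk1_def mk_def yp_def)
    fix k s' assume k: "k < n" and J: "?J k s'" and i: "s' ''i'' 0 = k" and e: "s' ''edges'' 0 = n"
    have ab: "array (map fst xs) k = fst (xs ! k)" "array (map snd xs) k = snd (xs ! k)"
      using array_nth[OF k length_xs(1)] by auto
    show "?J (Suc k) (exec out_body s') \<and> exec out_body s' ''i'' 0 = Suc k \<and> exec out_body s' ''edges'' 0 = n"
    proof (cases "?sel k")
      case True
      let ?o = "s' ''out_edges'' 0"
      have ex: "exec out_body s' = s'(''out_a'' := (s' ''out_a'')(?o := fst (xs ! k)),
          ''out_b'' := (s' ''out_b'')(?o := snd (xs ! k)), ''out_edges'' := (s' ''out_edges'')(0 := Suc ?o),
          ''i'' := (s' ''i'')(0 := Suc k))"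
        using J i True ab by (auto simp: out_body_def)
      have "output_edges (exec out_body s') = output_edges s' @ [xs ! k]"
        unfolding ex by (simp add: output_edges_def)
      then show ?thesis using J e True by (simp add: ex)
    next
      case False
      then have ex: "exec out_body s' = s'(''i'' := (s' ''i'')(0 := Suc k))"
        using J i by (auto simp: out_body_def)
      have "output_edges (exec out_body s') = output_edges s'"
        unfolding ex by (simp add: output_edges_def)
      then show ?thesis using J e False by (simp add: ex)
    qed
  qed
  from halts_unwritten[OF this] show ?thesis
  proof (rule halts_mono, goal_cases)
    case (2 s')
    then have eq: "s' x = s x" if "x \<notin> {''i'', ''out_a'', ''out_b'', ''out_edges''}" for x
      using that by (simp add: writes_out)
    have J: "output_edges s' = map ((!) xs) (filter ?sel [0..<n])" using 2 by blast
    have "static s'" using s unfolding static_def by (simp add: eq)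
    moreover have "distinct (output_edges s')"
      unfolding J distinct_map using distinct_xs(1) length_xs(1)
      by (auto simp: inj_on_def nth_eq_iff_index_eq)
    moreover have "set (output_edges s') = pick True mk1 \<union> pick False mk"
    proof -
      have "set (output_edges s') = (!) xs ` {x. x < n \<and> (mk1 x \<noteq> 0 \<or> mk (yp x) \<noteq> 0)}"
        unfolding J by (auto simp: image_iff)
      also have "\<dots> = pick True mk1 \<union> (!) xs ` {x. x < n \<and> mk (yp x) \<noteq> 0}"
        by (auto simp: pick_def listed_def)
      also have "(!) xs ` {x. x < n \<and> mk (yp x) \<noteq> 0} = pick False mk"
      proof
        show "(!) xs ` {x. x < n \<and> mk (yp x) \<noteq> 0} \<subseteq> pick False mk"
        proof
          fix e assume "e \<in> (!) xs ` {x. x < n \<and> mk (yp x) \<noteq> 0}"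
          then obtain x where x: "x < n" "mk (yp x) \<noteq> 0" "e = xs ! x" by auto
          then have "yp x < n" "e = ys ! yp x" using c by (auto simp: cross_def yp_def)
          then show "e \<in> pick False mk" using x by (auto simp: pick_def listed_def)
        qed
        show "pick False mk \<subseteq> (!) xs ` {x. x < n \<and> mk (yp x) \<noteq> 0}"
        proof
          fix e assume "e \<in> pick False mk"
          then obtain y where y: "y < n" "mk y \<noteq> 0" "e = ys ! y" by (auto simp: pick_def listed_def)
          have "s ''xpos'' y < n" "xs ! s ''xpos'' y = e" "yp (s ''xpos'' y) = y"
            using c y cross_inv(2)[OF c y(1)] by (auto simp: cross_def yp_def)
          then show "e \<in> (!) xs ` {x. x < n \<and> mk (yp x) \<noteq> 0}" using y(2)
            by (intro image_eqI[of _ _ "s ''xpos'' y"]) auto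
        qed
      qed
      finally show ?thesis .
    qed
    ultimately show ?case by (simp add: mk1_def mk_def)
  qed simp
qed

end

text \<open>Bracketed like \<open>main_prog\<close>, so that \<open>halts_Seq_linear\<close> applies
  stage by stage; the final 20 covers the two writes of the vertex counts.\<close>

definition main_cost :: nat where
  "main_cost = for_cost link_body + (match_cost +
     (for_cost (prep_body ''student_list_a'' ''school_list_b'') + 4 + (da_cost + (for_cost save_body +
     (for_cost (prep_body ''student_list_a'' ''school_list_b'') + 4 +
     (phase_cost ''student_list_a'' ''student_list_b'' ''ypos'' ''xpos'' ''fb'' + (for_cost switch_body +
     (for_cost (prep_body ''school_list_b'' ''student_list_a'') + 4 +
     (phase_cost ''school_list_b'' ''school_list_a'' ''xpos'' ''ypos'' ''fa'' + (for_cost out_body + 20))))))))))"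

context listing
begin

lemma prep_static:
  assumes "\<forall>x. x \<notin> {''i'', ''j'', ''p'', ''thr''} \<longrightarrow> s' x = s x"
  shows "static s' \<longleftrightarrow> static s" "idle s' \<longleftrightarrow> idle s" "zeros s' \<longleftrightarrow> zeros s" "saved M0 s' \<longleftrightarrow> saved M0 s"
    "s' ''ypos'' = s ''ypos''" "s' ''xpos'' = s ''xpos''" "s' ''m'' = s ''m''" "s' ''mk'' = s ''mk''"
    "s' ''mk1'' = s ''mk1''" "s' ''fb'' = s ''fb''"
  using assms by (simp_all add: static_def idle_def zeros_def saved_def)

lemma explored_legal_edges:
  assumes M0: "stable M0" and "explored True M0 K" "explored False M0 K'"
  shows "legal_edges I = K \<union> K'"
proof -
  obtain C C' where C: "\<exists>M R. reach True M0 M R C \<and> (\<forall>u. dead True M R u)" "K = \<Union>C"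
    "\<exists>M R. reach False M0 M R C' \<and> (\<forall>u. dead False M R u)" "K' = \<Union>C'"
    using assms unfolding explored_def by blast
  then have "\<exists>M R. reach d M0 M R (if d then C else C') \<and> (\<forall>u. dead d M R u)" for d by (cases d) simp_all
  then have "legal_edges I = \<Union>(if True then C else C') \<union> \<Union>(if False then C else C')"
    using M0 legal_edges_eq[of M0 "\<lambda>d. if d then C else C'"] unfolding stable_def by blast
  then show ?thesis using C by simp
qed

text \<open>Assembled from the last stage backwards: each numbered fact treats the rest of the
  program from one stage on.\<close>

lemma main_correct:
  "halts main_prog (input_memory I xs ys) (main_cost * max 1 n) (\<lambda>s. outputs_graph s (legal_graph I))"
proof -
  let ?Q = "\<lambda>s. outputs_graph s (legal_graph I)" and ?N = "max 1 n"
  let ?p12 = "set_var ''out_students'' (var ''students'') ;; set_var ''out_schools'' (var ''schools'')"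
  let ?p11 = "for_edges out_body ;; ?p12" and ?c11 = "for_cost out_body + 20"
  let ?p10 = "school_phase ;; ?p11"
    and ?c10 = "phase_cost ''school_list_b'' ''school_list_a'' ''xpos'' ''ypos'' ''fa'' + ?c11"
  let ?p9 = "prep_prog ''school_list_b'' ''student_list_a'' ;; ?p10"
    and ?c9 = "for_cost (prep_body ''school_list_b'' ''student_list_a'') + 4 + ?c10"
  let ?p8 = "for_edges switch_body ;; ?p9" and ?c8 = "for_cost switch_body + ?c9"
  let ?p7 = "student_phase ;; ?p8"
    and ?c7 = "phase_cost ''student_list_a'' ''student_list_b'' ''ypos'' ''xpos'' ''fb'' + ?c8"
  let ?p6 = "prep_prog ''student_list_a'' ''school_list_b'' ;; ?p7"
    and ?c6 = "for_cost (prep_body ''student_list_a'' ''school_list_b'') + 4 + ?c7"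
  let ?p5 = "for_edges save_body ;; ?p6" and ?c5 = "for_cost save_body + ?c6"
  let ?p4 = "da_prog ;; ?p5" and ?c4 = "da_cost + ?c5"
  let ?p3 = "prep_prog ''student_list_a'' ''school_list_b'' ;; ?p4"
    and ?c3 = "for_cost (prep_body ''student_list_a'' ''school_list_b'') + 4 + ?c4"
  let ?cr = "\<lambda>s. cross (s ''ypos'') (s ''xpos'')"
  have 12: "halts ?p12 s (20 * ?N) ?Q"
    if s: "static s" "distinct (output_edges s)" "set (output_edges s) = legal_edges I" for s
  proof (rule halts_mono[OF halts_exec[where Q = ?Q]])
    have V: "students I = {..<card (students I)}" "schools I = {..<card (schools I)}"
      using num unfolding numbered_instance_def by blast+
    have o: "output_edges (exec ?p12 s) = output_edges s" by (simp add: output_edges_def)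
    have "exec ?p12 s ''out_students'' 0 = card (students I)" "exec ?p12 s ''out_schools'' 0 = card (schools I)"
      using s(1) by (simp_all add: static_def)
    then show "?Q (exec ?p12 s)"
      unfolding outputs_graph_def legal_graph_def o using s V by simp
  qed simp_all
  have 11: "halts ?p11 s (?c11 * ?N) ?Q"
    if s: "static s" "idle s" "?cr s" "stable M0" "explored True M0 (pick True (s ''mk1''))"
      "explored False M0 (pick False (s ''mk''))" for s M0
    by (rule halts_Seq_linear[OF stage_out[OF s(1-3)]]) (use explored_legal_edges[OF s(4-6)] 12 in auto)
  have 10: "halts ?p10 s (?c10 * ?N) ?Q"
    if s: "static s" "idle s" "ready False s" "?cr s" "saved M0 s" "pick False (s ''m'') = M0"
      "pick False (s ''mk'') = M0" "explored True M0 (pick True (s ''mk1''))" for s M0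
    by (rule halts_Seq_linear[OF stage_school_phase[OF s]]) (use 11 in blast)
  have 9: "halts ?p9 s (?c9 * ?N) ?Q"
    if s: "static s" "idle s" "?cr s" "saved M0 s" "explored True M0 (pick True (s ''mk1''))"
      "pick False (s ''m'') = M0" "pick False (s ''mk'') = M0" for s M0
  proof (rule halts_Seq_linear[OF stage_prep[where d = False, OF s(1)]])
    show "{''school_list_b'', ''student_list_a''} \<inter> {''thr'', ''p'', ''i'', ''j''} = {}" by simp
    show "s ''school_list_b'' = array (map (vt False) (listed False))"
      "s ''student_list_a'' = array (map (vt (\<not> False)) (listed (\<not> False)))"
      using static_tables[OF s(1)] by simp_all
    fix s' assume s': "ready False s' \<and> (\<forall>x. x \<notin> {''i'', ''j'', ''p'', ''thr''} \<longrightarrow> s' x = s x)"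
    then have r: "ready False s'" and f: "\<forall>x. x \<notin> {''i'', ''j'', ''p'', ''thr''} \<longrightarrow> s' x = s x" by blast+
    show "halts ?p10 s' (?c10 * ?N) ?Q"
      by (rule 10[OF _ _ r]) (use s in \<open>simp_all add: prep_static[OF f]\<close>)
  qed
  have 8: "halts ?p8 s (?c8 * ?N) ?Q"
    if s: "static s" "idle s" "?cr s" "saved M0 s" "explored True M0 (pick True (s ''mk''))" for s M0
    by (rule halts_Seq_linear[OF stage_switch[OF s]]) (use 9 in blast)
  have 7: "halts ?p7 s (?c7 * ?N) ?Q"
    if s: "static s" "idle s" "ready True s" "?cr s" "saved M0 s" "pick True (s ''m'') = M0"
      "pick True (s ''mk'') = M0" "\<forall>k<n. s ''fb'' (snd (xs ! k)) \<noteq> 0 \<longleftrightarrow> full False M0 (snd (xs ! k))" for s M0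
    by (rule halts_Seq_linear[OF stage_student_phase[OF s]]) (use 8 in blast)
  have prepT: "halts (prep_prog ''student_list_a'' ''school_list_b'') s
      ((for_cost (prep_body ''student_list_a'' ''school_list_b'') + 4) * ?N)
      (\<lambda>s'. ready True s' \<and> (\<forall>x. x \<notin> {''i'', ''j'', ''p'', ''thr''} \<longrightarrow> s' x = s x))" if s: "static s" for s
  proof (rule stage_prep[OF s])
    show "{''student_list_a'', ''school_list_b''} \<inter> {''thr'', ''p'', ''i'', ''j''} = {}" by simp
    show "s ''student_list_a'' = array (map (vt True) (listed True))"
      "s ''school_list_b'' = array (map (vt (\<not> True)) (listed (\<not> True)))"
      using static_tables[OF s] by simp_all
  qed
  have 6: "halts ?p6 s (?c6 * ?N) ?Q"
    if s: "static s" "idle s" "?cr s" "saved M0 s" "pick True (s ''m'') = M0"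
      "pick True (s ''mk'') = M0" "\<forall>k<n. s ''fb'' (snd (xs ! k)) \<noteq> 0 \<longleftrightarrow> full False M0 (snd (xs ! k))" for s M0
  proof (rule halts_Seq_linear[OF prepT[OF s(1)]])
    fix s' assume s': "ready True s' \<and> (\<forall>x. x \<notin> {''i'', ''j'', ''p'', ''thr''} \<longrightarrow> s' x = s x)"
    then have r: "ready True s'" and f: "\<forall>x. x \<notin> {''i'', ''j'', ''p'', ''thr''} \<longrightarrow> s' x = s x" by blast+
    show "halts ?p7 s' (?c7 * ?N) ?Q"
      by (rule 7[OF _ _ r, of M0], unfold prep_static[OF f]) (fact s)+
  qed
  have 5: "halts ?p5 s (?c5 * ?N) ?Q"
    if s: "static s" "idle s" "?cr s" "s ''fa'' = (\<lambda>_. 0)" "s ''fb'' = (\<lambda>_. 0)" "stable (pick True (s ''m''))"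
      "\<forall>k<n. s ''cnt'' (snd (xs ! k)) = card (star False (snd (xs ! k)) (pick True (s ''m'')))" for s
    by (rule halts_Seq_linear[OF stage_save[OF s(1-5) refl s(6,7)]]) (use 6 in blast)
  have 4: "halts ?p4 s (?c4 * ?N) ?Q" if s: "static s" "zeros s" "idle s" "?cr s" "ready True s" for s
    by (rule halts_Seq_linear[OF stage_da[OF s]]) (use 5 in blast)
  have 3: "halts ?p3 s (?c3 * ?N) ?Q" if s: "static s" "zeros s" "idle s" "?cr s" for s
  proof (rule halts_Seq_linear[OF prepT[OF s(1)]])
    fix s' assume s': "ready True s' \<and> (\<forall>x. x \<notin> {''i'', ''j'', ''p'', ''thr''} \<longrightarrow> s' x = s x)"
    then have r: "ready True s'" and f: "\<forall>x. x \<notin> {''i'', ''j'', ''p'', ''thr''} \<longrightarrow> s' x = s x" by blast+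
    show "halts ?p4 s' (?c4 * ?N) ?Q"
      by (rule 4[OF _ _ _ _ r]) (use s in \<open>simp_all add: prep_static[OF f]\<close>)
  qed
  have 2: "halts (match_prog ;; ?p3) s ((match_cost + ?c3) * ?N) ?Q"
    if s: "static s" "zeros s" "idle s" "linked s" for s
    by (rule halts_Seq_linear[OF stage_match[OF s]]) (use 3 in blast)
  show ?thesis
    unfolding main_prog_def main_cost_def by (rule halts_Seq_linear[OF stage_link]) (use 2 in blast)
qed

end

text \<open>\<open>max 1\<close> covers instances without edges, where constant overhead remains;
  isolated vertices cost nothing, since only listing positions are scanned.\<close>

theorem theorem7:
  "\<exists>(prog :: com) (c :: nat).
     \<forall>(I :: (nat, nat) assignment_instance) xs ys.
       numbered_instance I \<longrightarrow> student_listing I xs \<longrightarrow> school_listing I ys \<longrightarrow>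
       (\<exists>t s. runs prog (input_memory I xs ys) t s \<and>
              t \<le> c * max 1 (card (edges I)) \<and>
              outputs_graph s (legal_graph I))"
proof (rule exI[of _ main_prog], rule exI[of _ main_cost], intro allI impI)
  fix I :: "(nat, nat) assignment_instance" and xs ys
  assume "numbered_instance I" "student_listing I xs" "school_listing I ys"
  then interpret listing I xs ys by unfold_locales
  show "\<exists>t s. runs main_prog (input_memory I xs ys) t s \<and>
              t \<le> main_cost * max 1 (card (edges I)) \<and> outputs_graph s (legal_graph I)"
    using main_correct by (simp add: halts_def)
qed

end
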